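(* If $Z=(X,Y)\in\Omega_{ff}$, then $Z$ is locally $\Sigma$-equivalent near the origin to $Z_{ff}=(X_{ff},Y_{ff})\in\Omega_{ff}$, where $$X_{ff}(x,y)=(\alpha x-y,\ x+\alpha y),\qquad Y_{ff}(x,y)=(\alpha x-y,\ x+\alpha y),$$ and $\alpha=\mathrm{sign}\,\ell$, with $\ell\neq0$ the quantity associated with $Z$.
   Context: Let $\mathcal U\subset\mathbb R^2$ be a bounded open set containing the origin $O$, and let $\mathfrak X$ be the set of $\mathcal C^1$ vector fields on $\mathcal U$. Put $\Sigma^+=\{(x,y)\in\mathcal U:y>0\}$, $\Sigma^-=\{(x,y)\in\mathcal U:y<0\}$, $\Sigma=\{(x,y)\in\mathcal U:y=0\}$ (the switching line). $\Omega$ is the set of piecewise smooth vector fields $Z=(X,Y)$, with $X=(X_1,X_2)$, $Y=(Y_1,Y_2)\in\mathfrak X$, given by $Z=X$ on $\Sigma^+$ and $Z=Y$ on $\Sigma^-$. On $\Sigma$, $Z$ is defined to be $Z_\Sigma$ by the Filippov convention. If $X\equiv Y$ on $\Sigma$, then $Z_\Sigma=X=Y$. Otherwise: on the crossing set $\Sigma^c=\{p\in\Sigma:X_2(p)Y_2(p)>0\}$, $Z_\Sigma=X$ if $X_2>0$ and $Z_\Sigma=Y$ if $X_2<0$ (orbits cross $\Sigma$ there); on the sliding set $\Sigma^s=\{p\in\Sigma:X_2(p)Y_2(p)\le0\}$, $Z_\Sigma=\left(\frac{Y_2X_1-X_2Y_1}{Y_2-X_2},0\right)$ if $X_2\ne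 Y_2$, and $Z_\Sigma=(0,0)$ if $X_2=Y_2=0$. Orbits of $Z$ are obtained by concatenating orbits of $X$ in $\Sigma^+$, $Y$ in $\Sigma^-$ and $Z_\Sigma$ in $\Sigma$. $\Omega_0\subset\Omega$ is the set of $Z=(X,Y)$ with $X(0,0)=Y(0,0)=(0,0)$, $\det A^+\det A^-\neq0$ and $X_{2x}(0,0)\,Y_{2x}(0,0)>0$, where $A^+$ (resp. $A^-$) is the Jacobian matrix of $X$ (resp. $Y$) at $O$ and the subscript $x$ denotes the partial derivative in $x$. Let $\lambda_1^\pm,\lambda_2^\pm$ be the eigenvalues of $A^\pm$. Then $\Omega_1=\{Z\in\Omega_0:\lambda_1^+\ne\lambda_2^+,\ \lambda_1^-\ne\lambda_2^-,\ \ell\ne0\}$, where $\ell=\frac{\mathrm{Re}\lambda_1^+}{|\mathrm{Im}\lambda_1^+|}+\frac{\mathrm{Re}\lambda_1^-}{|\mathrm{Im}\lambda_1^-|}$ if $\mathrm{Im}\lambda_1^+\,\mathrm{Im}\lambda_1^-\ne0$, and $\ell=1$ if $\mathrm{Im}\lambda_1^+\,\mathrm{Im}\lambda_1^-=0$. Further, $\Omega_{ff}=\{Z\in\Omega_1:\lambda_1^\pm,\lambda_2^\pm\in\mathbb C\setminus\mathbb R\}$. $Z_1,Z_2\in\Omega_0$ are locally $\Sigma$-equivalent near the origin if there exist neighborhoods $U,V$ of the origin and a homeomorphism $H:U\to V$ that maps the orbits of $Z_1$ in $U$ onto the orbits of $Z_2$ in $V$, preserving the direction of time, and sends $\Sigma\cap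 U$ to $\Sigma\cap V$. *)

theory Defs
  imports "HOL-Analysis.Analysis"
begin

text \<open>The plane is \<^typ>\<open>real^2\<close>, a point \<open>p\<close> having coordinates \<open>x = p$1\<close> and \<open>y = p$2\<close>.
  Vector fields on the open set \<open>D\<close> are total functions whose
  values outside \<open>D\<close> are never used.\<close>

type_synonym field2 = "real^2 \<Rightarrow> real^2"

definition C1_fields :: "(real^2) set \<Rightarrow> field2 set" where
  "C1_fields D = {X. (\<forall>p\<in>D. X differentiable (at p)) \<and> continuous_on D (\<lambda>p. jacobian X (at p))}"

definition Sigma_plus :: "(real^2) set \<Rightarrow> (real^2) set" where
  "Sigma_plus D = {p\<in>D. p$2 > 0}"

definition Sigma_minus :: "(real^2) set \<Rightarrow> (real^2) set" where
  "Sigma_minus D = {p\<in>D. p$2 < 0}"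

definition switching_line :: "(real^2) set \<Rightarrow> (real^2) set" where
  "switching_line D = {p\<in>D. p$2 = 0}"

definition Omega :: "(real^2) set \<Rightarrow> (field2 \<times> field2) set" where
  "Omega D = C1_fields D \<times> C1_fields D"

definition Z_Sigma :: "(real^2) set \<Rightarrow> field2 \<times> field2 \<Rightarrow> field2" where
  "Z_Sigma D = (\<lambda>(X, Y) p.
     if \<forall>q\<in>switching_line D. X q = Y q then X p
     else if X p $ 2 * Y p $ 2 > 0 then (if X p $ 2 > 0 then X p else Y p)
     else if X p $ 2 \<noteq> Y p $ 2
       then vector [(Y p $ 2 * X p $ 1 - X p $ 2 * Y p $ 1) / (Y p $ 2 - X p $ 2), 0]
     else 0)"


section \<open>Orbits\<close>

definition solves_in :: "field2 \<Rightarrow> (real^2) set \<Rightarrow> real set \<Rightarrow> (real \<Rightarrow> real^2) \<Rightarrow> bool" where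
  "solves_in F S J \<gamma> \<longleftrightarrow>
     (\<forall>s\<in>J. \<gamma> s \<in> S \<and> (\<gamma> has_vector_derivative F (\<gamma> s)) (at s))"

definition orbit_arc ::
    "(real^2) set \<Rightarrow> field2 \<times> field2 \<Rightarrow> real set \<Rightarrow> (real \<Rightarrow> real^2) \<Rightarrow> bool" where
  "orbit_arc D Z J \<gamma> \<longleftrightarrow>
     solves_in (fst Z) (Sigma_plus D) J \<gamma> \<or>
     solves_in (snd Z) (Sigma_minus D) J \<gamma> \<or>
     solves_in (Z_Sigma D Z) (switching_line D) J \<gamma>"

text \<open>A trajectory in \<open>W \<subseteq> D\<close> is a continuous concatenation of arcs of \<open>X\<close> in \<open>\<Sigma>\<^sup>+\<close>, of \<open>Y\<close> in
  \<open>\<Sigma>\<^sup>-\<close> and of \<open>Z\<^sub>\<Sigma>\<close> in \<open>\<Sigma>\<close>; there may be infinitely many arcs, but only finitely many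
  over a compact subinterval of the time interval \<open>I\<close>. Since \<open>e\<close> can be shrunk, the
  intersections with \<open>I\<close> are either empty or open intervals inside \<open>I\<close>, so the values of
  \<open>\<gamma>\<close> outside \<open>I\<close> play no role. At a crossing point \<open>Z\<^sub>\<Sigma>\<close> is transversal to \<open>\<Sigma>\<close>, so no arc
  of the third kind runs through it.\<close>

definition trajectory ::
    "(real^2) set \<Rightarrow> field2 \<times> field2 \<Rightarrow> (real^2) set \<Rightarrow> real set \<Rightarrow> (real \<Rightarrow> real^2) \<Rightarrow> bool" where
  "trajectory D Z W I \<gamma> \<longleftrightarrow>
     I \<noteq> {} \<and> is_interval I \<and> continuous_on I \<gamma> \<and> \<gamma> ` I \<subseteq> W \<and>
     (\<forall>t\<in>I. \<exists>e>0. orbit_arc D Z ({t - e<..<t} \<inter> I) \<gamma> \<and> orbit_arc D Z ({t<..<t + e} \<inter> I) \<gamma>)"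

text \<open>The orbits of \<open>Z\<close> in \<open>W\<close>, together with their direction of time, are given by the
  trajectories in \<open>W\<close> that are not the restriction of one on a larger time interval.\<close>

definition maximal_trajectory ::
    "(real^2) set \<Rightarrow> field2 \<times> field2 \<Rightarrow> (real^2) set \<Rightarrow> real set \<Rightarrow> (real \<Rightarrow> real^2) \<Rightarrow> bool" where
  "maximal_trajectory D Z W I \<gamma> \<longleftrightarrow>
     trajectory D Z W I \<gamma> \<and>
     (\<forall>J \<delta>. trajectory D Z W J \<delta> \<and> I \<subseteq> J \<and> (\<forall>t\<in>I. \<delta> t = \<gamma> t) \<longrightarrow> J = I)"

text \<open>The image under \<open>H\<close> of every orbit of \<open>Z\<^sub>1\<close> in \<open>U\<close> is an orbit of \<open>Z\<^sub>2\<close> in \<open>V\<close>, traversed in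
  the same direction: \<open>h\<close> is an increasing change of time.\<close>

definition maps_orbits ::
    "(real^2) set \<Rightarrow> field2 \<times> field2 \<Rightarrow> (real^2) set \<Rightarrow> field2 \<times> field2 \<Rightarrow> (real^2) set
      \<Rightarrow> (real^2 \<Rightarrow> real^2) \<Rightarrow> bool" where
  "maps_orbits D Z1 U Z2 V H \<longleftrightarrow>
     (\<forall>I \<gamma>. maximal_trajectory D Z1 U I \<gamma> \<longrightarrow>
        (\<exists>J \<delta> h. maximal_trajectory D Z2 V J \<delta> \<and>
           strict_mono_on I h \<and> h ` I = J \<and> (\<forall>t\<in>I. H (\<gamma> t) = \<delta> (h t))))"

definition locally_Sigma_equivalent ::
    "(real^2) set \<Rightarrow> field2 \<times> field2 \<Rightarrow> field2 \<times> field2 \<Rightarrow> bool" where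
  "locally_Sigma_equivalent D Z1 Z2 \<longleftrightarrow>
     (\<exists>U V H G. open U \<and> 0 \<in> U \<and> U \<subseteq> D \<and> open V \<and> 0 \<in> V \<and> V \<subseteq> D \<and>
        homeomorphism U V H G \<and>
        maps_orbits D Z1 U Z2 V H \<and> maps_orbits D Z2 V Z1 U G \<and>
        H ` (switching_line D \<inter> U) = switching_line D \<inter> V)"


section \<open>The classes of vector fields\<close>

definition Omega0 :: "(real^2) set \<Rightarrow> (field2 \<times> field2) set" where
  "Omega0 D = {(X, Y) \<in> Omega D. X 0 = 0 \<and> Y 0 = 0 \<and>
     det (jacobian X (at 0)) * det (jacobian Y (at 0)) \<noteq> 0 \<and>
     jacobian X (at 0) $ 2 $ 1 * jacobian Y (at 0) $ 2 $ 1 > 0}"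

definition complex_eigenvalue :: "real^2^2 \<Rightarrow> complex \<Rightarrow> bool" where
  "complex_eigenvalue A \<mu> \<longleftrightarrow>
     (\<exists>v::complex^2. v \<noteq> 0 \<and> map_matrix complex_of_real A *v v = \<mu> *s v)"

text \<open>Also correct for a double eigenvalue: the set is then a singleton and \<open>\<mu>1 = \<mu>2\<close>.\<close>

definition eigenvalues :: "real^2^2 \<Rightarrow> complex \<Rightarrow> complex \<Rightarrow> bool" where
  "eigenvalues A \<mu>1 \<mu>2 \<longleftrightarrow> {\<mu>. complex_eigenvalue A \<mu>} = {\<mu>1, \<mu>2}"

text \<open>The number \<open>\<ell>\<close> in terms of an eigenvalue \<open>\<mu>p\<close> of the Jacobian of \<open>X\<close> and an eigenvalue
  \<open>\<mu>m\<close> of the Jacobian of \<open>Y\<close> at the origin. Non-real eigenvalues of a real matrix are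
  conjugate, so \<open>\<ell>\<close> does not depend on which of the two eigenvalues is numbered first.\<close>

definition ell :: "complex \<Rightarrow> complex \<Rightarrow> real" where
  "ell \<mu>p \<mu>m = (if Im \<mu>p * Im \<mu>m \<noteq> 0 then Re \<mu>p / \<bar>Im \<mu>p\<bar> + Re \<mu>m / \<bar>Im \<mu>m\<bar> else 1)"

definition Omega1 :: "(real^2) set \<Rightarrow> (field2 \<times> field2) set" where
  "Omega1 D = {(X, Y) \<in> Omega0 D. \<exists>\<mu>p1 \<mu>p2 \<mu>m1 \<mu>m2.
     eigenvalues (jacobian X (at 0)) \<mu>p1 \<mu>p2 \<and> eigenvalues (jacobian Y (at 0)) \<mu>m1 \<mu>m2 \<and>
     \<mu>p1 \<noteq> \<mu>p2 \<and> \<mu>m1 \<noteq> \<mu>m2 \<and> ell \<mu>p1 \<mu>m1 \<noteq> 0}"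

definition Omega_ff :: "(real^2) set \<Rightarrow> (field2 \<times> field2) set" where
  "Omega_ff D = {(X, Y) \<in> Omega1 D.
     (\<forall>\<mu>. complex_eigenvalue (jacobian X (at 0)) \<mu> \<longrightarrow> \<mu> \<notin> \<real>) \<and>
     (\<forall>\<mu>. complex_eigenvalue (jacobian Y (at 0)) \<mu> \<longrightarrow> \<mu> \<notin> \<real>)}"

definition X_ff :: "real \<Rightarrow> field2" where
  "X_ff \<alpha> = (\<lambda>p. vector [\<alpha> * p$1 - p$2, p$1 + \<alpha> * p$2])"

definition Y_ff :: "real \<Rightarrow> field2" where
  "Y_ff \<alpha> = (\<lambda>p. vector [\<alpha> * p$1 - p$2, p$1 + \<alpha> * p$2])"

end

theory Submission
  imports Defs
begin

text \<open>Near the origin every point of the switching line other than the origin is a crossing point, so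
  all orbits turn around the origin. A linear change of coordinates in each half plane that fixes the
  switching line turns both linear parts into rotations with dilation, and with the angle \<open>p\<close> as
  independent variable the orbits solve a scalar equation for the logarithm of the radius, whose right
  hand side jumps at multiples of \<open>\<pi>\<close> and tends to \<open>Re \<lambda> / |Im \<lambda>|\<close> in either half plane at the origin.
  Adding \<open>k arccos (cos p)\<close> to the logarithm replaces both limits by their mean \<open>\<ell> / 2\<close>, so that the
  new variable \<open>S\<close> is monotone along orbits and every orbit crosses \<open>S = 0\<close> exactly once, at an angle
  \<open>\<theta>\<close>. Labelling points by \<open>p\<close> and \<open>\<theta>\<close> gives an injective continuous map from the unit disc that
  takes the logarithmic spirals to the orbits and the real axis to the switching line; by invariance of
  domain it is a homeomorphism onto a neighbourhood of the origin. The normal form is itself of this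
  kind, with the same direction of spiralling, so two such maps compose to the equivalence.\<close>

section \<open>Scalar differential equations with jumps in time\<close>

text \<open>The hypothesis \<open>\<ell> \<noteq> 0\<close> constrains only the sum of the two
  rates: one half plane may attract while the other repels, and the radius need not be monotone
  along an orbit. Averaging the rates supplies a monotone quantity, and no return map has to be
  computed. The logarithm of the radius is used because the fields are merely C1: after division by
  the radius the nonlinear remainder is Lipschitz in the logarithm, uniformly down to the origin.
  The right-hand sides are frozen for \<open>S > 0\<close>, so that every solution is defined for
  all angles with one set of constants; points with \<open>S > 0\<close> lie outside the chart. The
  other obstacle is the notion of orbit. A trajectory is any concatenation of arcs, so a description
  of the orbits has to exclude all competitors; this is done by uniqueness through the crossing
  points in both directions of time. Clockwise rotation is treated together with counterclockwise
  rotation: the first basis vector then points along the negative axis, and angles always increase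
  with time.\<close>

lemma finite_sin_zeros: "finite {t. a \<le> t \<and> t \<le> b \<and> sin t = (0::real)}"
proof -
  have "{t. a \<le> t \<and> t \<le> b \<and> sin t = 0} \<subseteq> (\<lambda>i. of_int i * pi) ` {\<lfloor>a / pi\<rfloor>..\<lceil>b / pi\<rceil>}"
  proof
    fix t assume t: "t \<in> {t. a \<le> t \<and> t \<le> b \<and> sin t = 0}"
    then obtain i :: int where i: "t = of_int i * pi" by (auto simp: sin_zero_iff_int2)
    with t have "a / pi \<le> i" "i \<le> b / pi" by (auto simp: field_simps)
    then have "i \<in> {\<lfloor>a / pi\<rfloor>..\<lceil>b / pi\<rceil>}" by (auto simp: floor_le_iff le_ceiling_iff intro: order_le_less_trans order_less_le_trans)
    with i show "t \<in> (\<lambda>i. of_int i * pi) ` {\<lfloor>a / pi\<rfloor>..\<lceil>b / pi\<rceil>}" by blast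
  qed
  then show ?thesis by (rule finite_subset) auto
qed

text \<open>Replacing the derivative by 0 at the exceptional points leaves a function whose integral
  is still \<open>f b - f a\<close>, so its nonnegativity is enough. The finite set absorbs the
  jumps of the right-hand side, at which solutions are only known to be continuous.\<close>

lemma mono_if_deriv_nonneg_except_finite:
  fixes f :: "real \<Rightarrow> real"
  assumes "finite S" "a \<le> b" "continuous_on {a..b} f"
    and der: "\<And>t. a < t \<Longrightarrow> t < b \<Longrightarrow> t \<notin> S \<Longrightarrow> (f has_real_derivative f' t) (at t)"
    and nonneg: "\<And>t. a < t \<Longrightarrow> t < b \<Longrightarrow> t \<notin> S \<Longrightarrow> 0 \<le> f' t"
  shows "f a \<le> f b"
proof -
  define d where "d t = (if a < t \<and> t < b \<and> t \<notin> S then f' t else 0)" for t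
  have "(d has_integral f b - f a) {a..b}"
    by (rule fundamental_theorem_of_calculus_interior_strong[OF assms(1,2)])
      (auto simp: d_def der assms(3) has_real_derivative_iff_has_vector_derivative[symmetric])
  then have "0 \<le> f b - f a" by (rule has_integral_nonneg) (auto simp: d_def nonneg)
  then show ?thesis by simp
qed

text \<open>The zeros of sine are the angles of the switching line, where the right-hand side jumps;
  continuity alone links the pieces there.\<close>

definition solves_ode :: "(real \<Rightarrow> real \<Rightarrow> real) \<Rightarrow> (real \<Rightarrow> real) \<Rightarrow> bool" where
  "solves_ode F y \<longleftrightarrow> continuous_on UNIV y \<and>
     (\<forall>t. sin t \<noteq> 0 \<longrightarrow> (y has_real_derivative F t (y t)) (at t))"

lemma solves_ode_deriv:
  "solves_ode F y \<Longrightarrow> sin t \<noteq> 0 \<Longrightarrow> (y has_real_derivative F t (y t)) (at t)"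
  and solves_ode_continuous: "solves_ode F y \<Longrightarrow> continuous_on S y"
  by (auto simp: solves_ode_def intro: continuous_on_subset)

lemma solves_ode_growth:
  assumes y: "solves_ode F y" and F: "\<And>t. c1 \<le> F t (y t)" "\<And>t. F t (y t) \<le> c2" and "a \<le> b"
  shows "c1 * (b - a) \<le> y b - y a" "y b - y a \<le> c2 * (b - a)"
proof -
  let ?S = "{t. a \<le> t \<and> t \<le> b \<and> sin t = 0}"
  have "y a - c1 * a \<le> y b - c1 * b"
    by (rule mono_if_deriv_nonneg_except_finite[OF finite_sin_zeros[of a b] \<open>a \<le> b\<close>,
          where f' = "\<lambda>t. F t (y t) - c1" and f = "\<lambda>t. y t - c1 * t"])
      (auto intro!: continuous_intros derivative_eq_intros solves_ode_continuous[OF y]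
        solves_ode_deriv[OF y] simp: F)
  moreover have "c2 * a - y a \<le> c2 * b - y b"
    by (rule mono_if_deriv_nonneg_except_finite[OF finite_sin_zeros[of a b] \<open>a \<le> b\<close>,
          where f' = "\<lambda>t. c2 - F t (y t)" and f = "\<lambda>t. c2 * t - y t"])
      (auto intro!: continuous_intros derivative_eq_intros solves_ode_continuous[OF y]
        solves_ode_deriv[OF y] simp: F)
  ultimately show "c1 * (b - a) \<le> y b - y a" "y b - y a \<le> c2 * (b - a)"
    by (auto simp: algebra_simps)
qed

text \<open>The squared distance \<open>w\<close> is differentiable wherever both solutions are and
  satisfies \<open>\<bar>w'\<bar> \<le> 2 L w\<close>. This two-sided bound makes
  \<open>w exp (-2 L t)\<close> nonincreasing and \<open>w exp (2 L t)\<close> nondecreasing, which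
  covers times after and before \<open>a\<close>.\<close>

lemma solves_ode_gronwall:
  assumes y: "solves_ode F y" and z: "solves_ode F z"
    and L: "\<And>t u v. \<bar>F t u - F t v\<bar> \<le> L * \<bar>u - v\<bar>"
  shows "\<bar>y b - z b\<bar> \<le> \<bar>y a - z a\<bar> * exp (L * \<bar>b - a\<bar>)"
proof -
  define w where "w t = (y t - z t)\<^sup>2" for t
  define w' where "w' t = 2 * (y t - z t) * (F t (y t) - F t (z t))" for t
  have cont: "continuous_on S w" for S
    unfolding w_def by (intro continuous_intros solves_ode_continuous[OF y] solves_ode_continuous[OF z])
  have der: "(w has_real_derivative w' t) (at t)" if "sin t \<noteq> 0" for t
    unfolding w_def w'_def
    by (auto intro!: derivative_eq_intros solves_ode_deriv[OF y that] solves_ode_deriv[OF z that])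
  have w': "\<bar>w' t\<bar> \<le> 2 * L * w t" for t
  proof -
    have "\<bar>y t - z t\<bar> * \<bar>F t (y t) - F t (z t)\<bar> \<le> \<bar>y t - z t\<bar> * (L * \<bar>y t - z t\<bar>)"
      by (intro mult_left_mono L) auto
    moreover have "\<bar>y t - z t\<bar> * (L * \<bar>y t - z t\<bar>) = L * w t"
      by (simp add: w_def power2_eq_square)
    moreover have "\<bar>w' t\<bar> = 2 * (\<bar>y t - z t\<bar> * \<bar>F t (y t) - F t (z t)\<bar>)"
      unfolding w'_def by (simp only: abs_mult abs_numeral mult.assoc)
    ultimately show ?thesis by linarith
  qed
  have "w b \<le> w a * exp (2 * L * \<bar>b - a\<bar>)"
  proof (cases "a \<le> b")
    case True
    have "- (w a * exp (- 2 * L * a)) \<le> - (w b * exp (- 2 * L * b))"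
    proof (rule mono_if_deriv_nonneg_except_finite[OF finite_sin_zeros[of a b] True,
          where f' = "\<lambda>t. (2 * L * w t - w' t) * exp (- 2 * L * t)" and f = "\<lambda>t. - (w t * exp (- 2 * L * t))"])
      show "0 \<le> (2 * L * w t - w' t) * exp (- 2 * L * t)" for t using w'[of t] by auto
    qed (auto intro!: continuous_intros derivative_eq_intros cont der simp: algebra_simps)
    then have "w b * exp (- 2 * L * b) * exp (2 * L * b) \<le> w a * exp (- 2 * L * a) * exp (2 * L * b)"
      by (intro mult_right_mono) auto
    then show ?thesis using True by (simp add: mult.assoc exp_add[symmetric] algebra_simps)
  next
    case False
    then have le: "b \<le> a" by simp
    have "w b * exp (2 * L * b) \<le> w a * exp (2 * L * a)"
    proof (rule mono_if_deriv_nonneg_except_finite[OF finite_sin_zeros[of b a] le,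
          where f' = "\<lambda>t. (2 * L * w t + w' t) * exp (2 * L * t)" and f = "\<lambda>t. w t * exp (2 * L * t)"])
      show "0 \<le> (2 * L * w t + w' t) * exp (2 * L * t)" for t using w'[of t] by auto
    qed (auto intro!: continuous_intros derivative_eq_intros cont der simp: algebra_simps)
    then have "w b * exp (2 * L * b) * exp (- 2 * L * b) \<le> w a * exp (2 * L * a) * exp (- 2 * L * b)"
      by (intro mult_right_mono) auto
    then show ?thesis using le by (simp add: mult.assoc exp_add[symmetric] algebra_simps)
  qed
  also have "\<dots> = (\<bar>y a - z a\<bar> * exp (L * \<bar>b - a\<bar>))\<^sup>2"
    by (simp add: w_def power_mult_distrib exp_double[symmetric] mult.assoc)
  finally show ?thesis
    unfolding w_def by (metis abs_ge_zero abs_le_square_iff abs_of_nonneg exp_ge_zero mult_nonneg_nonneg)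
qed

lemma solves_ode_unique:
  assumes "solves_ode F y" "solves_ode F z" "\<And>t u v. \<bar>F t u - F t v\<bar> \<le> L * \<bar>u - v\<bar>" "y a = z a"
  shows "y = z"
  using solves_ode_gronwall[OF assms(1-3), of _ a] \<open>y a = z a\<close> by (intro ext) simp

text \<open>The oriented integral from \<open>a\<close> to \<open>t\<close>: for each
  \<open>t\<close> one of the two intervals is degenerate or empty and contributes 0.\<close>

definition primitive :: "(real \<Rightarrow> real) \<Rightarrow> real \<Rightarrow> real \<Rightarrow> real" where
  "primitive u a t = integral {a..t} u - integral {t..a} u"

lemma bounded_measurable_integrable_on:
  fixes u :: "real \<Rightarrow> real"
  assumes "u \<in> borel_measurable borel" "\<And>t. \<bar>u t\<bar> \<le> C"
  shows "u integrable_on {a..b}"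
proof -
  have "u \<in> borel_measurable (lebesgue_on {a..b})"
    using assms(1) by (intro measurable_restrict_space1 measurable_completion) simp
  then show ?thesis
    by (rule measurable_bounded_by_integrable_imp_integrable[where g = "\<lambda>_. C"]) (use assms(2) in auto)
qed

lemma primitive_diff:
  fixes u :: "real \<Rightarrow> real"
  assumes u: "u \<in> borel_measurable borel" "\<And>t. \<bar>u t\<bar> \<le> C" and "s \<le> t"
  shows "(u has_integral primitive u a t - primitive u a s) {s..t}"
proof -
  note int = bounded_measurable_integrable_on[OF u]
  have [simp]: "integral {y..x} u = 0" if "x \<le> y" for x y
    using that by (cases "x = y") auto
  have "primitive u a t - primitive u a s = integral {s..t} u"
    using \<open>s \<le> t\<close> Henstock_Kurzweil_Integration.integral_combine[OF _ _ int[of s t], of a]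
      Henstock_Kurzweil_Integration.integral_combine[OF _ _ int[of a t], of s]
      Henstock_Kurzweil_Integration.integral_combine[OF _ _ int[of s a], of t]
    by (cases "a \<le> s"; cases "a \<le> t") (auto simp: primitive_def)
  then show ?thesis using int by (simp add: integrable_integral)
qed

lemma primitive_lipschitz:
  fixes u :: "real \<Rightarrow> real"
  assumes u: "u \<in> borel_measurable borel" "\<And>t. \<bar>u t\<bar> \<le> C"
  shows "\<bar>primitive u a t - primitive u a s\<bar> \<le> C * \<bar>t - s\<bar>"
proof -
  have *: "\<bar>primitive u a t - primitive u a s\<bar> \<le> C * (t - s)" if "s \<le> t" for s t
    using has_integral_bound_real[OF order_trans[OF abs_ge_zero u(2)] finite.emptyI primitive_diff[OF u that]] u(2) that
    by auto
  show ?thesis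
    using *[of s t] *[of t s] by (cases "s \<le> t") (auto simp: abs_minus_commute)
qed

lemma primitive_has_derivative:
  fixes u :: "real \<Rightarrow> real"
  assumes u: "u \<in> borel_measurable borel" "\<And>t. \<bar>u t\<bar> \<le> C" and "isCont u t"
  shows "(primitive u a has_real_derivative u t) (at t)"
proof -
  \<comment> \<open>Starting at \<open>t - 1\<close> puts \<open>t\<close> in the interior of the
    interval of integration, so that a derivative within the interval is a derivative at
    \<open>t\<close>.\<close>
  have "((\<lambda>v. integral {t - 1..v} u) has_vector_derivative u t) (at t within ({t-1..t+1} - {}))"
    by (rule integral_has_vector_derivative_continuous_at)
      (use bounded_measurable_integrable_on[OF u] \<open>isCont u t\<close> in
        \<open>auto intro: continuous_at_imp_continuous_at_within\<close>)
  then have "((\<lambda>v. integral {t - 1..v} u) has_real_derivative u t) (at t)"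
    by (simp add: has_real_derivative_iff_has_vector_derivative at_within_Icc_at)
  then have "((\<lambda>v. integral {t - 1..v} u + primitive u a (t - 1)) has_real_derivative u t) (at t)"
    by (auto intro!: derivative_eq_intros)
  moreover have "integral {t - 1..v} u + primitive u a (t - 1) = primitive u a v" if "v \<in> {t - 1<..}" for v
    using integral_unique[OF primitive_diff[OF u, of "t - 1" v a]] that by simp
  ultimately show ?thesis
    using has_field_derivative_transform_within_open[OF _ open_greaterThan[of "t - 1"]] by auto
qed

text \<open>Picard iteration in the weighted norm \<open>sup |y t| exp (- 2 L |t - a|)\<close>, for which the integral
  operator contracts by \<open>1/2\<close> on the whole line.\<close>

theorem solves_ode_exists:
  fixes F1 F2 :: "real \<times> real \<Rightarrow> real"
  assumes F_def: "F = (\<lambda>t u. if sin t > 0 then F1 (t, u) else F2 (t, u))"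
    and F12: "continuous_on UNIV F1" "continuous_on UNIV F2"
    and C: "\<And>t u. \<bar>F t u\<bar> \<le> C" and L: "\<And>t u v. \<bar>F t u - F t v\<bar> \<le> L * \<bar>u - v\<bar>" and "L > 0"
  shows "\<exists>y. solves_ode F y \<and> y a = c"
proof -
  have [measurable]: "F1 \<in> borel_measurable (borel \<Otimes>\<^sub>M borel)" "F2 \<in> borel_measurable (borel \<Otimes>\<^sub>M borel)"
    using F12[THEN borel_measurable_continuous_onI] by (simp_all add: borel_prod)
  have meas: "(\<lambda>t. F t (y t)) \<in> borel_measurable borel" if "continuous_on UNIV y" for y
  proof -
    have [measurable]: "y \<in> borel_measurable borel" using that by (rule borel_measurable_continuous_onI)
    show ?thesis unfolding F_def by measurable
  qed
  have "C \<ge> 0" using C[of 0 0] by linarith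
  define E where "E t = exp (2 * L * \<bar>t - a\<bar>)" for t
  have E1: "E t \<ge> 1" "E t > 0" and E2: "E t \<ge> 2 * L * \<bar>t - a\<bar>" for t
    using \<open>L > 0\<close> order_trans[OF _ exp_ge_add_one_self, of "2 * L * \<bar>t - a\<bar>" "2 * L * \<bar>t - a\<bar>"] by (auto simp: E_def)
  have contE: "continuous_on UNIV E" unfolding E_def by (intro continuous_intros)
  \<comment> \<open>A bounded continuous \<open>g\<close> encodes the candidate
    \<open>E * g\<close>: the weighted norm of the candidate is the supremum norm of
    \<open>g\<close>, for which the space is complete.\<close>
  define u where "u g t = F t (E t * apply_bcontfun g t)" for g :: "real \<Rightarrow>\<^sub>C real" and t
  have u: "u g \<in> borel_measurable borel" "\<bar>u g t\<bar> \<le> C" for g t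
    using meas[OF continuous_on_mult[OF contE continuous_on_apply_bcontfun]] C by (auto simp: u_def[abs_def])
  define W where "W g = primitive (u g) a" for g
  have W0: "W g a = 0" for g by (simp add: W_def primitive_def)
  have contW: "continuous_on UNIV (W g)" for g
    unfolding W_def continuous_on_iff dist_real_def
  proof (intro ballI allI impI)
    fix x e :: real assume "e > 0"
    have "\<bar>primitive (u g) a x' - primitive (u g) a x\<bar> < e" if "\<bar>x' - x\<bar> < e / (C + 1)" for x'
    proof -
      have "C * \<bar>x' - x\<bar> \<le> (C + 1) * \<bar>x' - x\<bar>" by (intro mult_right_mono) auto
      also have "\<dots> < e" using that \<open>C \<ge> 0\<close> by (simp add: field_simps)
      finally show ?thesis using primitive_lipschitz[OF u, of g a x' x] by linarith
    qed
    then show "\<exists>d>0. \<forall>x'\<in>UNIV. \<bar>x' - x\<bar> < d \<longrightarrow> \<bar>primitive (u g) a x' - primitive (u g) a x\<bar> < e"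
      using \<open>e > 0\<close> \<open>C \<ge> 0\<close> by (intro exI[of _ "e / (C + 1)"]) auto
  qed
  have Wdiff: "\<bar>W g t - W h t\<bar> \<le> E t / 2 * dist g h" for g h t
  proof -
    have le: "\<bar>u g s - u h s\<bar> \<le> L * dist g h * E s" for s
    proof -
      have "\<bar>u g s - u h s\<bar> \<le> L * \<bar>E s * g s - E s * h s\<bar>" unfolding u_def by (rule L)
      also have "\<dots> = L * (E s * dist (g s) (h s))"
        using E1(2)[of s] by (simp add: dist_real_def abs_mult right_diff_distrib[symmetric])
      also have "\<dots> \<le> L * (E s * dist g h)"
        using \<open>L > 0\<close> E1(2)[of s] by (intro mult_left_mono dist_bounded) auto
      finally show ?thesis by (simp add: ac_simps)
    qed
    \<comment> \<open>\<open>E\<close> has a kink at \<open>a\<close>, hence the restriction to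
      intervals on one side of it. There the integral of \<open>L * E\<close> is
      \<open>\<bar>E q - E p\<bar> / 2\<close>, and this half is the contraction factor.\<close>
    have main: "\<bar>(W g q - W h q) - (W g p - W h p)\<bar> \<le> dist g h * (\<bar>E q - E p\<bar> / 2)"
      if "p \<le> q" and pq: "a \<le> p \<or> q \<le> a" for p q
    proof -
      have 1: "((\<lambda>s. u g s - u h s) has_integral (W g q - W h q) - (W g p - W h p)) {p..q}"
        using has_integral_diff[OF primitive_diff[OF u \<open>p \<le> q\<close>] primitive_diff[OF u \<open>p \<le> q\<close>]]
        by (simp add: W_def algebra_simps)
      have 2: "((\<lambda>s. L * dist g h * E s) has_integral dist g h * (\<bar>E q - E p\<bar> / 2)) {p..q}"
      proof (cases "a \<le> p")
        case True
        have "((\<lambda>s. L * dist g h * exp (2 * L * (s - a))) has_integral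
           dist g h * (exp (2 * L * (q - a)) / 2) - dist g h * (exp (2 * L * (p - a)) / 2)) {p..q}"
          by (rule fundamental_theorem_of_calculus[OF \<open>p \<le> q\<close>])
            (auto intro!: derivative_eq_intros simp: has_real_derivative_iff_has_vector_derivative[symmetric])
        moreover have "E q - E p \<ge> 0" using True \<open>p \<le> q\<close> \<open>L > 0\<close> by (auto simp: E_def)
        ultimately show ?thesis using True \<open>p \<le> q\<close>
          by (subst has_integral_cong[where g = "\<lambda>s. L * dist g h * exp (2 * L * (s - a))"])
            (auto simp: E_def algebra_simps diff_divide_distrib)
      next
        case False
        with pq have "q \<le> a" by simp
        have "((\<lambda>s. L * dist g h * exp (2 * L * (a - s))) has_integral
           (- dist g h * (exp (2 * L * (a - q)) / 2)) - (- dist g h * (exp (2 * L * (a - p)) / 2))) {p..q}"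
          by (rule fundamental_theorem_of_calculus[OF \<open>p \<le> q\<close>])
            (auto intro!: derivative_eq_intros simp: has_real_derivative_iff_has_vector_derivative[symmetric])
        moreover have "E q - E p \<le> 0" using \<open>q \<le> a\<close> \<open>p \<le> q\<close> \<open>L > 0\<close> by (auto simp: E_def)
        ultimately show ?thesis using \<open>q \<le> a\<close> \<open>p \<le> q\<close>
          by (subst has_integral_cong[where g = "\<lambda>s. L * dist g h * exp (2 * L * (a - s))"])
            (auto simp: E_def algebra_simps diff_divide_distrib)
      qed
      show ?thesis
        using integral_norm_bound_integral[OF has_integral_integrable[OF 1] has_integral_integrable[OF 2]] le
        unfolding integral_unique[OF 1] integral_unique[OF 2] by simp
    qed
    have "\<bar>W g t - W h t\<bar> \<le> dist g h * (\<bar>E t - E a\<bar> / 2)"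
      using main[of a t] main[of t a] by (cases "a \<le> t") (auto simp: W0 abs_minus_commute)
    also have "\<dots> \<le> dist g h * (E t / 2)"
      using E1(1)[of t] by (intro mult_left_mono) (auto simp: E_def)
    finally show ?thesis by (simp add: ac_simps)
  qed
  define T where "T g = Bcontfun (\<lambda>t. (c + W g t) / E t)" for g
  have T: "apply_bcontfun (T g) t = (c + W g t) / E t" for g t
  proof -
    \<comment> \<open>The integral grows at most linearly and \<open>E\<close> at least linearly, so
      the image is again bounded.\<close>
    have "\<bar>(c + W g t) / E t\<bar> \<le> \<bar>c\<bar> + C / (2 * L)" for t
    proof -
      have "\<bar>W g t\<bar> \<le> C * \<bar>t - a\<bar>"
        using primitive_lipschitz[OF u, of g a t a] W0[of g] by (simp add: W_def)
      then have "\<bar>c + W g t\<bar> \<le> \<bar>c\<bar> + C * \<bar>t - a\<bar>" by linarith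
      also have "\<dots> \<le> \<bar>c\<bar> * E t + C / (2 * L) * E t"
      proof (rule add_mono)
        show "\<bar>c\<bar> \<le> \<bar>c\<bar> * E t" using E1(1)[of t] mult_left_mono[of 1 "E t" "\<bar>c\<bar>"] by simp
        show "C * \<bar>t - a\<bar> \<le> C / (2 * L) * E t"
          using mult_left_mono[OF E2[of t] \<open>C \<ge> 0\<close>] \<open>L > 0\<close> by (simp add: field_simps)
      qed
      finally show ?thesis using E1(2)[of t] by (simp add: field_simps)
    qed
    then have "(\<lambda>t. (c + W g t) / E t) \<in> bcontfun"
      unfolding bcontfun_def bounded_iff using E1(2)
      by (auto intro!: continuous_intros contW contE simp: less_imp_neq[symmetric])
    then show ?thesis by (simp add: T_def Bcontfun_inverse)
  qed
  have "\<exists>!g. T g = g"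
  proof (rule banach_fix_type[of "1/2"], goal_cases)
    case 3
    have "dist (T g) (T h) \<le> 1 / 2 * dist g h" for g h
    proof (rule dist_bound)
      fix t
      have "dist (T g t) (T h t) = \<bar>W g t - W h t\<bar> / E t"
        using E1(2)[of t] by (simp add: T dist_real_def diff_divide_distrib[symmetric])
      also have "\<dots> \<le> 1 / 2 * dist g h" using Wdiff[of g t h] E1(2)[of t] by (simp add: field_simps)
      finally show "dist (T g t) (T h t) \<le> 1 / 2 * dist g h" .
    qed
    then show ?case by blast
  qed auto
  then obtain g where g: "T g = g" by blast
  define y where "y t = c + W g t" for t
  have y: "E t * g t = y t" for t using T[of g t] E1(2)[of t] by (simp add: g y_def)
  have conty: "continuous_on UNIV y" unfolding y_def by (intro continuous_intros contW)
  have der: "(y has_real_derivative F t (y t)) (at t)" if "sin t \<noteq> 0" for t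
  proof -
    have "isCont (\<lambda>t. F t (y t)) t"
    proof (cases "sin t > 0")
      case True
      have "continuous_on {s. sin s > 0} (\<lambda>t. F t (y t))"
      proof (rule continuous_on_eq)
        show "continuous_on {s. sin s > 0} (\<lambda>s. F1 (s, y s))"
          by (intro continuous_on_compose2[OF F12(1)] continuous_intros continuous_on_subset[OF conty]) auto
      qed (auto simp: F_def)
      then show ?thesis
        using True by (subst (asm) continuous_on_eq_continuous_at) (auto intro!: open_Collect_less continuous_intros)
    next
      case False
      have "continuous_on {s. sin s < 0} (\<lambda>t. F t (y t))"
      proof (rule continuous_on_eq)
        show "continuous_on {s. sin s < 0} (\<lambda>s. F2 (s, y s))"
          by (intro continuous_on_compose2[OF F12(2)] continuous_intros continuous_on_subset[OF conty]) auto
      qed (auto simp: F_def)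
      then show ?thesis
        using False that by (subst (asm) continuous_on_eq_continuous_at) (auto intro!: open_Collect_less continuous_intros)
    qed
    then have "isCont (u g) t" by (simp add: u_def[abs_def] y)
    then have "(W g has_real_derivative u g t) (at t)"
      unfolding W_def by (rule primitive_has_derivative[OF u])
    then have "((\<lambda>t. c + W g t) has_real_derivative 0 + F t (y t)) (at t)"
      by (intro DERIV_add DERIV_const) (simp add: u_def y)
    then show ?thesis by (simp add: y_def[abs_def])
  qed
  show ?thesis
    using conty der by (intro exI[of _ y]) (auto simp: solves_ode_def y_def W0)
qed

section \<open>Uniqueness of trajectories\<close>

text \<open>The form that orbit arcs take when sliding is excluded: an arc in the switching line
  rests at the origin. As neither the domain nor \<open>Z_Sigma\<close> occurs, uniqueness can be
  argued for the two fields alone.\<close>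

definition simple_arc :: "field2 \<Rightarrow> field2 \<Rightarrow> real set \<Rightarrow> (real \<Rightarrow> real^2) \<Rightarrow> bool" where
  "simple_arc X Y J \<gamma> \<longleftrightarrow>
     (\<forall>s\<in>J. \<gamma> s $ 2 > 0 \<and> (\<gamma> has_vector_derivative X (\<gamma> s)) (at s)) \<or>
     (\<forall>s\<in>J. \<gamma> s $ 2 < 0 \<and> (\<gamma> has_vector_derivative Y (\<gamma> s)) (at s)) \<or>
     (\<forall>s\<in>J. \<gamma> s = 0 \<and> (\<gamma> has_vector_derivative 0) (at s))"

text \<open>Reversing time negates both fields and keeps the half planes; through this, forward
  uniqueness yields backward uniqueness.\<close>

lemma simple_arc_reverse:
  assumes "simple_arc X Y {a<..<b} \<gamma>"
  shows "simple_arc (\<lambda>p. - X p) (\<lambda>p. - Y p) {-b<..<-a} (\<lambda>t. \<gamma> (- t))"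
proof -
  have *: "((\<lambda>t. \<gamma> (- t)) has_vector_derivative - v) (at s)"
    if "(\<gamma> has_vector_derivative v) (at (- s))" for s v
  proof -
    have "(uminus has_vector_derivative (- 1 :: real)) (at s)"
      by (auto simp: has_vector_derivative_def intro!: derivative_eq_intros)
    from vector_diff_chain_at[OF this that] show ?thesis by (simp add: o_def)
  qed
  from assms consider
    "\<And>s. a < s \<Longrightarrow> s < b \<Longrightarrow> \<gamma> s $ 2 > 0 \<and> (\<gamma> has_vector_derivative X (\<gamma> s)) (at s)"
    | "\<And>s. a < s \<Longrightarrow> s < b \<Longrightarrow> \<gamma> s $ 2 < 0 \<and> (\<gamma> has_vector_derivative Y (\<gamma> s)) (at s)"
    | "\<And>s. a < s \<Longrightarrow> s < b \<Longrightarrow> \<gamma> s = 0 \<and> (\<gamma> has_vector_derivative 0) (at s)"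
    unfolding simple_arc_def greaterThanLessThan_iff Ball_def by blast
  then show ?thesis
  proof cases
    case 1
    then show ?thesis unfolding simple_arc_def by (intro disjI1) (auto intro!: *)
  next
    case 2
    then show ?thesis unfolding simple_arc_def by (intro disjI2 disjI1) (auto intro!: *)
  next
    case 3
    have "((\<lambda>t. \<gamma> (- t)) has_vector_derivative 0) (at s)" if "-b < s" "s < -a" for s
      using *[of 0 s] 3[of "- s"] that by auto
    with 3 show ?thesis unfolding simple_arc_def by (intro disjI2) auto
  qed
qed

text \<open>Gronwall's estimate for the squared distance. Derivatives are asked for only inside the
  interval, because at its ends an arc may change from one field to the other.\<close>

lemma solution_unique_forward:
  fixes F :: "'a::real_inner \<Rightarrow> 'a"
  assumes lip: "\<And>p q. p \<in> B \<Longrightarrow> q \<in> B \<Longrightarrow> norm (F p - F q) \<le> K * norm (p - q)"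
    and "a \<le> b" "continuous_on {a..b} \<gamma>" "continuous_on {a..b} \<delta>"
    and "\<gamma> ` {a..b} \<subseteq> B" "\<delta> ` {a..b} \<subseteq> B" and "\<gamma> a = \<delta> a"
    and der: "\<And>s. a < s \<Longrightarrow> s < b \<Longrightarrow> (\<gamma> has_vector_derivative F (\<gamma> s)) (at s)"
      "\<And>s. a < s \<Longrightarrow> s < b \<Longrightarrow> (\<delta> has_vector_derivative F (\<delta> s)) (at s)"
  shows "\<gamma> b = \<delta> b"
proof -
  define w where "w s = (\<gamma> s - \<delta> s) \<bullet> (\<gamma> s - \<delta> s)" for s
  define w' where "w' s = 2 * ((\<gamma> s - \<delta> s) \<bullet> (F (\<gamma> s) - F (\<delta> s)))" for s
  have w: "(w has_real_derivative w' s) (at s)" if "a < s" "s < b" for s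
  proof -
    have "((\<lambda>s. \<gamma> s - \<delta> s) has_derivative (\<lambda>h. h *\<^sub>R (F (\<gamma> s) - F (\<delta> s)))) (at s)"
      using has_vector_derivative_diff[OF der[OF that]] by (simp add: has_vector_derivative_def)
    from has_derivative_inner[OF this this] show ?thesis
      unfolding w_def[abs_def] w'_def has_field_derivative_def
      by (rule has_derivative_eq_rhs) (auto simp: inner_commute fun_eq_iff)
  qed
  have w': "w' s \<le> 2 * K * w s" if "a < s" "s < b" for s
  proof -
    have "(\<gamma> s - \<delta> s) \<bullet> (F (\<gamma> s) - F (\<delta> s)) \<le> norm (\<gamma> s - \<delta> s) * norm (F (\<gamma> s) - F (\<delta> s))"
      by (rule norm_cauchy_schwarz)
    also have "\<dots> \<le> norm (\<gamma> s - \<delta> s) * (K * norm (\<gamma> s - \<delta> s))"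
      using that assms(5,6) by (intro mult_left_mono lip) auto
    also have "\<dots> = K * w s" by (simp add: w_def power2_norm_eq_inner[symmetric] power2_eq_square)
    finally show ?thesis by (simp add: w'_def)
  qed
  have "- (w a * exp (- 2 * K * a)) \<le> - (w b * exp (- 2 * K * b))"
  proof (rule mono_if_deriv_nonneg_except_finite[OF finite.emptyI \<open>a \<le> b\<close>,
        where f' = "\<lambda>t. (2 * K * w t - w' t) * exp (- 2 * K * t)" and f = "\<lambda>t. - (w t * exp (- 2 * K * t))"])
    show "0 \<le> (2 * K * w t - w' t) * exp (- 2 * K * t)" if "a < t" "t < b" for t
      using w'[OF that] by auto
    show "continuous_on {a..b} (\<lambda>t. - (w t * exp (- 2 * K * t)))"
      unfolding w_def by (intro continuous_intros assms)
  qed (auto intro!: derivative_eq_intros w simp: algebra_simps)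
  then have "w b \<le> 0" using \<open>\<gamma> a = \<delta> a\<close> by (simp add: w_def mult_le_0_iff)
  moreover have "0 \<le> w b" unfolding w_def by (rule inner_ge_zero)
  ultimately have "w b = 0" by (rule order_antisym)
  then show ?thesis by (simp add: w_def)
qed

text \<open>By continuity \<open>c * F (\<gamma> s) $ 2\<close> stays positive just after
  \<open>a\<close>, so \<open>c * \<gamma> s $ 2\<close> cannot fall below its initial value 0. The
  factor \<open>c\<close> selects the half plane, and the weak inequality is enough to refute an arc
  lying strictly on the other side.\<close>

lemma enters_half_plane:
  fixes \<gamma> :: "real \<Rightarrow> real^2"
  assumes "continuous_on B F" "a < b" "continuous_on {a..b} \<gamma>" "\<gamma> ` {a..b} \<subseteq> B"
    and der: "\<And>s. a < s \<Longrightarrow> s < b \<Longrightarrow> (\<gamma> has_vector_derivative F (\<gamma> s)) (at s)"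
    and pos: "c * F (\<gamma> a) $ 2 > 0" and "\<gamma> a $ 2 = 0"
  obtains s where "a < s" "s < b" "c * \<gamma> s $ 2 \<ge> 0"
proof -
  have cont: "continuous_on {a..b} (\<lambda>s. c * F (\<gamma> s) $ 2)"
    using assms(4) by (intro continuous_intros continuous_on_compose2[OF assms(1) assms(3)]) auto
  have "((\<lambda>s. c * F (\<gamma> s) $ 2) \<longlongrightarrow> c * F (\<gamma> a) $ 2) (at a within {a..b})"
    using cont \<open>a < b\<close> by (auto simp: continuous_on_def)
  then have "\<forall>\<^sub>F s in at a within {a..b}. c * F (\<gamma> s) $ 2 > 0"
    using pos by (rule order_tendstoD)
  then obtain d where d: "d > 0" "\<And>s. s \<in> {a..b} \<Longrightarrow> s \<noteq> a \<Longrightarrow> dist s a < d \<Longrightarrow> c * F (\<gamma> s) $ 2 > 0"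
    unfolding eventually_at by auto
  define s where "s = a + min d (b - a) / 2"
  have s: "a < s" "s < b" "s < a + d" using d(1) \<open>a < b\<close> by (auto simp: s_def min_def field_simps)
  have "c * \<gamma> a $ 2 \<le> c * \<gamma> s $ 2"
  proof (rule mono_if_deriv_nonneg_except_finite[OF finite.emptyI,
        where f' = "\<lambda>s. c * F (\<gamma> s) $ 2" and f = "\<lambda>s. c * \<gamma> s $ 2"])
    show "continuous_on {a..s} (\<lambda>s. c * \<gamma> s $ 2)"
      using s by (intro continuous_intros continuous_on_subset[OF assms(3)]) auto
    fix t assume t: "a < t" "t < s"
    then show "0 \<le> c * F (\<gamma> t) $ 2"
      using d(2)[of t] s by (auto simp: dist_real_def)
    have "((\<lambda>s. \<gamma> s $ 2) has_vector_derivative F (\<gamma> t) $ 2) (at t)"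
      using t s by (intro bounded_linear.has_vector_derivative[OF bounded_linear_vec_nth] der) auto
    then show "((\<lambda>s. c * \<gamma> s $ 2) has_real_derivative c * F (\<gamma> t) $ 2) (at t)"
      by (auto simp: has_real_derivative_iff_has_vector_derivative[symmetric] intro!: derivative_eq_intros)
  qed (use s in auto)
  with s \<open>\<gamma> a $ 2 = 0\<close> show ?thesis by (intro that[of s]) auto
qed

text \<open>Under the crossing condition every branch of \<open>Z_Sigma\<close> that can be reached
  returns \<open>X p\<close> or \<open>Y p\<close>, including the one for fields that agree on the
  whole line.\<close>

lemma Z_Sigma_crossing:
  assumes "X p $ 2 * Y p $ 2 > 0"
  shows "Z_Sigma D (X, Y) p $ 2 \<noteq> 0"
proof -
  have "Z_Sigma D (X, Y) p \<in> {X p, Y p}"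
    using assms unfolding Z_Sigma_def prod.case by (simp only: if_True split: if_split) blast
  then show ?thesis using assms by auto
qed

locale planar_pair =
  fixes X Y :: field2 and B :: "(real^2) set" and K :: real
  assumes lipX: "\<And>p q. p \<in> B \<Longrightarrow> q \<in> B \<Longrightarrow> norm (X p - X q) \<le> K * norm (p - q)"
    and lipY: "\<And>p q. p \<in> B \<Longrightarrow> q \<in> B \<Longrightarrow> norm (Y p - Y q) \<le> K * norm (p - q)"
    and zero: "X 0 = 0" "Y 0 = 0" "0 \<in> B"
    and crossing: "\<And>p. p \<in> B \<Longrightarrow> p $ 2 = 0 \<Longrightarrow> p \<noteq> 0 \<Longrightarrow> X p $ 2 * Y p $ 2 > 0"
begin

lemma continuous_fields: "continuous_on B X" "continuous_on B Y"
proof -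
  have *: "continuous_on B F" if "\<And>p q. p \<in> B \<Longrightarrow> q \<in> B \<Longrightarrow> norm (F p - F q) \<le> K * norm (p - q)"
    for F :: field2
  proof (rule lipschitz_on_continuous_on[of "max K 0"], rule lipschitz_onI)
    fix p q assume "p \<in> B" "q \<in> B"
    then show "dist (F p) (F q) \<le> max K 0 * dist p q"
      using that[of p q] mult_right_mono[of K "max K 0" "norm (p - q)"] by (simp add: dist_norm)
  qed simp
  show "continuous_on B X" "continuous_on B Y" by (rule *, erule (1) lipX lipY)+
qed

text \<open>The common starting point lies in both closed half planes, hence on the line. At the
  origin the upper arc would have to stay at rest; elsewhere \<open>X\<close> and \<open>Y\<close>
  point to the same side of the line and push one of the two arcs out of its half plane.\<close>

lemma no_opposite_arcs:
  assumes "a < b" "continuous_on {a..b} \<gamma>" "continuous_on {a..b} \<delta>"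
    and "\<gamma> ` {a..b} \<subseteq> B" "\<delta> ` {a..b} \<subseteq> B" and "\<gamma> a = \<delta> a"
    and X: "\<And>s. a < s \<Longrightarrow> s < b \<Longrightarrow> \<gamma> s $ 2 > 0 \<and> (\<gamma> has_vector_derivative X (\<gamma> s)) (at s)"
    and Y: "\<And>s. a < s \<Longrightarrow> s < b \<Longrightarrow> \<delta> s $ 2 < 0 \<and> (\<delta> has_vector_derivative Y (\<delta> s)) (at s)"
  shows False
proof -
  have "\<gamma> a $ 2 \<ge> 0"
  proof (rule continuous_ge_on_closure[of "{a<..<b}" "\<lambda>s. \<gamma> s $ 2"])
    show "continuous_on (closure {a<..<b}) (\<lambda>s. \<gamma> s $ 2)"
      using assms(1,2) by (auto intro!: continuous_intros)
  qed (use X \<open>a < b\<close> in \<open>auto intro: less_imp_le\<close>)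
  moreover have "\<delta> a $ 2 \<le> 0"
  proof (rule continuous_le_on_closure[of "{a<..<b}" "\<lambda>s. \<delta> s $ 2"])
    show "continuous_on (closure {a<..<b}) (\<lambda>s. \<delta> s $ 2)"
      using assms(1,3) by (auto intro!: continuous_intros)
  qed (use Y \<open>a < b\<close> in \<open>auto intro: less_imp_le\<close>)
  ultimately have a0: "\<gamma> a $ 2 = 0" using \<open>\<gamma> a = \<delta> a\<close> by simp
  have "\<gamma> a \<in> B" using assms(1,4) by auto
  show False
  proof (cases "\<gamma> a = 0")
    case True
    define c where "c = (a + b) / 2"
    have c: "a < c" "c < b" using \<open>a < b\<close> by (auto simp: c_def)
    have "\<gamma> c = 0"
      by (rule solution_unique_forward[where F = X and B = B and K = K and a = a and \<delta> = "\<lambda>_. 0"])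
        (use c True assms(4) X zero in \<open>auto intro!: lipX continuous_on_subset[OF assms(2)] continuous_intros derivative_eq_intros\<close>)
    with X[OF c] show False by simp
  next
    case False
    with crossing[OF \<open>\<gamma> a \<in> B\<close> a0] consider "-1 * X (\<gamma> a) $ 2 > 0" | "1 * Y (\<delta> a) $ 2 > 0"
      using \<open>\<gamma> a = \<delta> a\<close> by (auto simp: zero_less_mult_iff)
    then show False
    proof cases
      case 1
      obtain s where "a < s" "s < b" "- 1 * \<gamma> s $ 2 \<ge> 0"
        using enters_half_plane[OF continuous_fields(1) \<open>a < b\<close> assms(2,4) conjunct2[OF X] 1 a0] by blast
      with X[of s] show False by simp
    next
      case 2
      obtain s where "a < s" "s < b" "1 * \<delta> s $ 2 \<ge> 0"
        using enters_half_plane[OF continuous_fields(2) \<open>a < b\<close> assms(3,5) conjunct2[OF Y] 2] a0 \<open>\<gamma> a = \<delta> a\<close>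
        by auto
      with Y[of s] show False by simp
    qed
  qed
qed

text \<open>A resting arc solves the equations of both fields and can be paired with either kind of
  arc. As opposite arcs are excluded, the two curves always have a field in common.\<close>

lemma simple_arcs_agree:
  assumes "a \<le> b" "continuous_on {a..b} \<gamma>" "continuous_on {a..b} \<delta>"
    and "\<gamma> ` {a..b} \<subseteq> B" "\<delta> ` {a..b} \<subseteq> B" and "\<gamma> a = \<delta> a"
    and "simple_arc X Y {a<..<b} \<gamma>" "simple_arc X Y {a<..<b} \<delta>"
  shows "\<gamma> b = \<delta> b"
proof (cases "a = b")
  case False
  with \<open>a \<le> b\<close> have "a < b" by simp
  note uX = solution_unique_forward[of B X K a b \<gamma> \<delta>, OF lipX assms(1-6)]
    and uY = solution_unique_forward[of B Y K a b \<gamma> \<delta>, OF lipY assms(1-6)]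
  note opp = no_opposite_arcs[OF \<open>a < b\<close> assms(2-6)] no_opposite_arcs[OF \<open>a < b\<close> assms(3,2,5,4) assms(6)[symmetric]]
  define sol where "sol F \<eta> \<longleftrightarrow> (\<forall>s\<in>{a<..<b}. (\<eta> has_vector_derivative F (\<eta> s)) (at s))"
    for F :: field2 and \<eta>
  have zero_sol: "sol X \<eta> \<and> sol Y \<eta>" if "\<forall>s\<in>{a<..<b}. \<eta> s = 0 \<and> (\<eta> has_vector_derivative 0) (at s)" for \<eta>
    using that by (simp add: sol_def zero)
  have "sol X \<gamma> \<and> sol X \<delta> \<or> sol Y \<gamma> \<and> sol Y \<delta>"
  proof -
    define up :: "(real \<Rightarrow> real^2) \<Rightarrow> bool" where "up = (\<lambda>\<eta>. \<forall>s\<in>{a<..<b}. \<eta> s $ 2 > 0 \<and> (\<eta> has_vector_derivative X (\<eta> s)) (at s))"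
    define dn :: "(real \<Rightarrow> real^2) \<Rightarrow> bool" where "dn = (\<lambda>\<eta>. \<forall>s\<in>{a<..<b}. \<eta> s $ 2 < 0 \<and> (\<eta> has_vector_derivative Y (\<eta> s)) (at s))"
    have cases: "up \<eta> \<or> dn \<eta> \<or> sol X \<eta> \<and> sol Y \<eta>" if "simple_arc X Y {a<..<b} \<eta>" for \<eta>
      using that zero_sol[of \<eta>] unfolding simple_arc_def up_def dn_def by blast
    have "up \<eta> \<Longrightarrow> sol X \<eta>" "dn \<eta> \<Longrightarrow> sol Y \<eta>" for \<eta>
      unfolding up_def dn_def sol_def by blast+
    moreover have "\<not> (up \<gamma> \<and> dn \<delta>)" "\<not> (up \<delta> \<and> dn \<gamma>)"
      using opp unfolding up_def dn_def greaterThanLessThan_iff Ball_def by blast+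
    ultimately show ?thesis using cases[OF assms(7)] cases[OF assms(8)] by blast
  qed
  then show ?thesis using uX uY by (auto simp: sol_def)
qed (use \<open>\<gamma> a = \<delta> a\<close> in simp)

end

lemma planar_pair_uminus:
  assumes "planar_pair X Y B K"
  shows "planar_pair (\<lambda>p. - X p) (\<lambda>p. - Y p) B K"
proof -
  interpret planar_pair X Y B K by fact
  show ?thesis
  proof
    fix p q assume "p \<in> B" "q \<in> B"
    then show "norm (- X p - - X q) \<le> K * norm (p - q)" "norm (- Y p - - Y q) \<le> K * norm (p - q)"
      using lipX[of q p] lipY[of q p] by (simp_all add: norm_minus_commute)
  qed (use zero crossing in auto)
qed

context planar_pair
begin

lemma simple_arcs_agree_backward:
  assumes "a \<le> b" "continuous_on {a..b} \<gamma>" "continuous_on {a..b} \<delta>"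
    and "\<gamma> ` {a..b} \<subseteq> B" "\<delta> ` {a..b} \<subseteq> B" and "\<gamma> b = \<delta> b"
    and "simple_arc X Y {a<..<b} \<gamma>" "simple_arc X Y {a<..<b} \<delta>"
  shows "\<gamma> a = \<delta> a"
proof -
  interpret rev: planar_pair "\<lambda>p. - X p" "\<lambda>p. - Y p" B K
    by (rule planar_pair_uminus) (rule planar_pair_axioms)
  have "\<gamma> (- (- a)) = \<delta> (- (- a))"
  proof (rule rev.simple_arcs_agree[of "-b" "-a" "\<lambda>t. \<gamma> (- t)" "\<lambda>t. \<delta> (- t)"])
    show "continuous_on {-b..-a} (\<lambda>t. \<gamma> (- t))"
      by (rule continuous_on_compose2[OF assms(2)]) (auto intro!: continuous_intros)
    show "continuous_on {-b..-a} (\<lambda>t. \<delta> (- t))"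
      by (rule continuous_on_compose2[OF assms(3)]) (auto intro!: continuous_intros)
  qed (use assms(1,4-6) in \<open>auto intro!: simple_arc_reverse assms(7,8)\<close>)
  then show ?thesis by simp
qed

lemma Z_Sigma_zero: "Z_Sigma D (X, Y) 0 = 0"
  using zero by (simp add: Z_Sigma_def)

text \<open>Along an open set of times spent in the line the second velocity component vanishes,
  whereas \<open>Z_Sigma\<close> has a nonzero one at every crossing point; only the origin is
  left.\<close>

lemma simple_arc_if_orbit_arc:
  assumes "orbit_arc D (X, Y) J \<gamma>" "open J" "\<gamma> ` J \<subseteq> B"
  shows "simple_arc X Y J \<gamma>"
proof -
  have "\<gamma> s = 0 \<and> (\<gamma> has_vector_derivative 0) (at s)"
    if sol: "solves_in (Z_Sigma D (X, Y)) (switching_line D) J \<gamma>" and "s \<in> J" for s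
  proof -
    have line: "\<gamma> t $ 2 = 0" "\<gamma> t \<in> switching_line D"
      and der: "(\<gamma> has_vector_derivative Z_Sigma D (X, Y) (\<gamma> t)) (at t)" if "t \<in> J" for t
      using sol that by (auto simp: solves_in_def switching_line_def)
    have "((\<lambda>t. \<gamma> t $ 2) has_vector_derivative Z_Sigma D (X, Y) (\<gamma> s) $ 2) (at s)"
      by (intro bounded_linear.has_vector_derivative[OF bounded_linear_vec_nth] der \<open>s \<in> J\<close>)
    moreover have "((\<lambda>t. \<gamma> t $ 2) has_vector_derivative 0) (at s)"
      by (rule has_vector_derivative_transform_within_open[OF _ \<open>open J\<close> \<open>s \<in> J\<close>, of "\<lambda>_. 0"])
        (auto simp: line)
    ultimately have Z: "Z_Sigma D (X, Y) (\<gamma> s) $ 2 = 0"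
      by (rule vector_derivative_unique_at)
    have "\<gamma> s \<in> B" using assms(3) \<open>s \<in> J\<close> by blast
    have "\<gamma> s = 0"
      using crossing[OF \<open>\<gamma> s \<in> B\<close> line(1)[OF \<open>s \<in> J\<close>]] Z Z_Sigma_crossing[of X "\<gamma> s" Y D] by blast
    moreover have "(\<gamma> has_vector_derivative 0) (at s)"
      using der[OF \<open>s \<in> J\<close>] by (simp only: \<open>\<gamma> s = 0\<close> Z_Sigma_zero)
    ultimately show ?thesis by blast
  qed
  then have "solves_in (Z_Sigma D (X, Y)) (switching_line D) J \<gamma> \<Longrightarrow> simple_arc X Y J \<gamma>"
    unfolding simple_arc_def by blast
  moreover have "solves_in X (Sigma_plus D) J \<gamma> \<Longrightarrow> simple_arc X Y J \<gamma>"
    unfolding simple_arc_def solves_in_def Sigma_plus_def by blast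
  moreover have "solves_in Y (Sigma_minus D) J \<gamma> \<Longrightarrow> simple_arc X Y J \<gamma>"
    unfolding simple_arc_def solves_in_def Sigma_minus_def by blast
  ultimately show ?thesis using assms(1) by (auto simp: orbit_arc_def)
qed

lemma trajectory_simple_arcs:
  assumes "trajectory D (X, Y) W I \<gamma>" "W \<subseteq> B" "t \<in> I"
  obtains e where "e > 0"
    and "\<And>s. s \<in> I \<Longrightarrow> t \<le> s \<Longrightarrow> s < t + e \<Longrightarrow> simple_arc X Y {t<..<s} \<gamma>"
    and "\<And>s. s \<in> I \<Longrightarrow> s \<le> t \<Longrightarrow> t - e < s \<Longrightarrow> simple_arc X Y {s<..<t} \<gamma>"
proof -
  from assms obtain e where e: "e > 0" "orbit_arc D (X, Y) ({t - e<..<t} \<inter> I) \<gamma>"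
    "orbit_arc D (X, Y) ({t<..<t + e} \<inter> I) \<gamma>"
    unfolding trajectory_def by blast
  have I: "is_interval I" and img: "\<gamma> ` I \<subseteq> B" using assms by (auto simp: trajectory_def)
  have sub: "orbit_arc D (X, Y) J \<gamma> \<Longrightarrow> J' \<subseteq> J \<Longrightarrow> orbit_arc D (X, Y) J' \<gamma>" for J J'
    unfolding orbit_arc_def solves_in_def by (meson subsetD)
  show ?thesis
  proof (rule that[OF e(1)])
    fix s assume s: "s \<in> I" "t \<le> s" "s < t + e"
    have "{t<..<s} \<subseteq> I" using I \<open>t \<in> I\<close> s(1) by (meson greaterThanLessThan_iff less_imp_le mem_is_interval_1_I subsetI)
    then show "simple_arc X Y {t<..<s} \<gamma>"
      using s img by (intro simple_arc_if_orbit_arc[OF sub[OF e(3)]]) auto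
  next
    fix s assume s: "s \<in> I" "s \<le> t" "t - e < s"
    have "{s<..<t} \<subseteq> I" using I \<open>t \<in> I\<close> s(1) by (meson greaterThanLessThan_iff less_imp_le mem_is_interval_1_I subsetI)
    then show "simple_arc X Y {s<..<t} \<gamma>"
      using s img by (intro simple_arc_if_orbit_arc[OF sub[OF e(2)]]) auto
  qed
qed

text \<open>The times of agreement form a clopen subset of the common interval: closed by
  continuity, open by uniqueness for the arcs that follow and precede each such time.\<close>

theorem trajectories_agree:
  assumes \<gamma>: "trajectory D (X, Y) W I \<gamma>" and \<delta>: "trajectory D (X, Y) W J \<delta>" and "W \<subseteq> B"
    and "t0 \<in> I \<inter> J" "\<gamma> t0 = \<delta> t0" "t \<in> I \<inter> J"
  shows "\<gamma> t = \<delta> t"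
proof -
  define A where "A = I \<inter> J"
  define C where "C = {s\<in>A. \<gamma> s - \<delta> s = 0}"
  have int: "is_interval A" unfolding A_def using \<gamma> \<delta> by (intro is_interval_Int) (auto simp: trajectory_def)
  have cont: "continuous_on A \<gamma>" "continuous_on A \<delta>" and img: "\<gamma> ` A \<subseteq> B" "\<delta> ` A \<subseteq> B"
    using \<gamma> \<delta> \<open>W \<subseteq> B\<close> by (auto simp: A_def trajectory_def intro: continuous_on_subset)
  have "connected A" using int by (simp add: is_interval_connected_1)
  moreover have "closedin (top_of_set A) C"
    unfolding C_def by (intro continuous_closedin_preimage_constant continuous_intros cont)
  moreover have "openin (top_of_set A) C"
    unfolding openin_euclidean_subtopology_iff
  proof (intro conjI ballI)
    fix s assume "s \<in> C"
    then have s: "s \<in> I" "s \<in> J" "s \<in> A" "\<gamma> s = \<delta> s" by (auto simp: C_def A_def)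
    obtain e1 where e1: "e1 > 0"
      "\<And>u. u \<in> I \<Longrightarrow> s \<le> u \<Longrightarrow> u < s + e1 \<Longrightarrow> simple_arc X Y {s<..<u} \<gamma>"
      "\<And>u. u \<in> I \<Longrightarrow> u \<le> s \<Longrightarrow> s - e1 < u \<Longrightarrow> simple_arc X Y {u<..<s} \<gamma>"
      using trajectory_simple_arcs[OF \<gamma> \<open>W \<subseteq> B\<close> s(1)] by blast
    obtain e2 where e2: "e2 > 0"
      "\<And>u. u \<in> J \<Longrightarrow> s \<le> u \<Longrightarrow> u < s + e2 \<Longrightarrow> simple_arc X Y {s<..<u} \<delta>"
      "\<And>u. u \<in> J \<Longrightarrow> u \<le> s \<Longrightarrow> s - e2 < u \<Longrightarrow> simple_arc X Y {u<..<s} \<delta>"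
      using trajectory_simple_arcs[OF \<delta> \<open>W \<subseteq> B\<close> s(2)] by blast
    have "u \<in> C" if "u \<in> A" "dist u s < min e1 e2" for u
    proof -
      have u: "u \<in> I" "u \<in> J" using that by (auto simp: A_def)
      have d: "u < s + e1" "u < s + e2" "s - e1 < u" "s - e2 < u"
        using that(2) by (auto simp: dist_real_def abs_if split: if_splits)
      have seg: "{s..u} \<subseteq> A" "{u..s} \<subseteq> A"
        using int s(3) that(1) by (meson atLeastAtMost_iff mem_is_interval_1_I subsetI)+
      note csub = continuous_on_subset[OF cont(1)] continuous_on_subset[OF cont(2)]
      have "\<gamma> u = \<delta> u"
      proof (cases "s \<le> u")
        case True
        show ?thesis
          by (rule simple_arcs_agree[OF True csub(1)[OF seg(1)] csub(2)[OF seg(1)]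
              order_trans[OF image_mono[OF seg(1)] img(1)] order_trans[OF image_mono[OF seg(1)] img(2)] s(4)])
            (use d u True in \<open>auto intro!: e1(2) e2(2)\<close>)
      next
        case False
        then have "u \<le> s" by simp
        show ?thesis
          by (rule simple_arcs_agree_backward[OF \<open>u \<le> s\<close> csub(1)[OF seg(2)] csub(2)[OF seg(2)]
              order_trans[OF image_mono[OF seg(2)] img(1)] order_trans[OF image_mono[OF seg(2)] img(2)] s(4)])
            (use d u \<open>u \<le> s\<close> in \<open>auto intro!: e1(3) e2(3)\<close>)
      qed
      with that show ?thesis by (simp add: C_def)
    qed
    with e1(1) e2(1) show "\<exists>e>0. \<forall>u\<in>A. dist u s < e \<longrightarrow> u \<in> C"
      by (intro exI[of _ "min e1 e2"]) auto
  qed (auto simp: C_def)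
  ultimately have "C = {} \<or> C = A" by (meson connected_clopen)
  moreover have "t0 \<in> C" using assms(4,5) by (simp add: C_def A_def)
  ultimately have "t \<in> C" using assms(6) by (auto simp: A_def)
  then show ?thesis by (simp add: C_def)
qed

lemma zero_trajectory:
  assumes "0 \<in> D" "0 \<in> W" "is_interval I" "I \<noteq> {}"
  shows "trajectory D (X, Y) W I (\<lambda>_. 0)"
proof -
  have "orbit_arc D (X, Y) J (\<lambda>_. 0)" for J
    unfolding orbit_arc_def solves_in_def using assms(1) Z_Sigma_zero by (auto simp: switching_line_def)
  then show ?thesis unfolding trajectory_def using assms by (auto intro!: exI[of _ 1])
qed

end

section \<open>Polar coordinates adapted to a piecewise focus\<close>

lemma max_min_scale:
  fixes r x :: real
  assumes "0 \<le> r"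
  shows "max (r * x) 0 = r * max x 0" "min (r * x) 0 = r * min x 0"
  using assms by (auto simp: max_def min_def mult_le_0_iff zero_le_mult_iff)

text \<open>Serves to recover \<open>R p S * sin p\<close> from the second coordinate of
  \<open>P p S\<close>, which depends on it linearly with different positive slopes above and below
  the line.\<close>

lemma max_min_comb_inj:
  fixes p q :: real
  assumes "p > 0" "q > 0" "max x 0 * p + min x 0 * q = max y 0 * p + min y 0 * q"
  shows "x = y"
proof -
  have "max x 0 * p + min x 0 * q < max y 0 * p + min y 0 * q" if "x < y" for x y :: real
  proof -
    consider "0 \<le> x" | "x < 0" "0 \<le> y" | "y < 0" using that by linarith
    then show ?thesis
    proof cases
      case 2
      then have "x * q < 0" "0 \<le> y * p" using assms by (simp_all add: mult_less_0_iff)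
      with 2 show ?thesis by simp
    qed (use that assms in auto)
  qed
  from this[of x y] this[of y x] assms(3) show ?thesis by (cases x y rule: linorder_cases) auto
qed

text \<open>A trajectory has to be a single arc on a short interval on either side of each time. A
  constant sign of sine on one-sided neighbourhoods provides this, also at the crossing
  angles.\<close>

lemma sin_sign_locally:
  obtains d where "d > 0"
    and "(\<forall>s. x < s \<longrightarrow> s < x + d \<longrightarrow> sin s > 0) \<or> (\<forall>s. x < s \<longrightarrow> s < x + d \<longrightarrow> sin s < 0)"
    and "(\<forall>s. x - d < s \<longrightarrow> s < x \<longrightarrow> sin s > 0) \<or> (\<forall>s. x - d < s \<longrightarrow> s < x \<longrightarrow> sin s < (0::real))"
proof (cases "sin x = 0")
  case True
  then have "\<bar>cos x\<bar> = 1" by (rule sin_zero_abs_cos_one)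
  then consider "cos x = 1" | "cos x = -1" by linarith
  moreover have "sin s = cos x * sin (s - x)" for s
    using sin_add[of "s - x" x] True by simp
  moreover have "sin (s - x) > 0" if "x < s" "s < x + pi" for s using that by (intro sin_gt_zero) auto
  moreover have "sin (s - x) < 0" if "x - pi < s" "s < x" for s
  proof -
    have "sin (x - s) > 0" using that by (intro sin_gt_zero) auto
    then show ?thesis using sin_minus[of "x - s"] by simp
  qed
  ultimately have "(\<forall>s. x < s \<longrightarrow> s < x + pi \<longrightarrow> sin s > 0) \<and> (\<forall>s. x - pi < s \<longrightarrow> s < x \<longrightarrow> sin s < 0) \<or>
    (\<forall>s. x < s \<longrightarrow> s < x + pi \<longrightarrow> sin s < 0) \<and> (\<forall>s. x - pi < s \<longrightarrow> s < x \<longrightarrow> sin s > 0)"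
    by (metis mult_1 mult_minus1 neg_0_less_iff_less neg_less_0_iff_less)
  then show ?thesis by (intro that[of pi]) auto
next
  case False
  have "((\<lambda>s. sin s * sin x) \<longlongrightarrow> sin x * sin x) (nhds x)"
    by (intro tendsto_intros filterlim_ident)
  moreover have "sin x * sin x > 0" using False not_real_square_gt_zero by blast
  ultimately have "\<forall>\<^sub>F s in nhds x. sin s * sin x > 0" by (rule order_tendstoD)
  then obtain d where d: "d > 0" "\<And>s. \<bar>s - x\<bar> < d \<Longrightarrow> sin s * sin x > 0"
    unfolding eventually_nhds_metric dist_real_def by blast
  have near: "sin s * sin x > 0" if "x - d < s" "s < x + d" for s using that by (intro d(2)) auto
  show ?thesis
  proof (cases "sin x > 0")
    case True
    then have "sin s > 0" if "x - d < s" "s < x + d" for s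
      using near[OF that] by (simp add: zero_less_mult_iff)
    with d(1) show ?thesis by (intro that[of d]) auto
  next
    assume "\<not> sin x > 0"
    then have "sin s < 0" if "x - d < s" "s < x + d" for s
      using near[OF that] by (simp add: zero_less_mult_iff)
    with d(1) show ?thesis by (intro that[of d]) auto
  qed
qed

text \<open>On the ray of angle \<open>p\<close>, at \<open>r = c exp (S - k arccos (cos p))\<close>, the angular speed is \<open>W1\<close> above and
  \<open>W2\<close> below the switching line, and \<open>S\<close> changes at the rate \<open>F1\<close> or \<open>F2\<close> with respect to \<open>p\<close>; the
  summand \<open>k\<close> in the equations for \<open>X\<close> and \<open>Y\<close> is the derivative of \<open>k arccos (cos p)\<close> up to sign.\<close>

locale piecewise_focus = planar_pair X Y B K
  for X Y :: field2 and B :: "(real^2) set" and K :: real +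
  fixes v1 vp vm :: "real^2" and k c \<alpha> :: real
    and F1 F2 W1 W2 :: "real \<times> real \<Rightarrow> real" and L C w1 w2 \<delta> :: real
  assumes v1: "v1 $ 2 = 0" "v1 $ 1 \<noteq> 0" and v2: "vp $ 2 > 0" "vm $ 2 > 0"
    and c: "c > 0" and \<alpha>: "\<alpha> = 1 \<or> \<alpha> = -1"
    and cont_F: "continuous_on UNIV F1" "continuous_on UNIV F2"
    and cont_W: "continuous_on UNIV W1" "continuous_on UNIV W2"
    and periodic_F: "\<And>p q S. cos p = cos q \<Longrightarrow> sin p = sin q \<Longrightarrow> F1 (p, S) = F1 (q, S) \<and> F2 (p, S) = F2 (q, S)"
    and w1: "w1 > 0" and W: "\<And>z. w1 \<le> W1 z \<and> W1 z \<le> w2" "\<And>z. w1 \<le> W2 z \<and> W2 z \<le> w2"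
    and \<delta>: "\<delta> > 0" "\<And>z. \<delta> \<le> \<alpha> * F1 z \<and> \<delta> \<le> \<alpha> * F2 z"
    and F_le: "\<And>z. \<bar>F1 z\<bar> \<le> C \<and> \<bar>F2 z\<bar> \<le> C"
    and L: "L > 0" "\<And>p u v. \<bar>F1 (p, u) - F1 (p, v)\<bar> \<le> L * \<bar>u - v\<bar> \<and> \<bar>F2 (p, u) - F2 (p, v)\<bar> \<le> L * \<bar>u - v\<bar>"
    and X: "\<And>p r S. sin p > 0 \<Longrightarrow> S < 0 \<Longrightarrow> r = c * exp (S - k * arccos (cos p)) \<Longrightarrow>
        X (r *\<^sub>R (cos p *\<^sub>R v1 + sin p *\<^sub>R vp)) =
        (r * W1 (p, S)) *\<^sub>R ((F1 (p, S) - k) *\<^sub>R (cos p *\<^sub>R v1 + sin p *\<^sub>R vp) + (- sin p *\<^sub>R v1 + cos p *\<^sub>R vp))"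
    and Y: "\<And>p r S. sin p < 0 \<Longrightarrow> S < 0 \<Longrightarrow> r = c * exp (S - k * arccos (cos p)) \<Longrightarrow>
        Y (r *\<^sub>R (cos p *\<^sub>R v1 + sin p *\<^sub>R vm)) =
        (r * W2 (p, S)) *\<^sub>R ((F2 (p, S) + k) *\<^sub>R (cos p *\<^sub>R v1 + sin p *\<^sub>R vm) + (- sin p *\<^sub>R v1 + cos p *\<^sub>R vm))"
begin

definition F :: "real \<Rightarrow> real \<Rightarrow> real" where
  "F = (\<lambda>p S. if sin p > 0 then F1 (p, S) else F2 (p, S))"

definition R :: "real \<Rightarrow> real \<Rightarrow> real" where
  "R p S = c * exp (S - k * arccos (cos p))"

text \<open>The change from \<open>vp\<close> to \<open>vm\<close> is written with
  \<open>max\<close> and \<open>min\<close>, so that continuity across the line, where both terms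
  vanish, needs no case distinction.\<close>

definition E :: "real \<Rightarrow> real^2" where
  "E p = cos p *\<^sub>R v1 + max (sin p) 0 *\<^sub>R vp + min (sin p) 0 *\<^sub>R vm"

definition P :: "real \<Rightarrow> real \<Rightarrow> real^2" where
  "P p S = R p S *\<^sub>R E p"

lemma R_pos: "R p S > 0"
  using c by (simp add: R_def)

lemma continuous_P [continuous_intros]:
  fixes T :: "'a::t2_space set"
  assumes "continuous_on T f" "continuous_on T g"
  shows "continuous_on T (\<lambda>x. P (f x) (g x))"
  unfolding P_def R_def E_def by (intro continuous_intros assms) auto

lemma P_cong: "cos p = cos q \<Longrightarrow> sin p = sin q \<Longrightarrow> P p S = P q S"
  by (simp add: P_def R_def E_def)

lemma P_eq:
  assumes "p' = R p S * cos p" "q' = R p S * sin p"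
  shows "P p S = p' *\<^sub>R v1 + max q' 0 *\<^sub>R vp + min q' 0 *\<^sub>R vm"
  unfolding P_def E_def assms max_min_scale[OF less_imp_le[OF R_pos]] by (simp add: scaleR_add_right)

text \<open>The second coordinate determines \<open>R sin\<close>, then the first determines
  \<open>R cos\<close>. These give \<open>R\<close> and the direction, and finally \<open>S\<close>,
  since the correction \<open>k arccos (cos p)\<close> depends on the direction only.\<close>

lemma P_inj:
  assumes "P p S = P q T"
  shows "cos p = cos q" "sin p = sin q" "S = T"
proof -
  let ?r = "R p S" and ?s = "R q T"
  note eq = assms[unfolded P_eq[OF refl refl] vec_eq_iff forall_2 vector_add_component vector_scaleR_component]
  have s: "?r * sin p = ?s * sin q"
    by (rule max_min_comb_inj[OF v2]) (use eq v1 in simp)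
  have ce: "?r * cos p = ?s * cos q" using eq v1 by (simp add: s)
  have sq: "(x * cos u)\<^sup>2 + (x * sin u)\<^sup>2 = x\<^sup>2" for x u :: real
    by (simp add: power_mult_distrib distrib_left[symmetric])
  have "?r\<^sup>2 = ?s\<^sup>2" using sq[of ?r p] sq[of ?s q] s ce by simp
  then have rs: "?r = ?s" using R_pos[of p S] R_pos[of q T] by (simp add: power2_eq_iff)
  with s ce R_pos[of p S] show cs: "cos p = cos q" "sin p = sin q" by auto
  from rs cs c show "S = T" by (simp add: R_def)
qed

lemma P_snd_pos: "sin p > 0 \<Longrightarrow> P p S $ 2 > 0"
  and P_snd_neg: "sin p < 0 \<Longrightarrow> P p S $ 2 < 0"
  and P_snd_zero: "sin p = 0 \<Longrightarrow> P p S $ 2 = 0"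
  using R_pos[of p S] v1 v2 by (auto simp: P_def E_def max_def min_def mult_less_0_iff)

lemma P_nonzero: "P p S \<noteq> 0"
proof
  assume 0: "P p S = 0"
  then have "sin p = 0" using P_snd_pos[of p S] P_snd_neg[of p S] by (cases "sin p" "0::real" rule: linorder_cases) auto
  with 0 R_pos[of p S] have "cos p *\<^sub>R v1 = 0" by (simp add: P_def E_def)
  then have "cos p = 0" using v1 by auto
  with \<open>sin p = 0\<close> show False using sin_cos_squared_add[of p] by simp
qed

lemma P_norm_le: "norm (P p S) \<le> c * exp (\<bar>k\<bar> * pi) * (norm v1 + norm vp + norm vm) * exp S"
proof -
  have a: "0 \<le> arccos (cos p)" "arccos (cos p) \<le> pi" by (auto intro: arccos_lbound arccos_ubound)
  have "- k * arccos (cos p) \<le> \<bar>k\<bar> * arccos (cos p)" by (intro mult_right_mono a) auto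
  also have "\<dots> \<le> \<bar>k\<bar> * pi" by (intro mult_left_mono a) auto
  finally have R: "R p S \<le> c * exp (\<bar>k\<bar> * pi + S)" using c by (auto simp: R_def)
  have "norm (E p) \<le> \<bar>cos p\<bar> * norm v1 + \<bar>max (sin p) 0\<bar> * norm vp + \<bar>min (sin p) 0\<bar> * norm vm"
    unfolding E_def by (intro norm_triangle_le add_mono) simp_all
  also have "\<dots> \<le> 1 * norm v1 + 1 * norm vp + 1 * norm vm"
    by (intro add_mono mult_right_mono) (auto simp: max_def min_def abs_sin_le_one abs_cos_le_one)
  finally have "R p S * norm (E p) \<le> c * exp (\<bar>k\<bar> * pi + S) * (norm v1 + norm vp + norm vm)"
    using R R_pos[of p S] c by (intro mult_mono) auto
  then show ?thesis using R_pos[of p S] by (simp add: P_def exp_add algebra_simps)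
qed

section \<open>Solutions of the angular equation and their dependence on the label \<theta>\<close>

lemma F_lipschitz: "\<bar>F p u - F p v\<bar> \<le> L * \<bar>u - v\<bar>"
  using L(2) by (simp add: F_def)

lemma F_bounds: "\<bar>F p u\<bar> \<le> C" "\<delta> \<le> \<alpha> * F p u"
  using F_le \<delta>(2) by (auto simp: F_def)

text \<open>\<open>\<Psi> \<theta>\<close> is the orbit that passes through the curve \<open>S = 0\<close> at the angle \<open>\<theta>\<close>.\<close>

definition \<Psi> :: "real \<Rightarrow> real \<Rightarrow> real" where
  "\<Psi> \<theta> = (SOME y. solves_ode F y \<and> y \<theta> = 0)"

lemma \<Psi>: "solves_ode F (\<Psi> \<theta>)" "\<Psi> \<theta> \<theta> = 0"
proof -
  have "\<exists>y. solves_ode F y \<and> y \<theta> = 0"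
    using solves_ode_exists[OF F_def cont_F F_bounds(1) F_lipschitz L(1)] by blast
  from someI_ex[OF this] show "solves_ode F (\<Psi> \<theta>)" "\<Psi> \<theta> \<theta> = 0" by (simp_all add: \<Psi>_def)
qed

lemma \<Psi>_lipschitz: "\<bar>\<Psi> \<theta> b - \<Psi> \<theta> a\<bar> \<le> C * \<bar>b - a\<bar>"
proof -
  have "\<bar>\<Psi> \<theta> b - \<Psi> \<theta> a\<bar> \<le> C * (b - a)" if "a \<le> b" for a b
  proof -
    have "- C \<le> F t (\<Psi> \<theta> t)" "F t (\<Psi> \<theta> t) \<le> C" for t
      using F_bounds(1)[of t "\<Psi> \<theta> t"] by auto
    from solves_ode_growth[OF \<Psi>(1) this that] show ?thesis by (auto simp: abs_le_iff)
  qed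
  from this[of a b] this[of b a] show ?thesis by (cases "a \<le> b") (auto simp: abs_minus_commute)
qed

lemma \<Psi>_growth:
  assumes "a \<le> b"
  shows "\<delta> * (b - a) \<le> \<alpha> * (\<Psi> \<theta> b - \<Psi> \<theta> a)"
proof -
  have F: "F t (\<Psi> \<theta> t) \<le> C" "- C \<le> F t (\<Psi> \<theta> t)" "\<delta> \<le> \<alpha> * F t (\<Psi> \<theta> t)" for t
    using F_bounds[of t "\<Psi> \<theta> t"] by auto
  from \<alpha> show ?thesis
  proof
    assume "\<alpha> = 1"
    then show ?thesis using solves_ode_growth(1)[OF \<Psi>(1) _ F(1) assms, of \<delta>] F(3) by simp
  next
    assume "\<alpha> = -1"
    then show ?thesis using solves_ode_growth(2)[OF \<Psi>(1) F(2) _ assms, of "- \<delta>"] F(3)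
      by (simp add: le_minus_iff)
  qed
qed

lemma \<Psi>_neg: "\<alpha> * (p - \<theta>) < 0 \<Longrightarrow> \<Psi> \<theta> p \<le> \<delta> * (\<alpha> * (p - \<theta>))"
  using \<Psi>_growth[of p \<theta> \<theta>] \<Psi>_growth[of \<theta> p \<theta>] \<alpha> \<Psi>(2)[of \<theta>] by (auto simp: algebra_simps)

lemma \<Psi>_less_zero: "\<alpha> * (p - \<theta>) < 0 \<Longrightarrow> \<Psi> \<theta> p < 0"
  using \<Psi>_neg[of p \<theta>] \<delta>(1) by (smt (verit) mult_pos_neg)

text \<open>Solutions that meet coincide, and the strict monotonicity of
  \<open>\<alpha> \<Psi>\<close> leaves room for only one zero.\<close>

lemma \<Psi>_inj:
  assumes "\<Psi> \<theta> p = \<Psi> \<eta> p"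
  shows "\<theta> = \<eta>"
proof -
  have "\<Psi> \<theta> = \<Psi> \<eta>" by (rule solves_ode_unique[OF \<Psi>(1) \<Psi>(1) F_lipschitz assms])
  then have "\<Psi> \<theta> \<eta> = 0" using \<Psi>(2)[of \<eta>] by simp
  then show ?thesis
    using \<Psi>_growth[of \<eta> \<theta> \<theta>] \<Psi>_growth[of \<theta> \<eta> \<theta>] \<Psi>(2)[of \<theta>] \<delta>(1)
    by (cases \<theta> \<eta> rule: linorder_cases) (auto simp: mult_le_0_iff)
qed

text \<open>The translate of a solution by a period solves the same equation. This makes the chart
  independent of the branch of the logarithm.\<close>

lemma \<Psi>_shift:
  assumes d: "cos d = 1" "sin d = 0"
  shows "\<Psi> (\<theta> + d) (p + d) = \<Psi> \<theta> p"
proof -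
  have tr: "cos (t + d) = cos t" "sin (t + d) = sin t" for t
    using d by (simp_all add: cos_add sin_add)
  have "solves_ode F (\<lambda>t. \<Psi> (\<theta> + d) (t + d))"
    unfolding solves_ode_def
  proof (intro conjI allI impI)
    show "continuous_on UNIV (\<lambda>t. \<Psi> (\<theta> + d) (t + d))"
      by (intro continuous_on_compose2[OF solves_ode_continuous[OF \<Psi>(1), of UNIV]] continuous_intros) auto
    fix t :: real assume "sin t \<noteq> 0"
    then have "(\<Psi> (\<theta> + d) has_real_derivative F (t + d) (\<Psi> (\<theta> + d) (t + d))) (at (t + d))"
      by (intro solves_ode_deriv[OF \<Psi>(1)]) (simp add: tr)
    moreover have "F (t + d) u = F t u" for u
      using periodic_F[of "t + d" t u] by (simp add: F_def tr)
    ultimately show "((\<lambda>t. \<Psi> (\<theta> + d) (t + d)) has_real_derivative F t (\<Psi> (\<theta> + d) (t + d))) (at t)"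
      by (simp add: DERIV_shift)
  qed
  then have "(\<lambda>t. \<Psi> (\<theta> + d) (t + d)) = \<Psi> \<theta>"
    by (rule solves_ode_unique[OF _ \<Psi>(1) F_lipschitz, where a = \<theta>]) (simp add: \<Psi>(2))
  then show ?thesis by (rule fun_cong)
qed

text \<open>For continuity in the label, \<open>\<Psi> t\<close> and \<open>\<Psi> a\<close> are
  compared at the angle \<open>a\<close>: the latter is 0 there, and the former has size at most
  \<open>C \<bar>a - t\<bar>\<close> because it vanishes at \<open>t\<close>. Gronwall carries the
  estimate to \<open>b\<close>.\<close>

lemma \<Psi>_tendsto:
  assumes "(f \<longlongrightarrow> a) A" "(g \<longlongrightarrow> b) A"
  shows "((\<lambda>x. \<Psi> (f x) (g x)) \<longlongrightarrow> \<Psi> a b) A"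
proof -
  have bound: "\<bar>\<Psi> t p - \<Psi> a b\<bar> \<le> C * \<bar>p - b\<bar> + C * \<bar>a - t\<bar> * exp (L * \<bar>b - a\<bar>)" for t p
  proof -
    have "\<bar>\<Psi> t b - \<Psi> a b\<bar> \<le> \<bar>\<Psi> t a - \<Psi> a a\<bar> * exp (L * \<bar>b - a\<bar>)"
      by (rule solves_ode_gronwall[OF \<Psi>(1) \<Psi>(1) F_lipschitz])
    also have "\<dots> \<le> C * \<bar>a - t\<bar> * exp (L * \<bar>b - a\<bar>)"
      using \<Psi>_lipschitz[of t a t] by (intro mult_right_mono) (auto simp: \<Psi>(2))
    finally show ?thesis using \<Psi>_lipschitz[of t p b] by linarith
  qed
  have "((\<lambda>x. C * \<bar>g x - b\<bar> + C * \<bar>a - f x\<bar> * exp (L * \<bar>b - a\<bar>)) \<longlongrightarrow>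
      C * \<bar>b - b\<bar> + C * \<bar>a - a\<bar> * exp (L * \<bar>b - a\<bar>)) A"
    by (intro tendsto_intros assms)
  then have lim: "((\<lambda>x. C * \<bar>g x - b\<bar> + C * \<bar>a - f x\<bar> * exp (L * \<bar>b - a\<bar>)) \<longlongrightarrow> 0) A" by simp
  have "((\<lambda>x. \<Psi> (f x) (g x) - \<Psi> a b) \<longlongrightarrow> 0) A"
    by (rule Lim_null_comparison[OF always_eventually lim]) (simp only: real_norm_def bound simp_thms)
  then show ?thesis by (rule LIM_zero_cancel)
qed

lemma continuous_\<Psi> [continuous_intros]:
  "continuous_on T f \<Longrightarrow> continuous_on T g \<Longrightarrow> continuous_on T (\<lambda>x. \<Psi> (f x) (g x))"
  unfolding continuous_on_def by (auto intro: \<Psi>_tendsto)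

end

section \<open>The spiral chart\<close>

context piecewise_focus
begin

text \<open>The spirals \<open>Im w - \<alpha> Re w = \<theta>\<close> in the logarithmic coordinate \<open>w\<close> of the disc go to the orbits
  \<open>\<Psi> \<theta>\<close>.\<close>

definition Q :: "complex \<Rightarrow> real^2" where
  "Q w = P (Im w) (\<Psi> (Im w - \<alpha> * Re w) (Im w))"

text \<open>The principal branch is only a choice of representative: \<open>Q\<close> takes equal
  values at all logarithms of a point, so the cut causes no discontinuity.\<close>

definition G :: "complex \<Rightarrow> real^2" where
  "G z = (if z = 0 then 0 else Q (Ln z))"

lemma exp_eq_trig:
  assumes "exp w = exp w'"
  shows "Re w = Re w'" "cos (Im w) = cos (Im w')" "sin (Im w) = sin (Im w')"
proof -
  have "norm (exp w) = norm (exp w')" using assms by simp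
  then show re: "Re w = Re w'" by simp
  show "cos (Im w) = cos (Im w')" "sin (Im w) = sin (Im w')"
    using arg_cong[OF assms, of Re] arg_cong[OF assms, of Im] re by (simp_all add: Re_exp Im_exp)
qed

lemma \<Psi>_periodic:
  assumes "cos p = cos q" "sin p = sin q"
  shows "\<Psi> (p - u) p = \<Psi> (q - u) q"
proof -
  have "cos (p - q) = 1" "sin (p - q) = 0"
    using assms sin_cos_squared_add3[of q] by (simp_all add: cos_diff sin_diff)
  from \<Psi>_shift[OF this, of "q - u" q] show ?thesis by simp
qed

lemma Q_cong:
  assumes "exp w = exp w'"
  shows "Q w = Q w'"
  using \<Psi>_periodic[OF exp_eq_trig(2,3)[OF assms]] P_cong[OF exp_eq_trig(2,3)[OF assms]]
  by (simp add: Q_def exp_eq_trig(1)[OF assms])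

lemma G_exp: "G (exp w) = Q w"
  using Q_cong[of "Ln (exp w)" w] by (simp add: G_def)

lemma Q_nonzero: "Q w \<noteq> 0"
  by (simp add: Q_def P_nonzero)

text \<open>\<open>P\<close> determines the direction and \<open>S\<close>. After both points are
  moved to one angle by periodicity, injectivity of \<open>\<Psi>\<close> in its label gives equal
  real parts.\<close>

lemma Q_inj:
  assumes "Q w = Q w'"
  shows "exp w = exp w'"
proof -
  note P_inj[OF assms[unfolded Q_def]]
  then have cs: "cos (Im w) = cos (Im w')" "sin (Im w) = sin (Im w')"
    and "\<Psi> (Im w - \<alpha> * Re w) (Im w) = \<Psi> (Im w' - \<alpha> * Re w') (Im w')" by auto
  with \<Psi>_periodic[OF cs, of "\<alpha> * Re w"]
  have "\<Psi> (Im w' - \<alpha> * Re w) (Im w') = \<Psi> (Im w' - \<alpha> * Re w') (Im w')" by simp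
  from \<Psi>_inj[OF this] have "Re w = Re w'" using \<alpha> by auto
  with cs show ?thesis by (intro complex_eqI) (simp_all add: Re_exp Im_exp)
qed

lemma G_inj: "inj G"
proof (rule injI)
  fix z z' assume eq: "G z = G z'"
  show "z = z'"
    using eq Q_inj[of "Ln z" "Ln z'"] Q_nonzero[of "Ln z"] Q_nonzero[of "Ln z'"]
    by (cases "z = 0"; cases "z' = 0") (auto simp: G_def)
qed

lemma continuous_Q: "continuous_on UNIV Q"
  unfolding Q_def by (intro continuous_intros)

text \<open>\<open>Ln (z / z0) + Ln z0\<close> is a logarithm of \<open>z\<close> that is continuous
  at \<open>z0\<close>, even if \<open>z0\<close> lies on the cut of \<open>Ln\<close>.\<close>

lemma isCont_G:
  assumes "z0 \<noteq> 0"
  shows "isCont G z0"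
proof -
  have "isCont (\<lambda>z. z / z0) z0" using assms by (intro continuous_intros)
  moreover have "isCont Ln (z0 / z0)" using assms by (intro continuous_at_Ln) simp
  ultimately have "isCont (\<lambda>z. Ln (z / z0)) z0" by (rule isCont_o2)
  then have "isCont (\<lambda>z. Ln (z / z0) + Ln z0) z0" by (rule isCont_add[OF _ continuous_const])
  moreover have "isCont Q w" for w using continuous_Q by (simp add: continuous_on_eq_continuous_at)
  ultimately have cont: "isCont (\<lambda>z. Q (Ln (z / z0) + Ln z0)) z0" by (rule isCont_o2)
  have "\<forall>\<^sub>F z in nhds z0. G z = Q (Ln (z / z0) + Ln z0)"
  proof (rule eventually_nhds_in_open[of "- {0}", THEN eventually_mono])
    fix z :: complex assume "z \<in> - {0}"
    then have "exp (Ln (z / z0) + Ln z0) = z" using assms by (simp add: exp_add)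
    then show "G z = Q (Ln (z / z0) + Ln z0)" using G_exp[of "Ln (z / z0) + Ln z0"] by simp
  qed (use assms in auto)
  from isCont_cong[OF this] cont show ?thesis by (rule iffD2)
qed

text \<open>At the origin the slope bound \<open>\<delta>\<close> gives
  \<open>S \<le> \<delta> ln \<bar>z\<bar>\<close>, hence the Hoelder estimate
  \<open>norm (G z) \<le> M \<bar>z\<bar>^\<delta>\<close>.\<close>

lemma continuous_G: "continuous_on (ball 0 1) G"
proof -
  define M where "M = c * exp (\<bar>k\<bar> * pi) * (norm v1 + norm vp + norm vm)"
  have M: "M \<ge> 0" "norm (P p S) \<le> M * exp S" for p S
    using c P_norm_le unfolding M_def by auto
  have le: "norm (G z) \<le> M * norm z powr \<delta>" if z: "z \<in> ball 0 1" for z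
  proof (cases "z = 0")
    case False
    define w where "w = Ln z"
    have "ln (norm z) < 0" using z False by simp
    then have "\<Psi> (Im w - \<alpha> * Re w) (Im w) \<le> \<delta> * ln (norm z)"
      using \<Psi>_neg[of "Im w" "Im w - \<alpha> * Re w"] \<alpha> False by (auto simp: w_def)
    then have "norm (Q w) \<le> M * exp (\<delta> * ln (norm z))"
      unfolding Q_def by (intro order_trans[OF M(2)] mult_left_mono) (use M in auto)
    then show ?thesis using False by (simp add: G_def w_def powr_def)
  qed (simp add: G_def)
  have "isCont G z" if z: "z \<in> ball 0 1" for z
  proof (cases "z = 0")
    case True
    have "((\<lambda>z::complex. M * norm z powr \<delta>) \<longlongrightarrow> M * norm (0::complex) powr \<delta>) (at 0)"
      using \<delta>(1) by (intro tendsto_intros) auto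
    then have lim: "((\<lambda>z::complex. M * norm z powr \<delta>) \<longlongrightarrow> 0) (at 0)" by simp
    have "\<forall>\<^sub>F z in at 0. norm (G z) \<le> M * norm z powr \<delta>"
      using eventually_at_ball[OF zero_less_one, of "0::complex" UNIV] by eventually_elim (auto intro: le)
    then have "(G \<longlongrightarrow> 0) (at 0)" using lim by (rule Lim_null_comparison)
    then show ?thesis by (simp add: True isCont_def G_def)
  qed (rule isCont_G)
  then show ?thesis by (intro continuous_at_imp_continuous_on) auto
qed

definition U :: "(real^2) set" where
  "U = G ` ball 0 1"

lemma open_U: "open U"
  unfolding U_def using G_inj continuous_G
  by (intro invariance_of_domain_gen) (auto intro: inj_on_subset)

lemma homeomorphism_G: "\<exists>H. homeomorphism (ball 0 1) U G H"
  using invariance_of_domain_homeomorphism[OF open_ball continuous_G _ inj_on_subset[OF G_inj subset_UNIV]]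
  unfolding U_def by auto

lemma G_zero: "G 0 = 0"
  by (simp add: G_def)

lemma zero_in_U: "0 \<in> U"
  using G_zero unfolding U_def by (metis centre_in_ball image_eqI zero_less_one)

lemma G_line: "G z $ 2 = 0 \<longleftrightarrow> Im z = 0"
proof (cases "z = 0")
  case False
  define w where "w = Ln z"
  have z: "z = exp w" using False by (simp add: w_def)
  have "G z $ 2 = 0 \<longleftrightarrow> sin (Im w) = 0"
    using P_snd_pos[of "Im w"] P_snd_neg[of "Im w"] P_snd_zero[of "Im w"]
    unfolding z G_exp Q_def by (metis less_irrefl linorder_neqE_linordered_idom)
  also have "\<dots> \<longleftrightarrow> Im z = 0" by (simp add: z Im_exp)
  finally show ?thesis .
qed (simp add: G_zero)

lemma U_cases:
  assumes "p \<in> U"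
  obtains "p = 0" | w where "Re w < 0" "p = Q w"
proof -
  from assms obtain z where z: "p = G z" "norm z < 1" by (auto simp: U_def)
  show ?thesis
  proof (cases "z = 0")
    case False
    with z have "Re (Ln z) < 0" "p = Q (Ln z)" by (simp_all add: G_def)
    then show ?thesis by (rule that(2))
  qed (use that(1) z G_zero in simp)
qed

lemma Q_in_U: "Re w < 0 \<Longrightarrow> Q w \<in> U"
  unfolding U_def by (rule image_eqI[where x = "exp w"]) (simp_all add: G_exp)

lemma Q_spiral: "\<alpha> * (p - \<theta>) < 0 \<Longrightarrow> P p (\<Psi> \<theta> p) \<in> U"
  and spiral_eq: "P p (\<Psi> \<theta> p) = G (exp (Complex (\<alpha> * (p - \<theta>)) p))"
proof -
  have inv: "\<alpha> * (\<alpha> * (p - \<theta>)) = p - \<theta>" using \<alpha> by auto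
  have *: "Q (Complex (\<alpha> * (p - \<theta>)) p) = P p (\<Psi> \<theta> p)"
    by (simp only: Q_def complex.sel inv diff_diff_eq2 add_diff_cancel_left')
  show "P p (\<Psi> \<theta> p) = G (exp (Complex (\<alpha> * (p - \<theta>)) p))" by (simp add: G_exp *)
  show "\<alpha> * (p - \<theta>) < 0 \<Longrightarrow> P p (\<Psi> \<theta> p) \<in> U"
    using Q_in_U[of "Complex (\<alpha> * (p - \<theta>)) p"] by (simp add: *)
qed

text \<open>All points of \<open>U\<close> other than the origin have \<open>S < 0\<close>. The
  curve \<open>S = 0\<close> therefore lies outside, which limits the time that an orbit spends in
  \<open>U\<close>.\<close>

lemma exit_not_in_U: "P \<theta> 0 \<notin> U"
proof
  assume "P \<theta> 0 \<in> U"
  then show False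
  proof (cases rule: U_cases)
    case (2 w)
    then have "\<Psi> (Im w - \<alpha> * Re w) (Im w) = 0" using P_inj(3) unfolding Q_def by metis
    moreover have "\<Psi> (Im w - \<alpha> * Re w) (Im w) < 0" using 2(1) \<alpha> by (intro \<Psi>_less_zero) auto
    ultimately show False by simp
  qed (simp add: P_nonzero)
qed

end

section \<open>Trajectories along the spirals\<close>

context piecewise_focus
begin

definition V :: "real^2 \<Rightarrow> real \<Rightarrow> real^2" where
  "V v p = cos p *\<^sub>R v1 + sin p *\<^sub>R v"

lemma arccos_cos_has_derivative:
  assumes "sin p \<noteq> 0"
  shows "((\<lambda>p. arccos (cos p)) has_real_derivative sgn (sin p)) (at p)"
proof -
  have "\<bar>cos p\<bar> < 1"
    using assms by (intro abs_square_less_1[THEN iffD1]) (simp add: cos_squared_eq)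
  then have b: "-1 < cos p" "cos p < 1" by auto
  have "sqrt (1 - (cos p)\<^sup>2) = \<bar>sin p\<bar>" by (simp add: sin_squared_eq[symmetric])
  then have "inverse (- sqrt (1 - (cos p)\<^sup>2)) * (- sin p) = sgn (sin p)"
    using assms by (simp add: sgn_if abs_if field_simps)
  then show ?thesis
    using DERIV_chain2[OF DERIV_arccos[OF b] DERIV_cos[of p]] by simp
qed

text \<open>The logarithmic derivative of the radius is \<open>y' - k sgn (sin (f t))\<close> times
  the angular speed \<open>f'\<close>. With \<open>y' = F\<close> and \<open>f' = W\<close> the
  result is the right-hand side prescribed in the locale.\<close>

lemma polar_curve_derivative:
  fixes f y :: "real \<Rightarrow> real"
  assumes f: "(f has_real_derivative f') (at t)"
    and y: "((\<lambda>t. y (f t)) has_real_derivative y' * f') (at t)"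
    and "sin (f t) \<noteq> 0"
  shows "((\<lambda>t. R (f t) (y (f t)) *\<^sub>R V v (f t)) has_vector_derivative
    (R (f t) (y (f t)) * f') *\<^sub>R ((y' - k * sgn (sin (f t))) *\<^sub>R V v (f t) + (- sin (f t) *\<^sub>R v1 + cos (f t) *\<^sub>R v))) (at t)"
proof -
  have arc: "((\<lambda>t. arccos (cos (f t))) has_real_derivative sgn (sin (f t)) * f') (at t)"
    by (rule DERIV_chain2[OF arccos_cos_has_derivative[OF assms(3)] f])
  have R: "((\<lambda>t. R (f t) (y (f t))) has_real_derivative
      R (f t) (y (f t)) * ((y' - k * sgn (sin (f t))) * f')) (at t)"
  proof -
    have "((\<lambda>t. y (f t) - k * arccos (cos (f t))) has_real_derivative y' * f' - k * (sgn (sin (f t)) * f')) (at t)"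
      by (intro DERIV_diff DERIV_cmult y arc)
    from DERIV_cmult[OF DERIV_fun_exp[OF this], of c] show ?thesis
      by (simp add: R_def[abs_def] algebra_simps)
  qed
  have V: "((\<lambda>t. V v (f t)) has_vector_derivative f' *\<^sub>R (- sin (f t) *\<^sub>R v1 + cos (f t) *\<^sub>R v)) (at t)"
  proof -
    have "((\<lambda>t. cos (f t)) has_vector_derivative - sin (f t) * f') (at t)"
      "((\<lambda>t. sin (f t)) has_vector_derivative cos (f t) * f') (at t)"
      unfolding has_real_derivative_iff_has_vector_derivative[symmetric]
      by (auto intro!: derivative_eq_intros f)
    from has_vector_derivative_add[OF
        bounded_linear.has_vector_derivative[OF bounded_linear_scaleR_left this(1), of v1]
        bounded_linear.has_vector_derivative[OF bounded_linear_scaleR_left this(2), of v]]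
    show ?thesis unfolding V_def[abs_def] by (simp add: scaleR_add_right scaleR_diff_right mult.commute)
  qed
  from has_vector_derivative_scaleR[OF R V] show ?thesis
    by (simp add: scaleR_add_right scaleR_add_left mult.commute mult.left_commute add.commute)
qed

lemma P_eq_V:
  "sin p \<ge> 0 \<Longrightarrow> P p S = R p S *\<^sub>R V vp p"
  "sin p \<le> 0 \<Longrightarrow> P p S = R p S *\<^sub>R V vm p"
  by (simp_all add: P_def E_def V_def max_def min_def)

text \<open>Time as a function of the angle satisfies \<open>dT/dp = 1 / W\<close>, whose right-hand
  side does not contain the unknown and jumps at fixed angles, so the existence theorem applies. The
  clock is the inverse function; an equation for the angle itself would jump in the unknown.\<close>

lemma spiral_clock:
  obtains f where "continuous_on UNIV f" "strict_mono f" "surj f" "f t0 = p0"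
    and "\<And>s t. \<bar>f s - f t\<bar> \<le> w2 * \<bar>s - t\<bar>"
    and "\<And>t. sin (f t) > 0 \<Longrightarrow> (f has_real_derivative W1 (f t, \<Psi> \<theta> (f t))) (at t)"
    and "\<And>t. sin (f t) < 0 \<Longrightarrow> (f has_real_derivative W2 (f t, \<Psi> \<theta> (f t))) (at t)"
proof -
  define g where "g p u = (if sin p > 0 then 1 / W1 (p, \<Psi> \<theta> p) else 1 / W2 (p, \<Psi> \<theta> p))" for p u :: real
  have Wpos: "W1 z > 0" "W2 z > 0" "w2 > 0" for z using W[of z] w1 by linarith+
  have g: "1 / w2 \<le> g p u" "g p u \<le> 1 / w1" for p u
    using W Wpos w1 by (auto simp: g_def intro!: divide_left_mono)
  have "\<exists>T. solves_ode g T \<and> T p0 = t0"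
  proof (rule solves_ode_exists)
    show "g = (\<lambda>p u. if sin p > 0 then (\<lambda>z. 1 / W1 (fst z, \<Psi> \<theta> (fst z))) (p, u)
        else (\<lambda>z. 1 / W2 (fst z, \<Psi> \<theta> (fst z))) (p, u))"
      by (simp add: g_def fun_eq_iff)
    show "continuous_on UNIV (\<lambda>z::real \<times> real. 1 / W1 (fst z, \<Psi> \<theta> (fst z)))"
      "continuous_on UNIV (\<lambda>z::real \<times> real. 1 / W2 (fst z, \<Psi> \<theta> (fst z)))"
      by (intro continuous_on_divide continuous_on_const continuous_on_compose2[OF cont_W(1)]
          continuous_on_compose2[OF cont_W(2)] continuous_on_Pair continuous_on_fst continuous_on_id
          continuous_\<Psi> subset_UNIV ballI less_imp_neq[OF Wpos(1), symmetric] less_imp_neq[OF Wpos(2), symmetric])+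
    show "\<bar>g p u\<bar> \<le> 1 / w1" for p u
    proof -
      have "0 < 1 / w2" using Wpos(3) by simp
      with g[of p u] show ?thesis by linarith
    qed
    \<comment> \<open>The left-hand side is 0, so any positive constant serves as Lipschitz
      constant.\<close>
    show "\<bar>g p u - g p v\<bar> \<le> 1 * \<bar>u - v\<bar>" for p u v by (simp add: g_def)
  qed simp
  then obtain T where T: "solves_ode g T" "T p0 = t0" by blast
  have growth: "1 / w2 * (b - a) \<le> T b - T a" if "a \<le> b" for a b
    using solves_ode_growth(1)[OF T(1) g that] .
  have Tmono: "T a < T b" if "a < b" for a b
  proof -
    have "0 < 1 / w2 * (b - a)" using that Wpos(3) by simp
    with growth[of a b] that show ?thesis by linarith
  qed
  then have Tinj: "strict_mono T" by (rule strict_monoI)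
  have contT: "continuous_on S T" for S by (rule solves_ode_continuous[OF T(1)])
  have "\<exists>p. T p = t" for t
  proof -
    \<comment> \<open>\<open>T\<close> has slope at least \<open>1 / w2\<close>, so within this
      angular distance of \<open>p0\<close> it takes the value \<open>t\<close>.\<close>
    define b where "b = w2 * \<bar>t - t0\<bar>"
    have "b \<ge> 0" "b / w2 = \<bar>t - t0\<bar>" using Wpos(3) by (auto simp: b_def)
    then have "T (p0 - b) \<le> t" "t \<le> T (p0 + b)"
      using growth[of p0 "p0 + b"] growth[of "p0 - b" p0] by (auto simp: T(2))
    then show ?thesis using IVT'[of T "p0 - b" t "p0 + b"] contT \<open>b \<ge> 0\<close> by auto
  qed
  then obtain f where Tf: "T (f t) = t" for t by metis
  have fT: "f (T p) = p" for p using Tf[of "T p"] strict_mono_eq[OF Tinj] by simp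
  have lip: "\<bar>f s - f t\<bar> \<le> w2 * \<bar>s - t\<bar>" for s t
  proof -
    have "\<bar>f s - f t\<bar> / w2 \<le> \<bar>s - t\<bar>"
      using growth[of "f s" "f t"] growth[of "f t" "f s"] by (cases "f s \<le> f t") (auto simp: Tf)
    then show ?thesis using Wpos(3) by (simp add: field_simps)
  qed
  have cont: "continuous_on UNIV f"
    by (rule lipschitz_on_continuous_on[of w2])
      (auto intro!: lipschitz_onI simp: dist_real_def lip less_imp_le[OF Wpos(3)])
  have mono: "strict_mono f"
    by (rule strict_monoI) (metis Tf Tinj strict_mono_less)
  have der: "(f has_real_derivative inverse (g (f t) (T (f t)))) (at t)" if "sin (f t) \<noteq> 0" for t
  proof (rule DERIV_inverse_function[where f = T and g = f and x = t and a = "t - 1" and b = "t + 1"])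
    show "(T has_real_derivative g (f t) (T (f t))) (at (f t))"
      by (rule solves_ode_deriv[OF T(1) that])
    show "g (f t) (T (f t)) \<noteq> 0"
      using g(1)[of "f t" "T (f t)"] Wpos(3) by (metis divide_pos_pos leD zero_less_one)
    show "isCont f t" using cont by (simp add: continuous_on_eq_continuous_at)
  qed (auto simp: Tf)
  show ?thesis
  proof (rule that[OF cont mono _ _ lip])
    show "surj f" using fT by (metis surjI)
    show "f t0 = p0" using fT[of p0] T(2) by simp
    show "(f has_real_derivative W1 (f t, \<Psi> \<theta> (f t))) (at t)" if "sin (f t) > 0" for t
      using der[of t] that by (simp add: g_def)
    show "(f has_real_derivative W2 (f t, \<Psi> \<theta> (f t))) (at t)" if "sin (f t) < 0" for t
      using der[of t] that by (simp add: g_def)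
  qed
qed

text \<open>The clock turns the solution \<open>\<Psi> \<theta>\<close> into a trajectory. A
  competitor through the same point agrees with it inside \<open>I\<close>; if it lasted longer, it
  would pass the time at which the angle is \<open>\<theta>\<close>, where by continuity it would
  sit on the curve \<open>S = 0\<close> outside \<open>U\<close>.\<close>

lemma spiral_trajectory:
  assumes "U \<subseteq> D" "U \<subseteq> B" "\<alpha> * (p0 - \<theta>) < 0"
  obtains I \<gamma> f where "trajectory D (X, Y) U I \<gamma>" "t0 \<in> I" "f t0 = p0"
    "\<And>t. \<gamma> t = P (f t) (\<Psi> \<theta> (f t))" "strict_mono f" "I = {t. \<alpha> * (f t - \<theta>) < 0}"
    "(\<lambda>t. f t - \<theta>) ` I = {u. \<alpha> * u < 0}"
    "\<And>J \<delta>. trajectory D (X, Y) U J \<delta> \<Longrightarrow> t0 \<in> J \<Longrightarrow> \<delta> t0 = \<gamma> t0 \<Longrightarrow> J \<subseteq> I \<and> (\<forall>t\<in>J. \<delta> t = \<gamma> t)"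
proof -
  obtain f where f: "continuous_on UNIV f" "strict_mono f" "surj f" "f t0 = p0"
    and lip: "\<And>s t. \<bar>f s - f t\<bar> \<le> w2 * \<bar>s - t\<bar>"
    and der1: "\<And>t. sin (f t) > 0 \<Longrightarrow> (f has_real_derivative W1 (f t, \<Psi> \<theta> (f t))) (at t)"
    and der2: "\<And>t. sin (f t) < 0 \<Longrightarrow> (f has_real_derivative W2 (f t, \<Psi> \<theta> (f t))) (at t)"
    using spiral_clock by blast
  define \<gamma> where "\<gamma> t = P (f t) (\<Psi> \<theta> (f t))" for t
  define I where "I = {t. \<alpha> * (f t - \<theta>) < 0}"
  have w2: "w2 > 0" using W(1)[of undefined] w1 by linarith
  have cont: "continuous_on S \<gamma>" for S
    unfolding \<gamma>_def by (intro continuous_P continuous_\<Psi> continuous_on_const continuous_on_subset[OF f(1)] subset_UNIV)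
  have in_U: "\<gamma> t \<in> U" if "t \<in> I" for t
    using that unfolding I_def \<gamma>_def by (intro Q_spiral) simp
  have neg: "\<Psi> \<theta> (f t) < 0" if "t \<in> I" for t
    using that unfolding I_def by (intro \<Psi>_less_zero) simp
  have dX: "(\<gamma> has_vector_derivative X (\<gamma> t)) (at t)" if t: "t \<in> I" "sin (f t) > 0" for t
  proof -
    have "((\<lambda>t. R (f t) (\<Psi> \<theta> (f t)) *\<^sub>R V vp (f t)) has_vector_derivative
      (R (f t) (\<Psi> \<theta> (f t)) * W1 (f t, \<Psi> \<theta> (f t))) *\<^sub>R ((F1 (f t, \<Psi> \<theta> (f t)) - k * sgn (sin (f t))) *\<^sub>R V vp (f t)
        + (- sin (f t) *\<^sub>R v1 + cos (f t) *\<^sub>R vp))) (at t)"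
      using DERIV_chain2[OF solves_ode_deriv[OF \<Psi>(1)[of \<theta>]] der1[OF t(2)]] t(2)
      by (intro polar_curve_derivative der1) (auto simp: F_def)
    also have "(R (f t) (\<Psi> \<theta> (f t)) * W1 (f t, \<Psi> \<theta> (f t))) *\<^sub>R ((F1 (f t, \<Psi> \<theta> (f t)) - k * sgn (sin (f t))) *\<^sub>R V vp (f t)
        + (- sin (f t) *\<^sub>R v1 + cos (f t) *\<^sub>R vp)) = X (\<gamma> t)"
      using X[OF t(2) neg[OF t(1)] refl] t(2)
      by (simp add: \<gamma>_def P_eq_V(1) R_def V_def)
    finally show ?thesis
    proof (rule has_vector_derivative_transform_within_open[where S = "{t. sin (f t) > 0}"])
      show "open {t. sin (f t) > 0}"
        by (intro open_Collect_less continuous_on_const continuous_on_sin f)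
    qed (use t in \<open>auto simp: \<gamma>_def P_eq_V(1)\<close>)
  qed
  have dY: "(\<gamma> has_vector_derivative Y (\<gamma> t)) (at t)" if t: "t \<in> I" "sin (f t) < 0" for t
  proof -
    have "((\<lambda>t. R (f t) (\<Psi> \<theta> (f t)) *\<^sub>R V vm (f t)) has_vector_derivative
      (R (f t) (\<Psi> \<theta> (f t)) * W2 (f t, \<Psi> \<theta> (f t))) *\<^sub>R ((F2 (f t, \<Psi> \<theta> (f t)) - k * sgn (sin (f t))) *\<^sub>R V vm (f t)
        + (- sin (f t) *\<^sub>R v1 + cos (f t) *\<^sub>R vm))) (at t)"
      using DERIV_chain2[OF solves_ode_deriv[OF \<Psi>(1)[of \<theta>]] der2[OF t(2)]] t(2)
      by (intro polar_curve_derivative der2) (auto simp: F_def)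
    also have "(R (f t) (\<Psi> \<theta> (f t)) * W2 (f t, \<Psi> \<theta> (f t))) *\<^sub>R ((F2 (f t, \<Psi> \<theta> (f t)) - k * sgn (sin (f t))) *\<^sub>R V vm (f t)
        + (- sin (f t) *\<^sub>R v1 + cos (f t) *\<^sub>R vm)) = Y (\<gamma> t)"
      using Y[OF t(2) neg[OF t(1)] refl] t(2)
      by (simp add: \<gamma>_def P_eq_V(2) R_def V_def)
    finally show ?thesis
    proof (rule has_vector_derivative_transform_within_open[where S = "{t. sin (f t) < 0}"])
      show "open {t. sin (f t) < 0}"
        by (intro open_Collect_less continuous_on_const continuous_on_sin f)
    qed (use t in \<open>auto simp: \<gamma>_def P_eq_V(2)\<close>)
  qed
  have arc: "orbit_arc D (X, Y) J \<gamma>"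
    if J: "J \<subseteq> I" and sgn: "(\<forall>s\<in>J. sin (f s) > 0) \<or> (\<forall>s\<in>J. sin (f s) < 0)" for J
    using sgn
  proof
    assume s: "\<forall>s\<in>J. sin (f s) > 0"
    then have "solves_in X (Sigma_plus D) J \<gamma>"
      unfolding solves_in_def Sigma_plus_def using J in_U assms(1) dX
      by (auto simp: \<gamma>_def intro!: P_snd_pos)
    then show ?thesis by (simp add: orbit_arc_def)
  next
    assume s: "\<forall>s\<in>J. sin (f s) < 0"
    then have "solves_in Y (Sigma_minus D) J \<gamma>"
      unfolding solves_in_def Sigma_minus_def using J in_U assms(1) dY
      by (auto simp: \<gamma>_def intro!: P_snd_neg)
    then show ?thesis by (simp add: orbit_arc_def)
  qed
  have "t0 \<in> I" using assms(3) f(4) by (simp add: I_def)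
  have interval: "is_interval I"
    unfolding is_interval_1
  proof (intro ballI allI impI)
    fix a b x assume ab: "a \<in> I" "b \<in> I" and "a \<le> x \<and> x \<le> b"
    then have "f a \<le> f x" "f x \<le> f b" using strict_mono_less_eq[OF f(2)] by auto
    with ab \<alpha> show "x \<in> I" by (auto simp: I_def)
  qed
  have traj: "trajectory D (X, Y) U I \<gamma>"
    unfolding trajectory_def
  proof (intro conjI ballI)
    fix t assume "t \<in> I"
    obtain d where d: "d > 0"
      "(\<forall>s. f t < s \<longrightarrow> s < f t + d \<longrightarrow> sin s > 0) \<or> (\<forall>s. f t < s \<longrightarrow> s < f t + d \<longrightarrow> sin s < 0)"
      "(\<forall>s. f t - d < s \<longrightarrow> s < f t \<longrightarrow> sin s > 0) \<or> (\<forall>s. f t - d < s \<longrightarrow> s < f t \<longrightarrow> sin s < 0)"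
      by (rule sin_sign_locally)
    define e where "e = d / w2"
    have close: "\<bar>f s - f t\<bar> < d" if "\<bar>s - t\<bar> < e" for s
    proof -
      have "w2 * \<bar>s - t\<bar> < d" using that w2 by (simp add: e_def field_simps)
      with lip[of s t] show ?thesis by linarith
    qed
    have right: "f t < f s \<and> f s < f t + d" if "s \<in> {t<..<t + e} \<inter> I" for s
      using close[of s] that strict_mono_less[OF f(2), of t s] by (auto simp: abs_less_iff)
    have left: "f t - d < f s \<and> f s < f t" if "s \<in> {t - e<..<t} \<inter> I" for s
      using close[of s] that strict_mono_less[OF f(2), of s t] by (auto simp: abs_less_iff)
    show "\<exists>e>0. orbit_arc D (X, Y) ({t - e<..<t} \<inter> I) \<gamma> \<and> orbit_arc D (X, Y) ({t<..<t + e} \<inter> I) \<gamma>"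
    proof (intro exI conjI)
      show "e > 0" using d(1) w2 by (simp add: e_def)
      show "orbit_arc D (X, Y) ({t - e<..<t} \<inter> I) \<gamma>" using d(3) left by (intro arc) blast+
      show "orbit_arc D (X, Y) ({t<..<t + e} \<inter> I) \<gamma>" using d(2) right by (intro arc) blast+
    qed
  qed (use \<open>t0 \<in> I\<close> interval cont in_U in auto)
  obtain t1 where t1: "f t1 = \<theta>" using f(3) by (metis surjD)
  have "\<gamma> t1 \<notin> U" using exit_not_in_U by (simp add: \<gamma>_def t1 \<Psi>(2))
  have less: "f s < f t \<longleftrightarrow> s < t" for s t by (rule strict_mono_less[OF f(2)])
  have less_eq: "f s \<le> f t \<longleftrightarrow> s \<le> t" for s t by (rule strict_mono_less_eq[OF f(2)])
  \<comment> \<open>Only the end of \<open>I\<close> at the angle \<open>\<theta>\<close> is finite: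
    it comes after \<open>t0\<close> for \<open>\<alpha> = 1\<close> and before \<open>t0\<close>
    for \<open>\<alpha> = -1\<close>.\<close>
  have between: "t1 \<in> closed_segment t0 t" if "t \<notin> I" for t
    using \<alpha>
  proof
    assume "\<alpha> = 1"
    then have "f t0 < f t1" "f t1 \<le> f t" using that \<open>t0 \<in> I\<close> t1 by (auto simp: I_def)
    then show ?thesis by (simp add: less less_eq closed_segment_eq_real_ivl)
  next
    assume "\<alpha> = -1"
    then have "f t1 < f t0" "f t \<le> f t1" using that \<open>t0 \<in> I\<close> t1 by (auto simp: I_def)
    then show ?thesis by (simp add: less less_eq closed_segment_eq_real_ivl)
  qed
  have "t0 \<noteq> t1" using \<open>t0 \<in> I\<close> t1 by (auto simp: I_def)
  have before: "open_segment t0 t1 \<subseteq> I"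
  proof
    fix s assume "s \<in> open_segment t0 t1"
    then have "t0 < s \<and> s < t1 \<or> t1 < s \<and> s < t0"
      by (auto simp: open_segment_eq_real_ivl split: if_splits)
    then have "f t0 < f s \<and> f s < f t1 \<or> f t1 < f s \<and> f s < f t0" by (simp add: less)
    with \<open>t0 \<in> I\<close> \<alpha> show "s \<in> I" by (auto simp: I_def t1)
  qed
  have excl: "J \<subseteq> I \<and> (\<forall>t\<in>J. \<eta> t = \<gamma> t)"
    if \<eta>: "trajectory D (X, Y) U J \<eta>" "t0 \<in> J" "\<eta> t0 = \<gamma> t0" for J \<eta>
  proof -
    have agree: "\<eta> t = \<gamma> t" if "t \<in> J" "t \<in> I" for t
      by (rule trajectories_agree[OF \<eta>(1) traj assms(2)]) (use \<eta> \<open>t0 \<in> I\<close> that in auto)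
    have "J \<subseteq> I"
    proof (rule ccontr)
      assume "\<not> J \<subseteq> I"
      then obtain t where t: "t \<in> J" "t \<notin> I" by blast
      have J: "is_interval J" "continuous_on J \<eta>" "\<eta> ` J \<subseteq> U" using \<eta>(1) by (auto simp: trajectory_def)
      have "convex J" using J(1) by (simp add: is_interval_convex)
      then have "closed_segment t0 t \<subseteq> J" using \<eta>(2) t(1) by (simp add: closed_segment_subset)
      with between[OF t(2)] have "t1 \<in> J" by blast
      with \<open>convex J\<close> \<eta>(2) have seg: "closed_segment t0 t1 \<subseteq> J" by (simp add: closed_segment_subset)
      have cl: "closure (open_segment t0 t1) = closed_segment t0 t1"
        using \<open>t0 \<noteq> t1\<close> by simp
      have "\<eta> t1 - \<gamma> t1 = 0"
      proof (rule continuous_constant_on_closure[where S = "open_segment t0 t1" and f = "\<lambda>t. \<eta> t - \<gamma> t"])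
        show "continuous_on (closure (open_segment t0 t1)) (\<lambda>t. \<eta> t - \<gamma> t)"
          unfolding cl by (intro continuous_on_diff continuous_on_subset[OF J(2) seg] cont)
        show "t1 \<in> closure (open_segment t0 t1)" unfolding cl by simp
        show "\<eta> t - \<gamma> t = 0" if "t \<in> open_segment t0 t1" for t
          using agree[of t] that before seg open_closed_segment[OF that] by auto
      qed
      with J(3) \<open>t1 \<in> J\<close> \<open>\<gamma> t1 \<notin> U\<close> show False by auto
    qed
    with agree show ?thesis by blast
  qed
  have onto: "(\<lambda>t. f t - \<theta>) ` I = {u. \<alpha> * u < 0}"
  proof
    show "{u. \<alpha> * u < 0} \<subseteq> (\<lambda>t. f t - \<theta>) ` I"
    proof
      fix u assume "u \<in> {u. \<alpha> * u < 0}"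
      moreover obtain t where "f t = u + \<theta>" using f(3) by (metis surjD)
      ultimately show "u \<in> (\<lambda>t. f t - \<theta>) ` I" by (intro image_eqI[of _ _ t]) (auto simp: I_def)
    qed
  qed (auto simp: I_def)
  show ?thesis
    by (rule that[OF traj \<open>t0 \<in> I\<close> f(4) \<gamma>_def f(2) I_def onto excl])
qed

end

section \<open>Equivalence of two spiral charts\<close>

text \<open>An orbit of the linear normal form in complex notation, parametrised by the angle
  \<open>u\<close> relative to \<open>\<theta>\<close>. It meets the unit circle at
  \<open>u = 0\<close>, so \<open>\<alpha> * u < 0\<close> describes the part inside.\<close>

definition spiral :: "real \<Rightarrow> real \<Rightarrow> real \<Rightarrow> complex" where
  "spiral \<alpha> \<theta> u = exp (Complex (\<alpha> * u) (u + \<theta>))"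

lemma spiral_in_ball: "\<alpha> * u < 0 \<Longrightarrow> spiral \<alpha> \<theta> u \<in> ball 0 1"
  by (simp add: spiral_def)

definition spiral_orbit ::
    "(complex \<Rightarrow> real^2) \<Rightarrow> real \<Rightarrow> real \<Rightarrow> real set \<Rightarrow> (real \<Rightarrow> real) \<Rightarrow> (real \<Rightarrow> real^2) \<Rightarrow> bool" where
  "spiral_orbit G \<alpha> \<theta> I h \<gamma> \<longleftrightarrow> strict_mono_on I h \<and> h ` I = {u. \<alpha> * u < 0} \<and> (\<forall>t\<in>I. \<gamma> t = G (spiral \<alpha> \<theta> (h t)))"

text \<open>A complete account of the maximal trajectories in terms of the disc: each is the rest
  point or a spiral, and every label \<theta> occurs. Fields with charts for the same \<alpha> can
  then be compared without reference to their coefficients.\<close>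

definition spiral_chart ::
    "(real^2) set \<Rightarrow> field2 \<times> field2 \<Rightarrow> real \<Rightarrow> (real^2) set \<Rightarrow> (complex \<Rightarrow> real^2) \<Rightarrow> bool" where
  "spiral_chart D Z \<alpha> U G \<longleftrightarrow>
     open U \<and> U \<subseteq> D \<and> (\<exists>H. homeomorphism (ball 0 1) U G H) \<and> G 0 = 0 \<and>
     (\<forall>z. G z $ 2 = 0 \<longleftrightarrow> Im z = 0) \<and>
     (\<forall>I \<gamma>. maximal_trajectory D Z U I \<gamma> \<longrightarrow>
        I = UNIV \<and> (\<forall>t. \<gamma> t = 0) \<or> (\<exists>\<theta> h. spiral_orbit G \<alpha> \<theta> I h \<gamma>)) \<and>
     maximal_trajectory D Z U UNIV (\<lambda>_. 0) \<and>
     (\<forall>\<theta>. \<exists>I \<gamma> h. maximal_trajectory D Z U I \<gamma> \<and> spiral_orbit G \<alpha> \<theta> I h \<gamma>)"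

lemma (in piecewise_focus) spiral_chart_G:
  assumes "U \<subseteq> B" "B \<subseteq> D"
  shows "spiral_chart D (X, Y) \<alpha> U G"
proof -
  have "U \<subseteq> D" "0 \<in> D" using assms zero_in_U by auto
  have zero_max: "maximal_trajectory D (X, Y) U UNIV (\<lambda>_. 0)"
    unfolding maximal_trajectory_def using zero_trajectory[OF \<open>0 \<in> D\<close> zero_in_U] by auto
  have spiral_G: "P p (\<Psi> \<theta> p) = G (spiral \<alpha> \<theta> (p - \<theta>))" for p \<theta>
    by (simp add: spiral_def spiral_eq)
  have exists: "\<exists>I \<gamma> h. maximal_trajectory D (X, Y) U I \<gamma> \<and> spiral_orbit G \<alpha> \<theta> I h \<gamma>" for \<theta>
  proof -
    \<comment> \<open>The starting angle is one radian away from \<open>\<theta>\<close>, on the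
      inner side because \<open>\<alpha> * \<alpha> = 1\<close>.\<close>
    have "\<alpha> * (\<theta> - \<alpha> - \<theta>) < 0" using \<alpha> by auto
    then obtain I \<gamma> f where *: "trajectory D (X, Y) U I \<gamma>" "0 \<in> I" "f 0 = \<theta> - \<alpha>"
        "\<And>t. \<gamma> t = P (f t) (\<Psi> \<theta> (f t))" "strict_mono f" "I = {t. \<alpha> * (f t - \<theta>) < 0}"
        "(\<lambda>t. f t - \<theta>) ` I = {u. \<alpha> * u < 0}"
        "\<And>J \<delta>. trajectory D (X, Y) U J \<delta> \<Longrightarrow> 0 \<in> J \<Longrightarrow> \<delta> 0 = \<gamma> 0 \<Longrightarrow> J \<subseteq> I \<and> (\<forall>t\<in>J. \<delta> t = \<gamma> t)"
      by (rule spiral_trajectory[OF \<open>U \<subseteq> D\<close> assms(1), where ?t0.0 = 0]) (rule that)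
    have "maximal_trajectory D (X, Y) U I \<gamma>"
      unfolding maximal_trajectory_def
    proof (intro conjI allI impI)
      fix J \<delta> assume J: "trajectory D (X, Y) U J \<delta> \<and> I \<subseteq> J \<and> (\<forall>t\<in>I. \<delta> t = \<gamma> t)"
      with *(8)[of J \<delta>] *(2) show "J = I" by blast
    qed (rule *(1))
    moreover have "spiral_orbit G \<alpha> \<theta> I (\<lambda>t. f t - \<theta>) \<gamma>"
      using *(5,7) by (auto simp: spiral_orbit_def *(4) spiral_G strict_mono_on_def strict_mono_def)
    ultimately show ?thesis by blast
  qed
  have all: "I = UNIV \<and> (\<forall>t. \<gamma> t = 0) \<or> (\<exists>\<theta> h. spiral_orbit G \<alpha> \<theta> I h \<gamma>)"
    if max: "maximal_trajectory D (X, Y) U I \<gamma>" for I \<gamma>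
  proof -
    have traj: "trajectory D (X, Y) U I \<gamma>"
      and ext: "\<And>J \<delta>. trajectory D (X, Y) U J \<delta> \<Longrightarrow> I \<subseteq> J \<Longrightarrow> \<forall>t\<in>I. \<delta> t = \<gamma> t \<Longrightarrow> J = I"
      using max by (auto simp: maximal_trajectory_def)
    then obtain t0 where "t0 \<in> I" by (auto simp: trajectory_def)
    then have "\<gamma> t0 \<in> U" using traj by (auto simp: trajectory_def)
    then show ?thesis
    proof (cases rule: U_cases)
      case 1
      have "is_interval I" "I \<noteq> {}" using traj by (auto simp: trajectory_def)
      then have "\<gamma> t = 0" if "t \<in> I" for t
        using trajectories_agree[OF traj zero_trajectory[OF \<open>0 \<in> D\<close> zero_in_U] assms(1), of I t0 t] 1 \<open>t0 \<in> I\<close> that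
        by auto
      moreover from this have "UNIV = I"
        by (intro ext[OF zero_trajectory[OF \<open>0 \<in> D\<close> zero_in_U]]) auto
      ultimately show ?thesis by auto
    next
      case (2 w)
      define \<theta> where "\<theta> = Im w - \<alpha> * Re w"
      have "\<alpha> * (Im w - \<theta>) < 0" using 2(1) \<alpha> by (auto simp: \<theta>_def)
      then obtain J \<eta> f where *: "trajectory D (X, Y) U J \<eta>" "t0 \<in> J" "f t0 = Im w"
          "\<And>t. \<eta> t = P (f t) (\<Psi> \<theta> (f t))" "strict_mono f" "J = {t. \<alpha> * (f t - \<theta>) < 0}"
          "(\<lambda>t. f t - \<theta>) ` J = {u. \<alpha> * u < 0}"
          "\<And>J' \<delta>. trajectory D (X, Y) U J' \<delta> \<Longrightarrow> t0 \<in> J' \<Longrightarrow> \<delta> t0 = \<eta> t0 \<Longrightarrow> J' \<subseteq> J \<and> (\<forall>t\<in>J'. \<delta> t = \<eta> t)"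
        by (rule spiral_trajectory[OF \<open>U \<subseteq> D\<close> assms(1), where ?t0.0 = t0]) (rule that)
      have "\<gamma> t0 = \<eta> t0" using 2(2) by (simp add: *(3,4) Q_def \<theta>_def)
      from *(8)[OF traj \<open>t0 \<in> I\<close> this] have sub: "I \<subseteq> J" "\<forall>t\<in>I. \<eta> t = \<gamma> t" by auto
      then have "J = I" by (rule ext[OF *(1)])
      with sub *(7) have "spiral_orbit G \<alpha> \<theta> I (\<lambda>t. f t - \<theta>) \<gamma>"
        using *(5) by (auto simp: spiral_orbit_def spiral_G[symmetric] *(4)[symmetric] strict_mono_on_def strict_mono_def)
      then show ?thesis by blast
    qed
  qed
  show ?thesis
    unfolding spiral_chart_def
    using open_U \<open>U \<subseteq> D\<close> homeomorphism_G G_zero G_line all zero_max exists by blast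
qed

text \<open>Both orbits trace the spiral with the same label, so the relative angle is their common
  clock: the change of time is the inverse of \<open>h2\<close> after \<open>h1\<close>.\<close>

lemma maps_orbits_spiral_charts:
  assumes Z1: "spiral_chart D Z1 \<alpha> U1 G1" and Z2: "spiral_chart D Z2 \<alpha> U2 G2"
    and H1: "homeomorphism (ball 0 1) U1 G1 H1"
  shows "maps_orbits D Z1 U1 Z2 U2 (G2 \<circ> H1)"
  unfolding maps_orbits_def
proof (intro allI impI)
  fix I \<gamma> assume max: "maximal_trajectory D Z1 U1 I \<gamma>"
  have G0: "G1 0 = 0" "G2 0 = 0" using Z1 Z2 by (simp_all add: spiral_chart_def)
  have H1G1: "H1 (G1 z) = z" if "z \<in> ball 0 1" for z
    using homeomorphism_apply1[OF H1 that] .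
  from Z1 max have "I = UNIV \<and> (\<forall>t. \<gamma> t = 0) \<or> (\<exists>\<theta> h. spiral_orbit G1 \<alpha> \<theta> I h \<gamma>)"
    unfolding spiral_chart_def by blast
  then show "\<exists>J \<delta> h. maximal_trajectory D Z2 U2 J \<delta> \<and> strict_mono_on I h \<and> h ` I = J \<and>
      (\<forall>t\<in>I. (G2 \<circ> H1) (\<gamma> t) = \<delta> (h t))"
  proof (elim disjE conjE exE)
    assume "I = UNIV" "\<forall>t. \<gamma> t = 0"
    moreover have "maximal_trajectory D Z2 U2 UNIV (\<lambda>_. 0)" using Z2 by (simp add: spiral_chart_def)
    moreover have "H1 0 = 0" using H1G1[of 0] by (simp add: G0)
    ultimately show ?thesis
      by (intro exI[of _ UNIV] exI[of _ "\<lambda>_. 0"] exI[of _ id]) (simp add: G0 strict_mono_on_def)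
  next
    fix \<theta> h1 assume 1: "spiral_orbit G1 \<alpha> \<theta> I h1 \<gamma>"
    from Z2 obtain J \<delta> h2 where J: "maximal_trajectory D Z2 U2 J \<delta>" and 2: "spiral_orbit G2 \<alpha> \<theta> J h2 \<delta>"
      unfolding spiral_chart_def by blast
    define h where "h t = the_inv_into J h2 (h1 t)" for t
    have inj: "inj_on h2 J" using 2 by (simp add: spiral_orbit_def strict_mono_on_imp_inj_on)
    have img: "h1 ` I = h2 ` J" using 1 2 by (simp add: spiral_orbit_def)
    have h: "h t \<in> J" "h2 (h t) = h1 t" if "t \<in> I" for t
    proof -
      have "h1 t \<in> h2 ` J" using that img by blast
      then show "h t \<in> J" "h2 (h t) = h1 t"
        unfolding h_def by (auto intro: the_inv_into_into[OF inj] f_the_inv_into_f[OF inj])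
    qed
    have mono: "strict_mono_on I h"
    proof (rule strict_mono_onI)
      fix s t assume st: "s \<in> I" "t \<in> I" "s < t"
      have "strict_mono_on I h1" using 1 by (simp add: spiral_orbit_def)
      then have "h2 (h s) < h2 (h t)" using st by (simp add: h strict_mono_on_def)
      then show "h s < h t"
        using 2 h[OF st(1)] h[OF st(2)] unfolding spiral_orbit_def
        by (metis linorder_neqE_linordered_idom order_less_asym order_less_irrefl strict_mono_onD)
    qed
    have "h ` I = J"
    proof
      show "J \<subseteq> h ` I"
      proof
        fix s assume "s \<in> J"
        then obtain t where t: "t \<in> I" "h1 t = h2 s" using img by (metis imageE imageI)
        then have "h t = s" using \<open>s \<in> J\<close> by (simp add: h_def the_inv_into_f_f[OF inj])
        with t show "s \<in> h ` I" by blast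
      qed
    qed (use h in auto)
    moreover have "(G2 \<circ> H1) (\<gamma> t) = \<delta> (h t)" if t: "t \<in> I" for t
    proof -
      have "\<alpha> * h1 t < 0" using 1 t by (auto simp: spiral_orbit_def)
      then have "H1 (\<gamma> t) = spiral \<alpha> \<theta> (h1 t)"
        using 1 t H1G1[OF spiral_in_ball] by (simp add: spiral_orbit_def)
      moreover have "\<delta> (h t) = G2 (spiral \<alpha> \<theta> (h1 t))"
        using 2 h[OF t] by (simp add: spiral_orbit_def)
      ultimately show ?thesis by simp
    qed
    ultimately show ?thesis using J mono by blast
  qed
qed

theorem locally_Sigma_equivalent_spiral_charts:
  assumes Z1: "spiral_chart D Z1 \<alpha> U1 G1" and Z2: "spiral_chart D Z2 \<alpha> U2 G2"
  shows "locally_Sigma_equivalent D Z1 Z2"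
proof -
  obtain H1 where H1: "homeomorphism (ball 0 1) U1 G1 H1" using Z1 by (auto simp: spiral_chart_def)
  obtain H2 where H2: "homeomorphism (ball 0 1) U2 G2 H2" using Z2 by (auto simp: spiral_chart_def)
  have hom: "homeomorphism U1 U2 (G2 \<circ> H1) (G1 \<circ> H2)"
    by (rule homeomorphism_compose[OF homeomorphism_symD[OF H1] H2])
  have line: "G1 z $ 2 = 0 \<longleftrightarrow> Im z = 0" "G2 z $ 2 = 0 \<longleftrightarrow> Im z = 0"
    and sub: "U1 \<subseteq> D" "U2 \<subseteq> D" "open U1" "open U2" and G0: "G1 0 = 0" "G2 0 = 0" for z
    using Z1 Z2 by (simp_all add: spiral_chart_def)
  have img: "G1 ` ball 0 1 = U1" "G2 ` ball 0 1 = U2" and HG: "\<And>z. z \<in> ball 0 1 \<Longrightarrow> H1 (G1 z) = z"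
    using H1 H2 by (simp_all add: homeomorphism_def)
  have sw: "switching_line D \<inter> U1 = G1 ` {z \<in> ball 0 1. Im z = 0}"
    "switching_line D \<inter> U2 = G2 ` {z \<in> ball 0 1. Im z = 0}"
    unfolding switching_line_def using sub img line by blast+
  have "(G2 \<circ> H1) ` (switching_line D \<inter> U1) = switching_line D \<inter> U2"
    unfolding sw image_image comp_def by (rule image_cong) (auto simp: HG)
  moreover have "0 \<in> U1" "0 \<in> U2" using img G0 by (metis centre_in_ball image_eqI zero_less_one)+
  ultimately show ?thesis
    unfolding locally_Sigma_equivalent_def
    using sub hom maps_orbits_spiral_charts[OF Z1 Z2 H1] maps_orbits_spiral_charts[OF Z2 Z1 H2] by blast
qed

section \<open>Polar form of a focus\<close>

text \<open>The difference of \<open>X\<close> and its linear part has derivative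
  \<open>J p - J 0\<close>, small near the origin by continuity of the Jacobian; the mean value
  inequality on a ball does the rest.\<close>

lemma C1_field_remainder:
  fixes X :: field2
  assumes "open D" "0 \<in> D" "X \<in> C1_fields D" "\<eta> > 0"
  obtains \<rho> where "\<rho> > 0" "ball 0 \<rho> \<subseteq> D"
    "\<And>p q. p \<in> ball 0 \<rho> \<Longrightarrow> q \<in> ball 0 \<rho> \<Longrightarrow>
      norm ((X p - jacobian X (at 0) *v p) - (X q - jacobian X (at 0) *v q)) \<le> \<eta> * norm (p - q)"
proof -
  define J where "J p = jacobian X (at p)" for p
  have der: "(X has_derivative (\<lambda>h. J p *v h)) (at p)" if "p \<in> D" for p
    using assms(3) that by (simp add: C1_fields_def jacobian_works J_def)
  have "isCont J 0"
    using assms(1-3) by (simp add: C1_fields_def J_def[abs_def] continuous_on_eq_continuous_at)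
  then obtain d where d: "d > 0" "\<And>p. dist p 0 < d \<Longrightarrow> dist (J p) (J 0) < \<eta> / 4"
    using \<open>\<eta> > 0\<close> unfolding continuous_at_eps_delta by (metis divide_pos_pos zero_less_numeral)
  obtain e where e: "e > 0" "ball 0 e \<subseteq> D" using assms(1,2) open_contains_ball by blast
  define \<rho> where "\<rho> = min d e"
  have sub: "ball 0 \<rho> \<subseteq> D" using e(2) by (auto simp: \<rho>_def)
  have "norm ((X p - J 0 *v p) - (X q - J 0 *v q)) \<le> \<eta> * norm (p - q)"
    if "p \<in> ball 0 \<rho>" "q \<in> ball 0 \<rho>" for p q
  proof (rule differentiable_bound[OF convex_ball _ _ that, where f' = "\<lambda>p h. (J p - J 0) *v h"])
    fix p :: "real^2" assume p: "p \<in> ball 0 \<rho>"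
    show "((\<lambda>p. X p - J 0 *v p) has_derivative (\<lambda>h. (J p - J 0) *v h)) (at p within ball 0 \<rho>)"
      using sub p has_derivative_at_withinI[OF der]
      by (auto intro!: derivative_eq_intros bounded_linear_imp_has_derivative simp: matrix_vector_mult_diff_rdistrib)
    have "\<bar>(J p - J 0) $ i $ j\<bar> \<le> \<eta> / 4" for i j
    proof -
      have "\<bar>(J p - J 0) $ i $ j\<bar> \<le> norm ((J p - J 0) $ i)" by (rule component_le_norm_cart)
      also have "\<dots> \<le> norm (J p - J 0)" by (rule Finite_Cartesian_Product.norm_nth_le)
      also have "\<dots> \<le> \<eta> / 4" using d(2)[of p] p by (simp add: \<rho>_def dist_norm)
      finally show ?thesis .
    qed
    from onorm_le_matrix_component[OF this] show "onorm (\<lambda>h. (J p - J 0) *v h) \<le> \<eta>" by simp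
  qed
  then show ?thesis using that[of \<rho>] sub d(1) e(1) by (auto simp: \<rho>_def J_def)
qed

lemma C1_field_lipschitz:
  fixes X :: field2
  assumes "open D" "0 \<in> D" "X \<in> C1_fields D"
  obtains \<rho> K where "\<rho> > 0" "ball 0 \<rho> \<subseteq> D"
    "\<And>p q. p \<in> ball 0 \<rho> \<Longrightarrow> q \<in> ball 0 \<rho> \<Longrightarrow> norm (X p - X q) \<le> K * norm (p - q)"
proof -
  let ?A = "jacobian X (at 0)"
  obtain \<rho> where \<rho>: "\<rho> > 0" "ball 0 \<rho> \<subseteq> D"
    "\<And>p q. p \<in> ball 0 \<rho> \<Longrightarrow> q \<in> ball 0 \<rho> \<Longrightarrow> norm ((X p - ?A *v p) - (X q - ?A *v q)) \<le> 1 * norm (p - q)"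
    using C1_field_remainder[OF assms zero_less_one] by blast
  have "norm (X p - X q) \<le> (1 + onorm ((*v) ?A)) * norm (p - q)" if "p \<in> ball 0 \<rho>" "q \<in> ball 0 \<rho>" for p q
  proof -
    have "X p - X q = ((X p - ?A *v p) - (X q - ?A *v q)) + ?A *v (p - q)"
      by (simp add: matrix_vector_mult_diff_distrib)
    then have "norm (X p - X q) \<le> norm ((X p - ?A *v p) - (X q - ?A *v q)) + norm (?A *v (p - q))"
      using norm_triangle_ineq by metis
    also have "\<dots> \<le> 1 * norm (p - q) + onorm ((*v) ?A) * norm (p - q)"
      by (intro add_mono \<rho>(3) that onorm matrix_vector_mul_bounded_linear)
    finally show ?thesis by (simp add: distrib_right)
  qed
  with \<rho> that show ?thesis by blast
qed

text \<open>The common denominator is at least \<open>\<omega>^2 / 4\<close>, and the two other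
  factors bound \<open>\<omega> + \<tau>'\<close> and \<open>a + \<nu>'\<close>. The lemma serves
  twice: with \<open>\<nu>' = \<tau>' = 0\<close> for the distance to the limit
  \<open>a / \<omega>\<close>, and for the Lipschitz estimate.\<close>

lemma quotient_perturbation:
  fixes a \<omega> \<nu> \<tau> \<nu>' \<tau>' e :: real
  assumes "\<omega> > 0" "e \<le> \<omega> / 2" "\<bar>\<nu>\<bar> \<le> e" "\<bar>\<tau>\<bar> \<le> e" "\<bar>\<nu>'\<bar> \<le> e" "\<bar>\<tau>'\<bar> \<le> e"
  shows "\<bar>(a + \<nu>) / (\<omega> + \<tau>) - (a + \<nu>') / (\<omega> + \<tau>')\<bar> \<le>
    4 / \<omega>\<^sup>2 * ((3 * \<omega> / 2) * \<bar>\<nu> - \<nu>'\<bar> + (\<bar>a\<bar> + \<omega> / 2) * \<bar>\<tau> - \<tau>'\<bar>)"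
proof -
  have den: "\<omega> / 2 \<le> \<omega> + \<tau>" "\<omega> / 2 \<le> \<omega> + \<tau>'" "\<omega> + \<tau>' \<le> 3 * \<omega> / 2" using assms by linarith+
  then have pos: "\<omega> + \<tau> > 0" "\<omega> + \<tau>' > 0" using assms(1) by linarith+
  have "(\<omega> / 2) * (\<omega> / 2) \<le> (\<omega> + \<tau>) * (\<omega> + \<tau>')" using den assms(1) by (intro mult_mono) auto
  then have prod: "\<omega>\<^sup>2 / 4 \<le> (\<omega> + \<tau>) * (\<omega> + \<tau>')" by (simp add: power2_eq_square)
  have "(a + \<nu>) / (\<omega> + \<tau>) - (a + \<nu>') / (\<omega> + \<tau>') =
      ((\<nu> - \<nu>') * (\<omega> + \<tau>') - (a + \<nu>') * (\<tau> - \<tau>')) / ((\<omega> + \<tau>) * (\<omega> + \<tau>'))"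
    using pos by (simp add: field_simps)
  also have "\<bar>\<dots>\<bar> = \<bar>(\<nu> - \<nu>') * (\<omega> + \<tau>') - (a + \<nu>') * (\<tau> - \<tau>')\<bar> / ((\<omega> + \<tau>) * (\<omega> + \<tau>'))"
    using pos by (simp add: abs_mult)
  also have "\<dots> \<le> \<bar>(\<nu> - \<nu>') * (\<omega> + \<tau>') - (a + \<nu>') * (\<tau> - \<tau>')\<bar> / (\<omega>\<^sup>2 / 4)"
    using prod assms(1) pos by (intro divide_left_mono mult_pos_pos) auto
  also have "\<dots> \<le> ((3 * \<omega> / 2) * \<bar>\<nu> - \<nu>'\<bar> + (\<bar>a\<bar> + \<omega> / 2) * \<bar>\<tau> - \<tau>'\<bar>) / (\<omega>\<^sup>2 / 4)"
  proof (rule divide_right_mono)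
    have "\<bar>(\<nu> - \<nu>') * (\<omega> + \<tau>')\<bar> \<le> \<bar>\<nu> - \<nu>'\<bar> * (3 * \<omega> / 2)"
      unfolding abs_mult using den pos by (intro mult_left_mono) auto
    moreover have "\<bar>(a + \<nu>') * (\<tau> - \<tau>')\<bar> \<le> (\<bar>a\<bar> + \<omega> / 2) * \<bar>\<tau> - \<tau>'\<bar>"
      unfolding abs_mult using assms by (intro mult_right_mono) auto
    ultimately show "\<bar>(\<nu> - \<nu>') * (\<omega> + \<tau>') - (a + \<nu>') * (\<tau> - \<tau>')\<bar> \<le>
        (3 * \<omega> / 2) * \<bar>\<nu> - \<nu>'\<bar> + (\<bar>a\<bar> + \<omega> / 2) * \<bar>\<tau> - \<tau>'\<bar>"
      by (simp add: mult.commute)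
  qed simp
  finally show ?thesis by (simp add: field_simps)
qed

definition ray :: "real^2 \<Rightarrow> real^2 \<Rightarrow> real \<Rightarrow> real^2" where
  "ray u v p = cos p *\<^sub>R u + sin p *\<^sub>R v"

text \<open>The derivative of \<open>ray\<close> with respect to the angle.\<close>

definition ray_normal :: "real^2 \<Rightarrow> real^2 \<Rightarrow> real \<Rightarrow> real^2" where
  "ray_normal u v p = - sin p *\<^sub>R u + cos p *\<^sub>R v"

lemma ray_basis:
  "x *\<^sub>R u + y *\<^sub>R v =
    (cos p * x + sin p * y) *\<^sub>R ray u v p + (cos p * y - sin p * x) *\<^sub>R ray_normal u v p"
proof -
  have x: "x = (cos p * x + sin p * y) * cos p - (cos p * y - sin p * x) * sin p"
    and y: "y = (cos p * x + sin p * y) * sin p + (cos p * y - sin p * x) * cos p"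
    using sin_cos_squared_add3[of p] by algebra+
  show ?thesis
    by (subst (1) x, subst (1) y)
      (simp only: ray_def ray_normal_def scaleR_add_right scaleR_scaleR scaleR_add_left scaleR_diff_left
        scaleR_minus_left scaleR_minus_right mult_minus_right; simp add: algebra_simps)
qed

lemma norm_ray_le: "norm (ray u v p) \<le> norm u + norm v"
  unfolding ray_def
  by (rule norm_triangle_le) (auto intro!: add_mono mult_left_le_one_le simp: abs_sin_le_one abs_cos_le_one)

lemma bounded_field_coordinates:
  fixes v1 v2 :: "real^2"
  assumes "v1 $ 2 = 0" "v1 $ 1 \<noteq> 0" "v2 $ 2 \<noteq> 0"
  obtains q1 q2 M where "bounded_linear q1" "bounded_linear q2" "M > (0::real)"
    "\<And>w. \<bar>q1 w\<bar> \<le> M * norm w" "\<And>w. \<bar>q2 w\<bar> \<le> M * norm w"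
    "\<And>w. w = q1 w *\<^sub>R v1 + q2 w *\<^sub>R v2"
proof -
  define q2 where "q2 w = w $ 2 / v2 $ 2" for w :: "real^2"
  define q1 where "q1 w = (w $ 1 - q2 w * v2 $ 1) / v1 $ 1" for w :: "real^2"
  have lin: "linear q1" "linear q2"
    using assms by (auto intro!: linearI simp: q1_def q2_def field_simps)
  then have bl: "bounded_linear q1" "bounded_linear q2" by (simp_all add: linear_conv_bounded_linear)
  obtain M1 where M1: "\<And>w. norm (q1 w) \<le> norm w * M1" "M1 > 0"
    using bounded_linear.pos_bounded[OF bl(1)] by blast
  obtain M2 where M2: "\<And>w. norm (q2 w) \<le> norm w * M2" "M2 > 0"
    using bounded_linear.pos_bounded[OF bl(2)] by blast
  have "\<bar>q1 w\<bar> \<le> (M1 + M2) * norm w" "\<bar>q2 w\<bar> \<le> (M1 + M2) * norm w" for w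
    using M1(1)[of w] M2(1)[of w] mult_nonneg_nonneg[OF norm_ge_zero less_imp_le[OF M1(2)], of w]
      mult_nonneg_nonneg[OF norm_ge_zero less_imp_le[OF M2(2)], of w] by (auto simp: algebra_simps)
  moreover have "w = q1 w *\<^sub>R v1 + q2 w *\<^sub>R v2" for w
    using assms by (simp add: vec_eq_iff forall_2 q1_def q2_def)
  ultimately show ?thesis using that[OF bl, of "M1 + M2"] M1(2) M2(2) by simp
qed

lemma ln_ratio_le:
  assumes "0 < s" "s \<le> r"
  shows "(r - s) / r \<le> ln r - ln (s::real)"
proof -
  have "ln (s / r) \<le> s / r - 1" using assms by (intro ln_le_minus_one) auto
  then show ?thesis using assms by (simp add: ln_div diff_divide_distrib)
qed

text \<open>For \<open>s \<le> r\<close> the difference splits into an increment of \<open>N\<close>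
  and an increment of the factor \<open>1 / r\<close>; each is at most
  \<open>\<eta> M (r - s) / r\<close>, and \<open>(r - s) / r \<le> ln r - ln s\<close>. In terms of
  \<open>r\<close> itself the constant would be of order \<open>1 / r\<close>.\<close>

lemma remainder_lipschitz_in_ln:
  fixes N :: "'a::real_normed_vector \<Rightarrow> 'b::real_normed_vector"
  assumes N: "\<And>p q. norm p < \<rho> \<Longrightarrow> norm q < \<rho> \<Longrightarrow> norm (N p - N q) \<le> \<eta> * norm (p - q)"
    and "N 0 = 0" "\<eta> \<ge> 0" "norm e \<le> M" "0 < r" "r * M < \<rho>" "0 < s" "s * M < \<rho>"
  shows "norm (N (r *\<^sub>R e) /\<^sub>R r) \<le> \<eta> * M"
    and "norm (N (r *\<^sub>R e) /\<^sub>R r - N (s *\<^sub>R e) /\<^sub>R s) \<le> 2 * \<eta> * M * \<bar>ln r - ln s\<bar>"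
proof -
  have small: "norm (u *\<^sub>R e) < \<rho>" if "0 < u" "u * M < \<rho>" for u
    using le_less_trans[OF mult_left_mono[OF assms(4), of u] that(2)] that(1) by simp
  have bound: "norm (N (u *\<^sub>R e)) \<le> \<eta> * (u * M)" if "0 < u" "u * M < \<rho>" for u
  proof -
    have "0 \<le> norm (u *\<^sub>R e)" by (rule norm_ge_zero)
    then have "norm (0::'a) < \<rho>" using small[OF that] by (metis le_less_trans norm_zero)
    then have "norm (N (u *\<^sub>R e)) \<le> \<eta> * norm (u *\<^sub>R e)"
      using N[OF small[OF that], of 0] \<open>N 0 = 0\<close> by simp
    also have "\<dots> \<le> \<eta> * (u * M)" using assms(3,4) that by (intro mult_left_mono) auto
    finally show ?thesis .
  qed
  show "norm (N (r *\<^sub>R e) /\<^sub>R r) \<le> \<eta> * M"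
    using bound[OF assms(5,6)] assms(5) by (simp add: field_simps)
  have main: "norm (N (r *\<^sub>R e) /\<^sub>R r - N (s *\<^sub>R e) /\<^sub>R s) \<le> 2 * \<eta> * M * (ln r - ln s)"
    if r: "0 < r" "r * M < \<rho>" and s: "0 < s" "s * M < \<rho>" and "s \<le> r" for r s
  proof -
    have "M \<ge> 0" using assms(4) norm_ge_zero order_trans by blast
    have inv: "inverse r \<le> inverse s" using s(1) \<open>s \<le> r\<close> by (rule le_imp_inverse_le[rotated])
    have "N (r *\<^sub>R e) /\<^sub>R r - N (s *\<^sub>R e) /\<^sub>R s =
        inverse r *\<^sub>R (N (r *\<^sub>R e) - N (s *\<^sub>R e)) + (inverse r - inverse s) *\<^sub>R N (s *\<^sub>R e)"
      by (simp add: algebra_simps)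
    also have "norm \<dots> \<le> inverse r * norm (N (r *\<^sub>R e) - N (s *\<^sub>R e)) + (inverse s - inverse r) * norm (N (s *\<^sub>R e))"
      using r(1) inv by (intro norm_triangle_le add_mono) auto
    also have "\<dots> \<le> inverse r * (\<eta> * ((r - s) * M)) + (inverse s - inverse r) * (\<eta> * (s * M))"
    proof (intro add_mono mult_left_mono bound s)
      have "norm (N (r *\<^sub>R e) - N (s *\<^sub>R e)) \<le> \<eta> * norm (r *\<^sub>R e - s *\<^sub>R e)"
        by (rule N[OF small[OF r] small[OF s]])
      also have "\<dots> \<le> \<eta> * ((r - s) * M)"
        using assms(3,4) \<open>s \<le> r\<close> by (intro mult_left_mono) (auto simp: scaleR_diff_left[symmetric] intro!: mult_left_mono)
      finally show "norm (N (r *\<^sub>R e) - N (s *\<^sub>R e)) \<le> \<eta> * ((r - s) * M)" .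
    qed (use r inv in auto)
    also have "\<dots> = 2 * \<eta> * M * ((r - s) / r)" using r(1) s(1) by (simp add: field_simps)
    also have "\<dots> \<le> 2 * \<eta> * M * (ln r - ln s)"
      using \<open>M \<ge> 0\<close> \<open>\<eta> \<ge> 0\<close> by (intro mult_left_mono ln_ratio_le s \<open>s \<le> r\<close>) auto
    finally show ?thesis .
  qed
  show "norm (N (r *\<^sub>R e) /\<^sub>R r - N (s *\<^sub>R e) /\<^sub>R s) \<le> 2 * \<eta> * M * \<bar>ln r - ln s\<bar>"
  proof (cases "s \<le> r")
    case True
    then have "ln s \<le> ln r" using assms by simp
    with main[OF assms(5-8) True] show ?thesis by simp
  next
    case False
    then have "ln r \<le> ln s" using assms by simp
    with main[OF assms(7,8,5,6)] False show ?thesis by (simp add: norm_minus_commute)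
  qed
qed

text \<open>In the basis \<open>v1\<close>, \<open>v2\<close> the linear part is \<open>a\<close>
  plus \<open>\<omega>\<close> times a quarter turn, so its components along \<open>ray\<close> and
  \<open>ray_normal\<close> do not depend on the angle. The remainder divided by \<open>r\<close>
  perturbs them to \<open>a + \<nu>\<close> and \<open>\<omega> + \<tau>\<close>. \<open>W\<close>
  is the angular speed and \<open>f\<close> the rate of \<open>ln r\<close> per unit of
  angle.\<close>

lemma focus_polar_form:
  fixes X :: field2 and v1 v2 :: "real^2"
  defines "A \<equiv> jacobian X (at 0)"
  assumes D: "open D" "0 \<in> D" and XC: "X \<in> C1_fields D" and X0: "X 0 = 0"
    and v: "v1 $ 2 = 0" "v1 $ 1 \<noteq> 0" "v2 $ 2 \<noteq> 0"
    and A: "A *v v1 = a *\<^sub>R v1 + \<omega> *\<^sub>R v2" "A *v v2 = a *\<^sub>R v2 - \<omega> *\<^sub>R v1"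
    and "\<omega> > 0" "d > 0"
  obtains r0 L f W where "r0 > 0" "L > 0"
    "\<And>p r. 0 < r \<Longrightarrow> r < r0 \<Longrightarrow>
      X (r *\<^sub>R ray v1 v2 p) = (r * W (p, r)) *\<^sub>R (f (p, r) *\<^sub>R ray v1 v2 p + ray_normal v1 v2 p)"
    "\<And>p r. 0 < r \<Longrightarrow> r < r0 \<Longrightarrow> \<bar>f (p, r) - a / \<omega>\<bar> \<le> d"
    "\<And>p r. 0 < r \<Longrightarrow> r < r0 \<Longrightarrow> \<omega> / 2 \<le> W (p, r) \<and> W (p, r) \<le> 2 * \<omega>"
    "\<And>p r s. 0 < r \<Longrightarrow> r < r0 \<Longrightarrow> 0 < s \<Longrightarrow> s < r0 \<Longrightarrow> \<bar>f (p, r) - f (p, s)\<bar> \<le> L * \<bar>ln r - ln s\<bar>"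
    "continuous_on (UNIV \<times> {0<..<r0}) f" "continuous_on (UNIV \<times> {0<..<r0}) W"
    "\<And>p q r. cos p = cos q \<Longrightarrow> sin p = sin q \<Longrightarrow> f (p, r) = f (q, r)"
proof -
  obtain q1 q2 :: "real^2 \<Rightarrow> real" and M where q: "bounded_linear q1" "bounded_linear q2" "M > (0::real)"
    "\<And>w. \<bar>q1 w\<bar> \<le> M * norm w" "\<And>w. \<bar>q2 w\<bar> \<le> M * norm w"
    "\<And>w. w = q1 w *\<^sub>R v1 + q2 w *\<^sub>R v2"
    by (rule bounded_field_coordinates[OF v]) (rule that)
  \<comment> \<open>Two requirements: the angular speed stays above \<open>\<omega> / 2\<close>, and
    the bound from \<open>quotient_perturbation\<close> does not exceed \<open>d\<close>.\<close>
  define e where "e = min (\<omega> / 2) (d * \<omega>\<^sup>2 / (4 * (3 * \<omega> / 2 + (\<bar>a\<bar> + \<omega> / 2))))"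
  define m where "m = norm v1 + norm v2"
  have m: "m > 0" using v(2) unfolding m_def by (metis add_pos_nonneg norm_ge_zero zero_index zero_less_norm_iff)
  have e: "e > 0"
    using \<open>\<omega> > 0\<close> \<open>d > 0\<close> unfolding e_def by (auto intro!: divide_pos_pos mult_pos_pos add_pos_nonneg)
  have e2: "e \<le> \<omega> / 2" unfolding e_def by (rule min.cobounded1)
  have ed: "4 / \<omega>\<^sup>2 * ((3 * \<omega> / 2) * e + (\<bar>a\<bar> + \<omega> / 2) * e) \<le> d"
  proof -
    have s: "3 * \<omega> / 2 + (\<bar>a\<bar> + \<omega> / 2) > 0" using \<open>\<omega> > 0\<close> by (simp add: add_pos_nonneg)
    have "e \<le> d * \<omega>\<^sup>2 / (4 * (3 * \<omega> / 2 + (\<bar>a\<bar> + \<omega> / 2)))" by (simp add: e_def)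
    then have "e * (4 * (3 * \<omega> / 2 + (\<bar>a\<bar> + \<omega> / 2))) \<le> d * \<omega>\<^sup>2"
      using s by (subst (asm) pos_le_divide_eq) auto
    then have "4 * ((3 * \<omega> / 2) * e + (\<bar>a\<bar> + \<omega> / 2) * e) \<le> d * \<omega>\<^sup>2" by (simp add: algebra_simps)
    then show ?thesis using \<open>\<omega> > 0\<close> by (simp add: pos_divide_le_eq)
  qed
  \<comment> \<open>Each of \<open>\<nu>\<close> and \<open>\<tau>\<close> is at most
    \<open>2 * M * norm (n z)\<close>, and \<open>norm (n z) \<le> \<eta> * m\<close>; this choice
    turns the product into \<open>e\<close>.\<close>
  define \<eta> where "\<eta> = e / (2 * M * m)"
  have \<eta>: "\<eta> > 0" "2 * M * (\<eta> * m) = e" using e q(3) m by (simp_all add: \<eta>_def)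
  obtain \<rho> where \<rho>: "\<rho> > 0" "ball 0 \<rho> \<subseteq> D" and N_le:
    "\<And>p q. p \<in> ball 0 \<rho> \<Longrightarrow> q \<in> ball 0 \<rho> \<Longrightarrow> norm ((X p - A *v p) - (X q - A *v q)) \<le> \<eta> * norm (p - q)"
    unfolding A_def using C1_field_remainder[OF D XC \<eta>(1)] by blast
  define N where "N p = X p - A *v p" for p
  have N: "norm (N p - N q) \<le> \<eta> * norm (p - q)" if "norm p < \<rho>" "norm q < \<rho>" for p q
    unfolding N_def using N_le that by simp
  have N0: "N 0 = 0" by (simp add: N_def X0)
  define r0 where "r0 = \<rho> / m"
  have r0: "r0 > 0" "r * m < \<rho>" if "r < r0" for r using that \<rho>(1) m by (auto simp: r0_def field_simps)
  have "r0 > 0" using \<rho>(1) m by (simp add: r0_def)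
  note ray_le = norm_ray_le[of v1 v2, folded m_def]
  define n where "n z = N (snd z *\<^sub>R ray v1 v2 (fst z)) /\<^sub>R snd z" for z :: "real \<times> real"
  have n_le: "norm (n (p, r)) \<le> \<eta> * m" if "0 < r" "r < r0" for p r
    using remainder_lipschitz_in_ln(1)[OF N N0 less_imp_le[OF \<eta>(1)] ray_le that(1) r0(2)[OF that(2)] that(1) r0(2)[OF that(2)]]
    by (simp add: n_def)
  have n_lip: "norm (n (p, r) - n (p, s)) \<le> 2 * \<eta> * m * \<bar>ln r - ln s\<bar>"
    if "0 < r" "r < r0" "0 < s" "s < r0" for p r s
    using remainder_lipschitz_in_ln(2)[OF N N0 less_imp_le[OF \<eta>(1)] ray_le that(1) r0(2)[OF that(2)] that(3) r0(2)[OF that(4)]]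
    by (simp add: n_def)
  define \<nu> where "\<nu> z = cos (fst z) * q1 (n z) + sin (fst z) * q2 (n z)" for z
  define \<tau> where "\<tau> z = cos (fst z) * q2 (n z) - sin (fst z) * q1 (n z)" for z
  have trig: "\<bar>cos p * x + sin p * y\<bar> \<le> \<bar>x\<bar> + \<bar>y\<bar>" "\<bar>cos p * y - sin p * x\<bar> \<le> \<bar>x\<bar> + \<bar>y\<bar>" for p x y :: real
  proof -
    have "\<bar>cos p\<bar> * \<bar>u\<bar> \<le> \<bar>u\<bar>" "\<bar>sin p\<bar> * \<bar>u\<bar> \<le> \<bar>u\<bar>" for u
      by (simp_all add: mult_left_le_one_le abs_cos_le_one abs_sin_le_one)
    from this[of x] this[of y] show "\<bar>cos p * x + sin p * y\<bar> \<le> \<bar>x\<bar> + \<bar>y\<bar>" "\<bar>cos p * y - sin p * x\<bar> \<le> \<bar>x\<bar> + \<bar>y\<bar>"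
      unfolding abs_mult[symmetric] by linarith+
  qed
  have q12: "\<bar>q1 w\<bar> + \<bar>q2 w\<bar> \<le> 2 * M * norm w" for w using q(4,5)[of w] by simp
  have \<nu>\<tau>: "\<bar>\<nu> (p, r)\<bar> \<le> e" "\<bar>\<tau> (p, r)\<bar> \<le> e" if "0 < r" "r < r0" for p r
  proof -
    have "2 * M * norm (n (p, r)) \<le> 2 * M * (\<eta> * m)" using n_le[OF that] q(3) by simp
    then have "\<bar>q1 (n (p, r))\<bar> + \<bar>q2 (n (p, r))\<bar> \<le> e" using q12[of "n (p, r)"] \<eta>(2) by linarith
    then show "\<bar>\<nu> (p, r)\<bar> \<le> e" "\<bar>\<tau> (p, r)\<bar> \<le> e"
      unfolding \<nu>_def \<tau>_def fst_conv using trig order_trans by blast+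
  qed
  have \<nu>\<tau>_lip: "\<bar>\<nu> (p, r) - \<nu> (p, s)\<bar> \<le> 2 * e * \<bar>ln r - ln s\<bar>" "\<bar>\<tau> (p, r) - \<tau> (p, s)\<bar> \<le> 2 * e * \<bar>ln r - ln s\<bar>"
    if "0 < r" "r < r0" "0 < s" "s < r0" for p r s
  proof -
    let ?w = "n (p, r) - n (p, s)"
    have diff: "q1 ?w = q1 (n (p, r)) - q1 (n (p, s))" "q2 ?w = q2 (n (p, r)) - q2 (n (p, s))"
      using q(1,2) by (simp_all add: bounded_linear.linear linear_diff)
    have "2 * M * norm ?w \<le> 2 * M * (2 * \<eta> * m * \<bar>ln r - ln s\<bar>)" using q(3) by (intro mult_left_mono n_lip that) simp
    also have "\<dots> = 2 * (2 * M * (\<eta> * m)) * \<bar>ln r - ln s\<bar>" by simp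
    finally have le: "\<bar>q1 ?w\<bar> + \<bar>q2 ?w\<bar> \<le> 2 * e * \<bar>ln r - ln s\<bar>" using q12[of ?w] unfolding \<eta>(2) by linarith
    have "\<nu> (p, r) - \<nu> (p, s) = cos p * q1 ?w + sin p * q2 ?w"
      "\<tau> (p, r) - \<tau> (p, s) = cos p * q2 ?w - sin p * q1 ?w"
      unfolding \<nu>_def \<tau>_def fst_conv diff by (simp_all add: algebra_simps)
    with le trig show "\<bar>\<nu> (p, r) - \<nu> (p, s)\<bar> \<le> 2 * e * \<bar>ln r - ln s\<bar>" "\<bar>\<tau> (p, r) - \<tau> (p, s)\<bar> \<le> 2 * e * \<bar>ln r - ln s\<bar>"
      using order_trans by metis+
  qed
  define W where "W z = \<omega> + \<tau> z" for z
  define f where "f z = (a + \<nu> z) / W z" for z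
  \<comment> \<open>The bound of \<open>quotient_perturbation\<close> with \<open>2 * e\<close> as
    Lipschitz constant of \<open>\<nu>\<close> and \<open>\<tau>\<close> in
    \<open>ln r\<close>.\<close>
  define L where "L = 4 / \<omega>\<^sup>2 * ((3 * \<omega> / 2) * (2 * e) + (\<bar>a\<bar> + \<omega> / 2) * (2 * e))"
  have W: "\<omega> / 2 \<le> W (p, r) \<and> W (p, r) \<le> 2 * \<omega>" if "0 < r" "r < r0" for p r
    using \<nu>\<tau>(2)[OF that, of p] e2 \<open>\<omega> > 0\<close> unfolding W_def by linarith
  have cont_ray: "continuous_on T (\<lambda>z. ray v1 v2 (fst z))" for T :: "(real \<times> real) set"
    unfolding ray_def by (intro continuous_intros)
  have contN: "continuous_on (ball 0 \<rho>) N"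
    by (rule lipschitz_on_continuous_on[of \<eta>], rule lipschitz_onI) (use N \<eta>(1) in \<open>auto simp: dist_norm\<close>)
  have cont_n: "continuous_on (UNIV \<times> {0<..<r0}) n"
    unfolding n_def
  proof (intro continuous_on_scaleR continuous_on_inverse continuous_on_snd continuous_on_id
      continuous_on_compose2[OF contN] cont_ray)
    show "(\<lambda>z. snd z *\<^sub>R ray v1 v2 (fst z)) ` (UNIV \<times> {0<..<r0}) \<subseteq> ball 0 \<rho>"
    proof clarsimp
      fix p r assume "0 < r" "r < r0"
      then show "r * norm (ray v1 v2 p) < \<rho>"
        using mult_left_mono[OF ray_le[of p], of r] r0(2)[of r] by linarith
    qed
  qed auto
  have cont_q: "continuous_on (UNIV \<times> {0<..<r0}) (\<lambda>z. q1 (n z))" "continuous_on (UNIV \<times> {0<..<r0}) (\<lambda>z. q2 (n z))"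
    by (intro linear_continuous_on_compose[OF cont_n] q(1,2)[THEN bounded_linear.linear])+
  have contW: "continuous_on (UNIV \<times> {0<..<r0}) W"
    unfolding W_def \<tau>_def by (intro continuous_intros cont_q)
  have "W z \<noteq> 0" if "z \<in> UNIV \<times> {0<..<r0}" for z
    using W[of "snd z" "fst z"] that \<open>\<omega> > 0\<close> by (cases z) auto
  then have contf: "continuous_on (UNIV \<times> {0<..<r0}) f"
    unfolding f_def \<nu>_def by (intro continuous_intros cont_q contW) blast
  show ?thesis
  proof (rule that[OF \<open>r0 > 0\<close> _ _ _ W _ contf contW])
    show "L > 0" unfolding L_def using \<open>\<omega> > 0\<close> e by (intro mult_pos_pos add_pos_nonneg) auto
  next
    fix p r :: real assume r: "0 < r" "r < r0"
    let ?V = "ray v1 v2 p" and ?V' = "ray_normal v1 v2 p"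
    have AV: "A *v ?V = a *\<^sub>R ?V + \<omega> *\<^sub>R ?V'"
      unfolding ray_def ray_normal_def matrix_vector_right_distrib matrix_vector_mult_scaleR A
      by (simp add: algebra_simps)
    have "X (r *\<^sub>R ?V) = A *v (r *\<^sub>R ?V) + N (r *\<^sub>R ?V)" by (simp add: N_def)
    also have "\<dots> = r *\<^sub>R (A *v ?V + n (p, r))"
      using r(1) by (simp add: n_def scaleR_add_right matrix_vector_mult_scaleR)
    also have "n (p, r) = \<nu> (p, r) *\<^sub>R ?V + \<tau> (p, r) *\<^sub>R ?V'"
      unfolding \<nu>_def \<tau>_def fst_conv ray_basis[symmetric] by (rule q(6))
    also have "A *v ?V + (\<nu> (p, r) *\<^sub>R ?V + \<tau> (p, r) *\<^sub>R ?V') = (a + \<nu> (p, r)) *\<^sub>R ?V + W (p, r) *\<^sub>R ?V'"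
      unfolding AV W_def by (simp add: algebra_simps)
    also have "a + \<nu> (p, r) = W (p, r) * f (p, r)"
      using W[OF r, of p] \<open>\<omega> > 0\<close> by (simp add: f_def)
    finally show "X (r *\<^sub>R ?V) = (r * W (p, r)) *\<^sub>R (f (p, r) *\<^sub>R ?V + ?V')"
      by (simp add: scaleR_add_right)
    have "\<bar>f (p, r) - a / \<omega>\<bar> \<le> 4 / \<omega>\<^sup>2 * ((3 * \<omega> / 2) * \<bar>\<nu> (p, r) - 0\<bar> + (\<bar>a\<bar> + \<omega> / 2) * \<bar>\<tau> (p, r) - 0\<bar>)"
      using quotient_perturbation[OF \<open>\<omega> > 0\<close> e2 \<nu>\<tau>(1)[OF r, of p] \<nu>\<tau>(2)[OF r, of p], of 0 0 a] e by (simp add: f_def W_def)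
    also have "\<dots> \<le> 4 / \<omega>\<^sup>2 * ((3 * \<omega> / 2) * e + (\<bar>a\<bar> + \<omega> / 2) * e)"
      using \<nu>\<tau>[OF r, of p] \<open>\<omega> > 0\<close> by (intro mult_left_mono add_mono) auto
    also note ed
    finally show "\<bar>f (p, r) - a / \<omega>\<bar> \<le> d" .
  next
    fix p r s :: real assume rs: "0 < r" "r < r0" "0 < s" "s < r0"
    have "\<bar>f (p, r) - f (p, s)\<bar> \<le> 4 / \<omega>\<^sup>2 * ((3 * \<omega> / 2) * \<bar>\<nu> (p, r) - \<nu> (p, s)\<bar> + (\<bar>a\<bar> + \<omega> / 2) * \<bar>\<tau> (p, r) - \<tau> (p, s)\<bar>)"
      unfolding f_def W_def by (rule quotient_perturbation[OF \<open>\<omega> > 0\<close> e2 \<nu>\<tau>[OF rs(1,2)] \<nu>\<tau>[OF rs(3,4)]])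
    also have "\<dots> \<le> 4 / \<omega>\<^sup>2 * ((3 * \<omega> / 2) * (2 * e * \<bar>ln r - ln s\<bar>) + (\<bar>a\<bar> + \<omega> / 2) * (2 * e * \<bar>ln r - ln s\<bar>))"
      using \<nu>\<tau>_lip[OF rs, of p] \<open>\<omega> > 0\<close> by (intro mult_left_mono add_mono) auto
    also have "\<dots> = L * \<bar>ln r - ln s\<bar>" by (simp add: L_def algebra_simps)
    finally show "\<bar>f (p, r) - f (p, s)\<bar> \<le> L * \<bar>ln r - ln s\<bar>" .
  next
    fix p q r :: real assume "cos p = cos q" "sin p = sin q"
    then show "f (p, r) = f (q, r)" by (simp add: f_def W_def \<nu>_def \<tau>_def n_def ray_def)
  qed
qed

section \<open>Spiral charts for fields of focus-focus type\<close>

lemma exists_spiral_chart: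
  fixes X Y :: field2 and v1 vp vm :: "real^2"
  assumes D: "open D" "0 \<in> D" and XY: "X \<in> C1_fields D" "Y \<in> C1_fields D" "X 0 = 0" "Y 0 = 0"
    and v: "v1 $ 2 = 0" "v1 $ 1 \<noteq> 0" "vp $ 2 > 0" "vm $ 2 > 0"
    and A: "jacobian X (at 0) *v v1 = a *\<^sub>R v1 + \<omega> *\<^sub>R vp" "jacobian X (at 0) *v vp = a *\<^sub>R vp - \<omega> *\<^sub>R v1"
    and B: "jacobian Y (at 0) *v v1 = b *\<^sub>R v1 + \<xi> *\<^sub>R vm" "jacobian Y (at 0) *v vm = b *\<^sub>R vm - \<xi> *\<^sub>R v1"
    and pos: "\<omega> > 0" "\<xi> > 0" and l: "a / \<omega> + b / \<xi> \<noteq> 0"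
  shows "\<exists>U G. spiral_chart D (X, Y) (sgn (a / \<omega> + b / \<xi>)) U G"
proof -
  define l where "l = a / \<omega> + b / \<xi>"
  define k where "k = (b / \<xi> - a / \<omega>) / 2"
  define \<alpha> where "\<alpha> = sgn l"
  have "l \<noteq> 0" using l by (simp add: l_def)
  then have \<alpha>: "\<alpha> = 1 \<or> \<alpha> = -1" "\<alpha> * l = \<bar>l\<bar>" by (auto simp: \<alpha>_def sgn_if)
  \<comment> \<open>Tolerance for the rates: after averaging, both stay within a quarter of
    \<open>\<bar>l\<bar>\<close> of \<open>l / 2\<close>, so they keep the sign of \<open>l\<close>
    and have size at least \<open>\<bar>l\<bar> / 4\<close>.\<close>
  have d: "\<bar>l\<bar> / 4 > 0" using \<open>l \<noteq> 0\<close> by simp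
  have v': "vp $ 2 \<noteq> 0" "vm $ 2 \<noteq> 0" using v by auto
  obtain rp Lp fp Wp where p: "rp > 0" "Lp > 0"
    "\<And>p r. 0 < r \<Longrightarrow> r < rp \<Longrightarrow>
      X (r *\<^sub>R ray v1 vp p) = (r * Wp (p, r)) *\<^sub>R (fp (p, r) *\<^sub>R ray v1 vp p + ray_normal v1 vp p)"
    "\<And>p r. 0 < r \<Longrightarrow> r < rp \<Longrightarrow> \<bar>fp (p, r) - a / \<omega>\<bar> \<le> \<bar>l\<bar> / 4"
    "\<And>p r. 0 < r \<Longrightarrow> r < rp \<Longrightarrow> \<omega> / 2 \<le> Wp (p, r) \<and> Wp (p, r) \<le> 2 * \<omega>"
    "\<And>p r s. 0 < r \<Longrightarrow> r < rp \<Longrightarrow> 0 < s \<Longrightarrow> s < rp \<Longrightarrow> \<bar>fp (p, r) - fp (p, s)\<bar> \<le> Lp * \<bar>ln r - ln s\<bar>"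
    "continuous_on (UNIV \<times> {0<..<rp}) fp" "continuous_on (UNIV \<times> {0<..<rp}) Wp"
    "\<And>p q r. cos p = cos q \<Longrightarrow> sin p = sin q \<Longrightarrow> fp (p, r) = fp (q, r)"
    by (rule focus_polar_form[OF D XY(1,3) v(1,2) v'(1) A pos(1) d]) (rule that)
  obtain rm Lm fm Wm where m: "rm > 0" "Lm > 0"
    "\<And>p r. 0 < r \<Longrightarrow> r < rm \<Longrightarrow>
      Y (r *\<^sub>R ray v1 vm p) = (r * Wm (p, r)) *\<^sub>R (fm (p, r) *\<^sub>R ray v1 vm p + ray_normal v1 vm p)"
    "\<And>p r. 0 < r \<Longrightarrow> r < rm \<Longrightarrow> \<bar>fm (p, r) - b / \<xi>\<bar> \<le> \<bar>l\<bar> / 4"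
    "\<And>p r. 0 < r \<Longrightarrow> r < rm \<Longrightarrow> \<xi> / 2 \<le> Wm (p, r) \<and> Wm (p, r) \<le> 2 * \<xi>"
    "\<And>p r s. 0 < r \<Longrightarrow> r < rm \<Longrightarrow> 0 < s \<Longrightarrow> s < rm \<Longrightarrow> \<bar>fm (p, r) - fm (p, s)\<bar> \<le> Lm * \<bar>ln r - ln s\<bar>"
    "continuous_on (UNIV \<times> {0<..<rm}) fm" "continuous_on (UNIV \<times> {0<..<rm}) Wm"
    "\<And>p q r. cos p = cos q \<Longrightarrow> sin p = sin q \<Longrightarrow> fm (p, r) = fm (q, r)"
    by (rule focus_polar_form[OF D XY(2,4) v(1,2) v'(2) B pos(2) d]) (rule that)
  obtain \<rho>X KX where X_lip: "\<rho>X > 0" "ball 0 \<rho>X \<subseteq> D"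
    "\<And>p q. p \<in> ball 0 \<rho>X \<Longrightarrow> q \<in> ball 0 \<rho>X \<Longrightarrow> norm (X p - X q) \<le> KX * norm (p - q)"
    using C1_field_lipschitz[OF D XY(1)] by blast
  obtain \<rho>Y KY where Y_lip: "\<rho>Y > 0" "ball 0 \<rho>Y \<subseteq> D"
    "\<And>p q. p \<in> ball 0 \<rho>Y \<Longrightarrow> q \<in> ball 0 \<rho>Y \<Longrightarrow> norm (Y p - Y q) \<le> KY * norm (p - q)"
    using C1_field_lipschitz[OF D XY(2)] by blast
  define r0 where "r0 = min rp rm"
  \<comment> \<open>The last bound brings every point of the switching line in the ball within the
    range \<open>r < r0\<close> of the polar forms, from which the crossing condition is
    derived.\<close>
  define \<rho> where "\<rho> = min (min \<rho>X \<rho>Y) (r0 * \<bar>v1 $ 1\<bar>)"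
  define S where "S = norm v1 + norm vp + norm vm"
  \<comment> \<open>The exponential offsets the correction \<open>k arccos (cos p)\<close>, so that
    for \<open>S \<le> 0\<close> the radius stays below \<open>r0\<close> and \<open>P p S\<close>
    in the ball of radius \<open>\<rho>\<close>; the halves make both inequalities strict.\<close>
  define c where "c = min (r0 / 2) (\<rho> / (2 * S)) * exp (- (\<bar>k\<bar> * pi))"
  have "r0 > 0" using p(1) m(1) by (simp add: r0_def)
  then have "\<rho> > 0" using X_lip(1) Y_lip(1) v(2) by (simp add: \<rho>_def)
  have "v1 \<noteq> 0" using v(2) by auto
  then have "S > 0" by (simp add: S_def add_pos_nonneg)
  have "c > 0" using \<open>r0 > 0\<close> \<open>\<rho> > 0\<close> \<open>S > 0\<close> by (simp add: c_def)
  have ce: "c * exp (\<bar>k\<bar> * pi) = min (r0 / 2) (\<rho> / (2 * S))"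
    by (simp add: c_def mult.assoc exp_add[symmetric])
  have cr0: "c * exp (\<bar>k\<bar> * pi) < r0" using ce \<open>r0 > 0\<close> by linarith
  have cS: "c * exp (\<bar>k\<bar> * pi) * S < \<rho>"
  proof -
    have "c * exp (\<bar>k\<bar> * pi) * S \<le> \<rho> / (2 * S) * S"
      unfolding ce using \<open>S > 0\<close> by (intro mult_right_mono) auto
    also have "\<dots> < \<rho>" using \<open>S > 0\<close> \<open>\<rho> > 0\<close> by simp
    finally show ?thesis .
  qed
  \<comment> \<open>Cutting \<open>S\<close> off at 0 extends the coefficients to all real
    \<open>S\<close>, keeps the radius in the range of the polar forms and makes \<open>ln R\<close>
    1-Lipschitz in \<open>S\<close>. Orbits are followed only where \<open>S < 0\<close>, and there
    nothing is changed.\<close>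
  define R where "R z = c * exp (min (snd z) 0 - k * arccos (cos (fst z)))" for z
  have R: "0 < R z" "R z < r0" for z
  proof -
    show "0 < R z" using \<open>c > 0\<close> by (simp add: R_def)
    have arc: "0 \<le> arccos (cos (fst z))" "arccos (cos (fst z)) \<le> pi" by (auto intro: arccos_lbound arccos_ubound)
    have "- k * arccos (cos (fst z)) \<le> \<bar>k\<bar> * arccos (cos (fst z))" by (intro mult_right_mono arc) auto
    also have "\<dots> \<le> \<bar>k\<bar> * pi" by (intro mult_left_mono arc) auto
    finally have "R z \<le> c * exp (\<bar>k\<bar> * pi)" using \<open>c > 0\<close> by (auto simp: R_def)
    then show "R z < r0" using cr0 by linarith
  qed
  then have Rp: "0 < R z" "R z < rp" and Rm: "0 < R z" "R z < rm" for z
    by (simp_all add: r0_def)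
  have lnR: "\<bar>ln (R (q, u)) - ln (R (q, w))\<bar> \<le> \<bar>u - w\<bar>" for q u w
    using \<open>c > 0\<close> by (simp add: R_def ln_mult)
  have contR: "continuous_on UNIV R"
    unfolding R_def by (intro continuous_intros) auto
  define \<Phi> where "\<Phi> f z = f (fst z, R z)" for f :: "real \<times> real \<Rightarrow> real" and z
  have cont: "continuous_on UNIV (\<Phi> f)" if "continuous_on (UNIV \<times> {0<..<r}) f" "r0 \<le> r" for f r
    unfolding \<Phi>_def using R(1) less_le_trans[OF R(2) that(2)]
    by (intro continuous_on_compose2[OF that(1)] continuous_intros contR) auto
  have r0_le: "r0 \<le> rp" "r0 \<le> rm" by (simp_all add: r0_def)
  define F1 where "F1 z = \<Phi> fp z + k" for z
  define F2 where "F2 z = \<Phi> fm z - k" for z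
  have F_near: "\<bar>F1 z - l / 2\<bar> \<le> \<bar>l\<bar> / 4" "\<bar>F2 z - l / 2\<bar> \<le> \<bar>l\<bar> / 4" for z
    using p(4)[OF Rp, of "fst z" z] m(4)[OF Rm, of "fst z" z]
    by (simp_all add: F1_def F2_def \<Phi>_def k_def l_def diff_divide_distrib add_divide_distrib)
  have on_line: "\<exists>r q. 0 < r \<and> r < r0 \<and> \<bar>cos q\<bar> = 1 \<and> z = r *\<^sub>R ray v1 vp q \<and> z = r *\<^sub>R ray v1 vm q \<and> sin q = 0"
    if z: "z \<in> ball 0 \<rho>" "z $ 2 = 0" "z \<noteq> 0" for z
  proof -
    define x where "x = z $ 1 / v1 $ 1"
    define r where "r = \<bar>x\<bar>"
    define q where "q = (if x > 0 then 0 else pi)"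
    have "z $ 1 \<noteq> 0" using z by (auto simp: vec_eq_iff forall_2)
    have "\<bar>z $ 1\<bar> < r0 * \<bar>v1 $ 1\<bar>" using component_le_norm_cart[of z 1] z(1) by (simp add: \<rho>_def)
    then have r: "0 < r" "r < r0" using \<open>z $ 1 \<noteq> 0\<close> v(2) by (auto simp: r_def x_def field_simps)
    have "r * cos q = x" by (auto simp: r_def q_def)
    then have "r * cos q * v1 $ 1 = z $ 1" using v(2) by (simp add: x_def)
    then have "z = r *\<^sub>R (cos q *\<^sub>R v1)" using z(2) v(1) by (simp add: vec_eq_iff forall_2)
    moreover have "sin q = 0" "\<bar>cos q\<bar> = 1" by (auto simp: q_def)
    ultimately show ?thesis using r by (intro exI[of _ r] exI[of _ q]) (simp add: ray_def)
  qed
  define wl wu KK LL where "wl = min \<omega> \<xi>" and "wu = max \<omega> \<xi>" and "KK = max KX KY" and "LL = max Lp Lm"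
  have w_le: "wl \<le> \<omega>" "wl \<le> \<xi>" "\<omega> \<le> wu" "\<xi> \<le> wu" and K_le: "KX \<le> KK" "KY \<le> KK"
    and L_le: "Lp \<le> LL" "Lm \<le> LL"
    by (simp_all add: wl_def wu_def KK_def LL_def)
  have lip: "norm (X x - X y) \<le> KK * norm (x - y)" "norm (Y x - Y y) \<le> KK * norm (x - y)"
    if "x \<in> ball 0 \<rho>" "y \<in> ball 0 \<rho>" for x y
  proof -
    have "norm (X x - X y) \<le> KX * norm (x - y)" "norm (Y x - Y y) \<le> KY * norm (x - y)"
      using that by (auto simp: \<rho>_def intro!: X_lip(3) Y_lip(3))
    moreover have "KX * norm (x - y) \<le> KK * norm (x - y)" "KY * norm (x - y) \<le> KK * norm (x - y)"
      by (intro mult_right_mono; simp add: K_le)+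
    ultimately show "norm (X x - X y) \<le> KK * norm (x - y)" "norm (Y x - Y y) \<le> KK * norm (x - y)"
      by linarith+
  qed
  \<comment> \<open>On the line \<open>ray\<close> has no second component, so those of
    \<open>X\<close> and \<open>Y\<close> come from the turning term alone; both are positive
    multiples of \<open>cos q\<close>.\<close>
  have crossing: "X z $ 2 * Y z $ 2 > 0" if z_line: "z \<in> ball 0 \<rho>" "z $ 2 = 0" "z \<noteq> 0" for z
  proof -
    from on_line[OF z_line] obtain r q where r: "0 < r" "r < rp" "r < rm" and q: "\<bar>cos q\<bar> = 1" "sin q = 0"
      and z: "z = r *\<^sub>R ray v1 vp q" "z = r *\<^sub>R ray v1 vm q"
      by (auto simp: r0_def)
    have comp: "ray v1 u q $ 2 = 0" "ray_normal v1 u q $ 2 = cos q * u $ 2" for u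
      using q v(1) by (simp_all add: ray_def ray_normal_def)
    have Xz: "X z $ 2 = r * Wp (q, r) * (cos q * vp $ 2)"
      unfolding z(1) p(3)[OF r(1,2)] by (simp add: comp)
    have Yz: "Y z $ 2 = r * Wm (q, r) * (cos q * vm $ 2)"
      unfolding z(2) m(3)[OF r(1,3)] by (simp add: comp)
    have "Wp (q, r) > 0" "Wm (q, r) > 0" using p(5)[OF r(1,2), of q] m(5)[OF r(1,3), of q] pos by linarith+
    then have "0 < (r * Wp (q, r) * vp $ 2) * (r * Wm (q, r) * vm $ 2)"
      using v(3,4) r(1) by (intro mult_pos_pos)
    also have "\<dots> = X z $ 2 * Y z $ 2"
      using q(1) unfolding Xz Yz by (cases "cos q \<ge> 0") (simp_all add: abs_if)
    finally show ?thesis .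
  qed
  have contF: "continuous_on UNIV F1" "continuous_on UNIV F2"
    unfolding F1_def F2_def by (intro continuous_intros cont[OF p(7) r0_le(1)] cont[OF m(7) r0_le(2)])+
  have contW: "continuous_on UNIV (\<Phi> Wp)" "continuous_on UNIV (\<Phi> Wm)"
    by (rule cont[OF p(8) r0_le(1)] cont[OF m(8) r0_le(2)])+
  have periodic: "F1 (q, u) = F1 (q', u) \<and> F2 (q, u) = F2 (q', u)"
    if "cos q = cos q'" "sin q = sin q'" for q q' u
    using p(9)[OF that] m(9)[OF that] that(1) by (simp add: F1_def F2_def \<Phi>_def R_def)
  have W_bounds: "wl / 2 \<le> \<Phi> Wp z \<and> \<Phi> Wp z \<le> 2 * wu"
    "wl / 2 \<le> \<Phi> Wm z \<and> \<Phi> Wm z \<le> 2 * wu" for z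
    using p(5)[OF Rp, of "fst z" z] m(5)[OF Rm, of "fst z" z] w_le unfolding \<Phi>_def by linarith+
  have sgn_l: "l \<ge> 0 \<and> \<alpha> = 1 \<or> l \<le> 0 \<and> \<alpha> = -1"
    using \<open>l \<noteq> 0\<close> by (auto simp: \<alpha>_def sgn_if)
  have F_pos: "\<bar>l\<bar> / 4 \<le> \<alpha> * F1 z \<and> \<bar>l\<bar> / 4 \<le> \<alpha> * F2 z" for z
    using sgn_l F_near[of z] by (elim disjE conjE) (simp_all only: mult_1 mult_minus1, linarith+)
  have F_le: "\<bar>F1 z\<bar> \<le> \<bar>l\<bar> \<and> \<bar>F2 z\<bar> \<le> \<bar>l\<bar>" for z
    using F_near[of z] by linarith
  have F_lip: "\<bar>F1 (q, u) - F1 (q, w)\<bar> \<le> LL * \<bar>u - w\<bar> \<and> \<bar>F2 (q, u) - F2 (q, w)\<bar> \<le> LL * \<bar>u - w\<bar>"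
    for q u w
  proof -
    have "\<bar>F1 (q, u) - F1 (q, w)\<bar> \<le> Lp * \<bar>u - w\<bar>" "\<bar>F2 (q, u) - F2 (q, w)\<bar> \<le> Lm * \<bar>u - w\<bar>"
      using order_trans[OF p(6)[OF Rp Rp] mult_left_mono[OF lnR less_imp_le[OF p(2)]], of q q u w]
        order_trans[OF m(6)[OF Rm Rm] mult_left_mono[OF lnR less_imp_le[OF m(2)]], of q q u w]
      by (simp_all add: F1_def F2_def \<Phi>_def)
    moreover have "Lp * \<bar>u - w\<bar> \<le> LL * \<bar>u - w\<bar>" "Lm * \<bar>u - w\<bar> \<le> LL * \<bar>u - w\<bar>"
      by (intro mult_right_mono; simp add: L_le)+
    ultimately show ?thesis by linarith
  qed
  have X_polar: "X (r *\<^sub>R (cos q *\<^sub>R v1 + sin q *\<^sub>R vp)) = (r * \<Phi> Wp (q, u)) *\<^sub>R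
        ((F1 (q, u) - k) *\<^sub>R (cos q *\<^sub>R v1 + sin q *\<^sub>R vp) + (- sin q *\<^sub>R v1 + cos q *\<^sub>R vp))"
    and Y_polar: "Y (r *\<^sub>R (cos q *\<^sub>R v1 + sin q *\<^sub>R vm)) = (r * \<Phi> Wm (q, u)) *\<^sub>R
        ((F2 (q, u) + k) *\<^sub>R (cos q *\<^sub>R v1 + sin q *\<^sub>R vm) + (- sin q *\<^sub>R v1 + cos q *\<^sub>R vm))"
    if u: "u < 0" and r: "r = c * exp (u - k * arccos (cos q))" for q r u
  proof -
    have rR: "R (q, u) = r" unfolding R_def r using u by simp
    have Xr: "X (R (q, u) *\<^sub>R ray v1 vp q) = (R (q, u) * Wp (q, R (q, u))) *\<^sub>R
        (fp (q, R (q, u)) *\<^sub>R ray v1 vp q + ray_normal v1 vp q)" by (rule p(3)[OF Rp])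
    have Yr: "Y (R (q, u) *\<^sub>R ray v1 vm q) = (R (q, u) * Wm (q, R (q, u))) *\<^sub>R
        (fm (q, R (q, u)) *\<^sub>R ray v1 vm q + ray_normal v1 vm q)" by (rule m(3)[OF Rm])
    have F: "F1 (q, u) - k = fp (q, r)" "F2 (q, u) + k = fm (q, r)" "\<Phi> Wp (q, u) = Wp (q, r)" "\<Phi> Wm (q, u) = Wm (q, r)"
      by (simp_all add: F1_def F2_def \<Phi>_def rR)
    show "X (r *\<^sub>R (cos q *\<^sub>R v1 + sin q *\<^sub>R vp)) = (r * \<Phi> Wp (q, u)) *\<^sub>R
        ((F1 (q, u) - k) *\<^sub>R (cos q *\<^sub>R v1 + sin q *\<^sub>R vp) + (- sin q *\<^sub>R v1 + cos q *\<^sub>R vp))"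
      using Xr unfolding F rR ray_def ray_normal_def .
    show "Y (r *\<^sub>R (cos q *\<^sub>R v1 + sin q *\<^sub>R vm)) = (r * \<Phi> Wm (q, u)) *\<^sub>R
        ((F2 (q, u) + k) *\<^sub>R (cos q *\<^sub>R v1 + sin q *\<^sub>R vm) + (- sin q *\<^sub>R v1 + cos q *\<^sub>R vm))"
      using Yr unfolding F rR ray_def ray_normal_def .
  qed
  have in_ball: "(0::real^2) \<in> ball 0 \<rho>" and pos': "LL > 0" "wl / 2 > 0"
    using \<open>\<rho> > 0\<close> p(2) L_le pos by (simp_all add: wl_def)
  interpret piecewise_focus X Y "ball 0 \<rho>" "KK" v1 vp vm k c \<alpha> F1 F2 "\<Phi> Wp" "\<Phi> Wm"
    "LL" "\<bar>l\<bar>" "wl / 2" "2 * wu" "\<bar>l\<bar> / 4"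
    by (intro piecewise_focus.intro planar_pair.intro piecewise_focus_axioms.intro)
      (assumption | rule lip XY(3,4) in_ball crossing v \<open>c > 0\<close> \<alpha>(1) contF contW periodic pos' W_bounds
        d F_pos F_le F_lip X_polar Y_polar)+
  have "U \<subseteq> ball 0 \<rho>"
  proof
    fix z assume "z \<in> U"
    then show "z \<in> ball 0 \<rho>"
    proof (cases rule: U_cases)
      case (2 w)
      define s where "s = \<Psi> (Im w - \<alpha> * Re w) (Im w)"
      have "s < 0" unfolding s_def using 2(1) \<alpha> by (intro \<Psi>_less_zero) auto
      have "norm z \<le> c * exp (\<bar>k\<bar> * pi) * S * exp s"
        using P_norm_le[of "Im w" s] 2(2) by (simp add: Q_def s_def S_def)
      also have "\<dots> \<le> c * exp (\<bar>k\<bar> * pi) * S * 1"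
        using \<open>c > 0\<close> \<open>S > 0\<close> \<open>s < 0\<close> by (intro mult_left_mono) auto
      finally show ?thesis using cS by simp
    qed (use \<open>\<rho> > 0\<close> in simp)
  qed
  moreover have "ball 0 \<rho> \<subseteq> D" using X_lip(2) by (auto simp: \<rho>_def)
  ultimately show ?thesis using spiral_chart_G unfolding \<alpha>_def l_def by blast
qed

section \<open>Eigenvalues\<close>

lemma complex_eigenvalue_char_eq:
  assumes "complex_eigenvalue A \<mu>"
  shows "(complex_of_real (A $ 1 $ 1) - \<mu>) * (complex_of_real (A $ 2 $ 2) - \<mu>) =
    complex_of_real (A $ 1 $ 2) * complex_of_real (A $ 2 $ 1)"
proof -
  let ?a = "complex_of_real (A $ 1 $ 1)" and ?b = "complex_of_real (A $ 1 $ 2)"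
    and ?c = "complex_of_real (A $ 2 $ 1)" and ?d = "complex_of_real (A $ 2 $ 2)"
  obtain v :: "complex^2" where v: "v \<noteq> 0" "map_matrix complex_of_real A *v v = \<mu> *s v"
    using assms by (auto simp: complex_eigenvalue_def)
  have eq: "?a * v $ 1 + ?b * v $ 2 = \<mu> * v $ 1" "?c * v $ 1 + ?d * v $ 2 = \<mu> * v $ 2"
    using v(2) by (simp_all add: vec_eq_iff forall_2 matrix_vector_mult_def sum_2 map_matrix_def)
  have "((?a - \<mu>) * (?d - \<mu>) - ?b * ?c) * v $ 1 = 0" "((?a - \<mu>) * (?d - \<mu>) - ?b * ?c) * v $ 2 = 0"
    using eq by algebra+
  moreover have "v $ 1 \<noteq> 0 \<or> v $ 2 \<noteq> 0" using v(1) by (auto simp: vec_eq_iff forall_2)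
  ultimately show ?thesis by auto
qed

text \<open>The eigenvector is read off from the first row and is nonzero because of
  \<open>A $ 1 $ 2\<close>; the second row then is the characteristic equation.\<close>

lemma complex_eigenvalue_if_char_eq:
  assumes "A $ 1 $ 2 \<noteq> 0"
    and "(complex_of_real (A $ 1 $ 1) - \<mu>) * (complex_of_real (A $ 2 $ 2) - \<mu>) =
      complex_of_real (A $ 1 $ 2) * complex_of_real (A $ 2 $ 1)"
  shows "complex_eigenvalue A \<mu>"
  unfolding complex_eigenvalue_def
proof (intro exI conjI)
  let ?v = "vector [complex_of_real (A $ 1 $ 2), \<mu> - complex_of_real (A $ 1 $ 1)] :: complex^2"
  show "?v \<noteq> 0" using assms(1) by (auto simp: vec_eq_iff forall_2)
  show "map_matrix complex_of_real A *v ?v = \<mu> *s ?v"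
    using assms(2) by (simp add: vec_eq_iff forall_2 matrix_vector_mult_def sum_2 map_matrix_def algebra_simps)
qed

text \<open>The imaginary part of the characteristic equation is \<open>Im \<mu>\<close> times the
  trace relation; the real part then gives the determinant.\<close>

lemma nonreal_eigenvalue:
  assumes "complex_eigenvalue A \<mu>" "\<mu> \<notin> \<real>"
  shows "A $ 1 $ 1 + A $ 2 $ 2 = 2 * Re \<mu>" "det A = (Re \<mu>)\<^sup>2 + (Im \<mu>)\<^sup>2" "Im \<mu> \<noteq> 0"
proof -
  show im: "Im \<mu> \<noteq> 0" using assms(2) by (simp add: complex_is_Real_iff)
  note eq = complex_eigenvalue_char_eq[OF assms(1), unfolded complex_eq_iff]
  from eq have "Im \<mu> * (A $ 1 $ 1 + A $ 2 $ 2 - 2 * Re \<mu>) = 0" by (simp add: algebra_simps)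
  with im show tr: "A $ 1 $ 1 + A $ 2 $ 2 = 2 * Re \<mu>" by simp
  have "(A $ 1 $ 1 - Re \<mu>) * (A $ 2 $ 2 - Re \<mu>) - (Im \<mu>)\<^sup>2 = A $ 1 $ 2 * A $ 2 $ 1"
    using eq by (simp add: power2_eq_square)
  with tr show "det A = (Re \<mu>)\<^sup>2 + (Im \<mu>)\<^sup>2" unfolding det_2 by algebra
qed

text \<open>By trace and determinant, all nonreal eigenvalues of one matrix share their real part
  and the size of their imaginary part, and \<open>ell\<close> depends on nothing else.\<close>

lemma ell_unique:
  assumes "complex_eigenvalue A \<mu>" "complex_eigenvalue A \<mu>'" "complex_eigenvalue B \<nu>" "complex_eigenvalue B \<nu>'"
    and "\<mu> \<notin> \<real>" "\<mu>' \<notin> \<real>" "\<nu> \<notin> \<real>" "\<nu>' \<notin> \<real>"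
  shows "ell \<mu> \<nu> = ell \<mu>' \<nu>'"
proof -
  have *: "Re \<mu> = Re \<mu>' \<and> \<bar>Im \<mu>\<bar> = \<bar>Im \<mu>'\<bar>"
    if "complex_eigenvalue A \<mu>" "complex_eigenvalue A \<mu>'" "\<mu> \<notin> \<real>" "\<mu>' \<notin> \<real>" for A \<mu> \<mu>'
  proof -
    have re: "Re \<mu> = Re \<mu>'" using nonreal_eigenvalue(1)[OF that(1,3)] nonreal_eigenvalue(1)[OF that(2,4)] by simp
    then have "(Im \<mu>)\<^sup>2 = (Im \<mu>')\<^sup>2"
      using nonreal_eigenvalue(2)[OF that(1,3)] nonreal_eigenvalue(2)[OF that(2,4)] by simp
    then have "\<bar>Im \<mu>\<bar> = \<bar>Im \<mu>'\<bar>" by (simp add: power2_eq_iff abs_eq_iff)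
    with re show ?thesis by simp
  qed
  show ?thesis
    using *[OF assms(1,2,5,6)] *[OF assms(3,4,7,8)] assms(5-8)
    by (simp add: ell_def complex_is_Real_iff)
qed

text \<open>The vectors \<open>v1\<close> and \<open>v2\<close> are the real and the negative imaginary part of an eigenvector
  normalised to have its real part on the switching line.\<close>

lemma focus_basis:
  fixes A :: "real^2^2"
  assumes "A $ 1 $ 1 + A $ 2 $ 2 = 2 * a" "det A = a\<^sup>2 + \<omega>\<^sup>2" "\<omega> > 0" "s * A $ 2 $ 1 > 0"
  obtains v2 where "v2 $ 2 > 0" "A *v vector [s, 0] = a *\<^sub>R vector [s, 0] + \<omega> *\<^sub>R v2"
    "A *v v2 = a *\<^sub>R v2 - \<omega> *\<^sub>R vector [s, 0]"
proof
  define v2 :: "real^2" where "v2 = vector [s * (A $ 1 $ 1 - a) / \<omega>, s * A $ 2 $ 1 / \<omega>]"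
  show "v2 $ 2 > 0" using assms by (simp add: v2_def)
  show "A *v vector [s, 0] = a *\<^sub>R vector [s, 0] + \<omega> *\<^sub>R v2"
    using assms(3) by (simp add: v2_def vec_eq_iff forall_2 matrix_vector_mult_def sum_2) (simp add: algebra_simps)
  have A22: "A $ 2 $ 2 = 2 * a - A $ 1 $ 1" using assms(1) by simp
  then have det: "A $ 1 $ 2 * A $ 2 $ 1 = A $ 1 $ 1 * (2 * a - A $ 1 $ 1) - a\<^sup>2 - \<omega>\<^sup>2"
    using assms(2) by (simp add: det_2)
  have "A $ 1 $ 1 * (s * (A $ 1 $ 1 - a) / \<omega>) + A $ 1 $ 2 * (s * A $ 2 $ 1 / \<omega>) =
      s * (A $ 1 $ 1 * (A $ 1 $ 1 - a) + A $ 1 $ 2 * A $ 2 $ 1) / \<omega>"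
    using assms(3) by (simp add: field_simps)
  also have "\<dots> = s * (a * (A $ 1 $ 1 - a) - \<omega> * \<omega>) / \<omega>"
    unfolding det by (simp add: power2_eq_square algebra_simps)
  also have "\<dots> = a * (s * (A $ 1 $ 1 - a) / \<omega>) - \<omega> * s" using assms(3) by (simp add: field_simps)
  finally have "(A *v v2) $ 1 = (a *\<^sub>R v2 - \<omega> *\<^sub>R vector [s, 0]) $ 1"
    by (simp add: v2_def matrix_vector_mult_def sum_2)
  moreover have "(A *v v2) $ 2 = (a *\<^sub>R v2 - \<omega> *\<^sub>R vector [s, 0]) $ 2"
    using assms(3) by (simp add: v2_def matrix_vector_mult_def sum_2 A22 field_simps)
  ultimately show "A *v v2 = a *\<^sub>R v2 - \<omega> *\<^sub>R vector [s, 0]" by (simp add: vec_eq_iff forall_2)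
qed

section \<open>The normal form: Jacobian, eigenvalues and membership in the class\<close>

lemma X_ff_eq: "X_ff \<alpha> = (\<lambda>p. vector [vector [\<alpha>, -1], vector [1, \<alpha>]] *v p)"
  by (simp add: X_ff_def fun_eq_iff vec_eq_iff forall_2 matrix_vector_mult_def sum_2)

lemma Y_ff_eq_X_ff: "Y_ff = X_ff"
  by (simp add: Y_ff_def X_ff_def fun_eq_iff)

lemma jacobian_X_ff: "jacobian (X_ff \<alpha>) (at p) = vector [vector [\<alpha>, -1], vector [1, \<alpha>]]"
  and differentiable_X_ff: "X_ff \<alpha> differentiable (at p)"
proof -
  have der: "(X_ff \<alpha> has_derivative (*v) (vector [vector [\<alpha>, -1], vector [1, \<alpha>]])) (at p)"
    unfolding X_ff_eq by (intro bounded_linear_imp_has_derivative matrix_vector_mul_bounded_linear)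
  then show "X_ff \<alpha> differentiable (at p)" by (rule differentiableI)
  show "jacobian (X_ff \<alpha>) (at p) = vector [vector [\<alpha>, -1], vector [1, \<alpha>]]"
    unfolding jacobian_def frechet_derivative_at[OF der, symmetric] by simp
qed

lemma eigenvalue_X_ff:
  "complex_eigenvalue (vector [vector [\<alpha>, -1], vector [1, \<alpha>]]) \<mu> \<longleftrightarrow> \<mu> = Complex \<alpha> 1 \<or> \<mu> = Complex \<alpha> (-1)"
  (is "complex_eigenvalue ?A \<mu> \<longleftrightarrow> _")
proof -
  have ij: "?A $ 1 $ 1 = \<alpha>" "?A $ 1 $ 2 = -1" "?A $ 2 $ 1 = 1" "?A $ 2 $ 2 = \<alpha>" by simp_all
  have "complex_eigenvalue ?A \<mu> \<longleftrightarrow> (complex_of_real \<alpha> - \<mu>) * (complex_of_real \<alpha> - \<mu>) = -1"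
    using complex_eigenvalue_char_eq[of ?A \<mu>] complex_eigenvalue_if_char_eq[of ?A \<mu>] unfolding ij by auto
  also have "\<dots> \<longleftrightarrow> (\<mu> - Complex \<alpha> 1) * (\<mu> - Complex \<alpha> (-1)) = 0"
    by (simp add: complex_eq_iff algebra_simps)
  finally show ?thesis by simp
qed

lemma ff_in_Omega_ff:
  assumes "\<alpha> \<noteq> 0"
  shows "(X_ff \<alpha>, Y_ff \<alpha>) \<in> Omega_ff D"
proof -
  have C1: "X_ff \<alpha> \<in> C1_fields D"
    by (simp add: C1_fields_def jacobian_X_ff differentiable_X_ff)
  have "eigenvalues (jacobian (X_ff \<alpha>) (at 0)) (Complex \<alpha> 1) (Complex \<alpha> (-1))"
    by (auto simp: eigenvalues_def jacobian_X_ff eigenvalue_X_ff)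
  moreover have "ell (Complex \<alpha> 1) (Complex \<alpha> 1) \<noteq> 0" using assms by (simp add: ell_def)
  moreover have "X_ff \<alpha> 0 = 0" by (simp add: X_ff_eq)
  moreover have "\<alpha> * \<alpha> + 1 > 0" by (simp add: add_nonneg_pos)
  moreover have "Complex \<alpha> 1 \<noteq> Complex \<alpha> (-1)" by simp
  ultimately show ?thesis
    using C1 unfolding Omega_ff_def Omega1_def Omega0_def Omega_def Y_ff_eq_X_ff
    by (auto simp: jacobian_X_ff eigenvalue_X_ff det_2 complex_is_Real_iff intro!: exI)
qed

section \<open>The normal form\<close>

lemma Omega_ff_spiral_chart:
  fixes X Y :: field2
  assumes "open D" "0 \<in> D" and Z: "(X, Y) \<in> Omega_ff D"
    and \<mu>: "complex_eigenvalue (jacobian X (at 0)) \<mu>" and \<nu>: "complex_eigenvalue (jacobian Y (at 0)) \<nu>"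
  shows "ell \<mu> \<nu> \<noteq> 0" and "\<exists>U G. spiral_chart D (X, Y) (sgn (ell \<mu> \<nu>)) U G"
proof -
  let ?A = "jacobian X (at 0)" and ?B = "jacobian Y (at 0)"
  have C1: "X \<in> C1_fields D" "Y \<in> C1_fields D" "X 0 = 0" "Y 0 = 0" and prod: "?A $ 2 $ 1 * ?B $ 2 $ 1 > 0"
    using Z by (auto simp: Omega_ff_def Omega1_def Omega0_def Omega_def)
  have nonreal: "\<And>\<mu>. complex_eigenvalue ?A \<mu> \<Longrightarrow> \<mu> \<notin> \<real>" "\<And>\<nu>. complex_eigenvalue ?B \<nu> \<Longrightarrow> \<nu> \<notin> \<real>"
    using Z by (auto simp: Omega_ff_def)
  obtain \<mu>1 \<mu>2 \<nu>1 \<nu>2 where ev: "eigenvalues ?A \<mu>1 \<mu>2" "eigenvalues ?B \<nu>1 \<nu>2" "ell \<mu>1 \<nu>1 \<noteq> 0"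
    using Z by (auto simp: Omega_ff_def Omega1_def)
  then have "complex_eigenvalue ?A \<mu>1" "complex_eigenvalue ?B \<nu>1"
    unfolding eigenvalues_def by blast+
  with ev(3) show ell: "ell \<mu> \<nu> \<noteq> 0"
    using ell_unique[OF \<mu> _ \<nu>] nonreal \<mu> \<nu> by metis
  note \<mu>_eq = nonreal_eigenvalue[OF \<mu> nonreal(1)[OF \<mu>]] and \<nu>_eq = nonreal_eigenvalue[OF \<nu> nonreal(2)[OF \<nu>]]
  \<comment> \<open>The sense of rotation. With \<open>vector [s, 0]\<close> as first basis vector,
    \<open>vp\<close> and \<open>vm\<close> point upwards and angles increase with time, also for
    clockwise rotation. One \<open>s\<close> serves both fields because the two entries have the
    same sign.\<close>
  define s where "s = sgn (?A $ 2 $ 1)"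
  have s: "s * ?A $ 2 $ 1 > 0" "s * ?B $ 2 $ 1 > 0" "s \<noteq> 0"
    using prod by (auto simp: s_def sgn_if zero_less_mult_iff)
  obtain vp where vp: "vp $ 2 > 0" "?A *v vector [s, 0] = Re \<mu> *\<^sub>R vector [s, 0] + \<bar>Im \<mu>\<bar> *\<^sub>R vp"
    "?A *v vp = Re \<mu> *\<^sub>R vp - \<bar>Im \<mu>\<bar> *\<^sub>R vector [s, 0]"
    using focus_basis[of ?A "Re \<mu>" "\<bar>Im \<mu>\<bar>" s] \<mu>_eq s by auto
  obtain vm where vm: "vm $ 2 > 0" "?B *v vector [s, 0] = Re \<nu> *\<^sub>R vector [s, 0] + \<bar>Im \<nu>\<bar> *\<^sub>R vm"
    "?B *v vm = Re \<nu> *\<^sub>R vm - \<bar>Im \<nu>\<bar> *\<^sub>R vector [s, 0]"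
    using focus_basis[of ?B "Re \<nu>" "\<bar>Im \<nu>\<bar>" s] \<nu>_eq s by auto
  have ell_eq: "ell \<mu> \<nu> = Re \<mu> / \<bar>Im \<mu>\<bar> + Re \<nu> / \<bar>Im \<nu>\<bar>"
    using \<mu>_eq(3) \<nu>_eq(3) by (simp add: ell_def)
  show "\<exists>U G. spiral_chart D (X, Y) (sgn (ell \<mu> \<nu>)) U G"
    unfolding ell_eq
    by (rule exists_spiral_chart[OF assms(1,2) C1 _ _ vp(1) vm(1) vp(2,3) vm(2,3)])
      (use s(3) \<mu>_eq(3) \<nu>_eq(3) ell in \<open>auto simp: ell_eq\<close>)
qed

theorem lemma3p2:
  fixes D :: "(real^2) set" and X Y :: "real^2 \<Rightarrow> real^2"
    and \<mu>p1 \<mu>p2 \<mu>m1 \<mu>m2 :: complex and \<alpha> :: real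
  assumes "open D" and "bounded D" and "0 \<in> D"
    and "(X, Y) \<in> Omega_ff D"
    and "eigenvalues (jacobian X (at 0)) \<mu>p1 \<mu>p2"
    and "eigenvalues (jacobian Y (at 0)) \<mu>m1 \<mu>m2"
    and "\<alpha> = sgn (ell \<mu>p1 \<mu>m1)"
  shows "(X_ff \<alpha>, Y_ff \<alpha>) \<in> Omega_ff D \<and>
         locally_Sigma_equivalent D (X, Y) (X_ff \<alpha>, Y_ff \<alpha>)"
proof
  have ev: "complex_eigenvalue (jacobian X (at 0)) \<mu>p1" "complex_eigenvalue (jacobian Y (at 0)) \<mu>m1"
    using assms(5,6) unfolding eigenvalues_def by blast+
  note chart = Omega_ff_spiral_chart[OF assms(1,3,4) ev, folded assms(7)]
  have \<alpha>: "\<alpha> \<noteq> 0" "sgn \<alpha> = \<alpha>" using chart(1) assms(7) by (simp_all add: sgn_zero_iff)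
  show ff: "(X_ff \<alpha>, Y_ff \<alpha>) \<in> Omega_ff D" using \<alpha>(1) by (rule ff_in_Omega_ff)
  have ev_ff: "complex_eigenvalue (jacobian (X_ff \<alpha>) (at 0)) (Complex \<alpha> 1)"
    "complex_eigenvalue (jacobian (Y_ff \<alpha>) (at 0)) (Complex \<alpha> 1)"
    by (simp_all add: Y_ff_eq_X_ff jacobian_X_ff eigenvalue_X_ff)
  \<comment> \<open>The normal form has \<open>ell\<close> equal to \<open>2 * \<alpha>\<close>, so
    both charts carry the same \<open>\<alpha>\<close>.\<close>
  have "sgn (ell (Complex \<alpha> 1) (Complex \<alpha> 1)) = \<alpha>"
    using \<alpha>(2) by (simp add: ell_def sgn_if split: if_splits)
  then have "\<exists>U G. spiral_chart D (X_ff \<alpha>, Y_ff \<alpha>) \<alpha> U G"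
    using Omega_ff_spiral_chart(2)[OF assms(1,3) ff ev_ff] by simp
  with chart(2) show "locally_Sigma_equivalent D (X, Y) (X_ff \<alpha>, Y_ff \<alpha>)"
    using locally_Sigma_equivalent_spiral_charts by blast
qed

end
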